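(* Let $d\in\mathbb{N}$. (i) Let $\mu\in\mathbb{R}$, $(v_0,v_1)\in H^1(\mathbb{R}^d)\times L^2(\mathbb{R}^d)$, and let $v$ be the solution of $$\partial_t^2 v-\Delta v+\frac{\mu}{(1+t)^2}v=0\ \text{ in }(0,\infty)\times\mathbb{R}^d,\qquad (v(0),\partial_t v(0))=(v_0,v_1).$$ If $\mu<0$, then $$\lim_{t\to\infty}(1+t)^{\frac12-\operatorname{Re}\nu}\|\overrightarrow v(t)\|_{\dot H^1\times L^2}=0.$$ Moreover, for any $\mu\in\mathbb{R}$, $$\begin{cases}\lim_{t\to\infty}(1+t)^{-\frac12-\operatorname{Re}\nu}\|v(t)\|_{L^2}=0 & \text{if }\mu\ne1/4,\\ \lim_{t\to\infty}(1+t)^{-\frac12}\{1+\log(1+t)\}^{-1}\|v(t)\|_{L^2}=0 & \text{if }\mu=1/4.\end{cases}$$ (ii) Let $\mu_1,\mu_2\in\mathbb{R}$, $\mu:=\frac{\mu_1(2-\mu_1)}{4}+\mu_2$, $(u_0,u_1)\in H^1(\mathbb{R}^d)\times L^2(\mathbb{R}^d)$, and let $u$ be the solution of $$\partial_t^2u-\Delta u+\frac{\mu_1}{1+t}\partial_tu+\frac{\mu_2}{(1+t)^2}u=0\ \text{ in }(0,\infty)\times\mathbb{R}^d,\qquad (u(0),\partial_tu(0))=(u_0,u_1).$$ If $\mu<0$, then $$\lim_{t\to\infty}(1+t)^{\frac12-\operatorname{Re}\nu+\frac{\mu_1}{2}}\|\overrightarrow u(t)\|_{\dot H^1\times L^2}=0,$$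 and, for any value of $\mu$, $$\begin{cases}\lim_{t\to\infty}(1+t)^{-\frac12-\operatorname{Re}\nu+\frac{\mu_1}{2}}\|u(t)\|_{L^2}=0 & \text{if }\mu\ne1/4,\\ \lim_{t\to\infty}(1+t)^{-\frac12+\frac{\mu_1}{2}}\{1+\log(1+t)\}^{-1}\|u(t)\|_{L^2}=0 & \text{if }\mu=1/4.\end{cases}$$
   Context: Notation. For $\mu\in\mathbb{R}$ set $\nu:=\frac12\sqrt{1-4\mu}$ if $\mu\le 1/4$ and $\nu:=\frac{i}{2}\sqrt{4\mu-1}$ if $\mu>1/4$ (so $\operatorname{Re}\nu=0$ for $\mu\geq 1/4$). $\overrightarrow v(t):=(v(t),\partial_tv(t))$, $\overrightarrow u(t):=(u(t),\partial_tu(t))$, and $\|(f,g)\|_{\dot H^1\times L^2}$ is the product norm with $\|f\|_{\dot H^1}=\||\xi|\widehat f\,\|_{L^2}$. "The solution" is the unique solution in $C([0,\infty);H^1)\cap C^1([0,\infty);L^2)$; equivalently, for a.e. $\xi$, the spatial Fourier transform of the solution solves the corresponding second-order ODE in $t$ (with $-\Delta$ replaced by $|\xi|^2$) with the transformed data. *)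

theory Defs
  imports "HOL-Analysis.Analysis"
begin

text \<open>
  Elements of function spaces on \<open>\<real>\<^sup>d\<close> are represented by Borel measurable functions
  \<open>'a \<Rightarrow> complex\<close> with \<open>'a\<close> a Euclidean space of dimension \<open>d \<ge> 1\<close>; identities between
  such functions are meant almost everywhere.
\<close>

definition L2 :: "('a::euclidean_space \<Rightarrow> complex) set" where
  "L2 = {f. f \<in> borel_measurable lborel \<and> integrable lborel (\<lambda>x. (cmod (f x))\<^sup>2)}"

definition L2_norm :: "('a::euclidean_space \<Rightarrow> complex) \<Rightarrow> real" where
  "L2_norm f = sqrt (\<integral>x. (cmod (f x))\<^sup>2 \<partial>lborel)"

text \<open>
  The Fourier transform on \<open>L\<^sup>2\<close> with the unitary normalisation: the \<open>L\<^sup>2\<close>-limit, as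
  \<open>R \<rightarrow> \<infinity>\<close>, of the Fourier integrals of the truncations of \<open>f\<close> to the ball of radius \<open>R\<close>
  (these truncations are integrable). The membership clause in \<open>has_fourier\<close> is needed because
  \<open>L2_norm\<close> takes the value 0 on functions that are not square integrable.
\<close>

definition fourier_trunc ::
    "real \<Rightarrow> ('a::euclidean_space \<Rightarrow> complex) \<Rightarrow> 'a \<Rightarrow> complex" where
  "fourier_trunc R f \<xi> =
     of_real ((2 * pi) powr (- real DIM('a) / 2)) *
     (LINT x:cball 0 R|lborel. exp (- \<i> * of_real (x \<bullet> \<xi>)) * f x)"

definition has_fourier ::
    "('a::euclidean_space \<Rightarrow> complex) \<Rightarrow> ('a \<Rightarrow> complex) \<Rightarrow> bool" where
  "has_fourier f g \<longleftrightarrow>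
     g \<in> L2 \<and>
     (\<forall>\<^sub>F R in at_top. (\<lambda>\<xi>. fourier_trunc R f \<xi> - g \<xi>) \<in> L2) \<and>
     ((\<lambda>R. L2_norm (\<lambda>\<xi>. fourier_trunc R f \<xi> - g \<xi>)) \<longlongrightarrow> 0) at_top"

text \<open>The transform is determined only up to a null set, so a representative is chosen.\<close>

definition fourier :: "('a::euclidean_space \<Rightarrow> complex) \<Rightarrow> 'a \<Rightarrow> complex" where
  "fourier f = (SOME g. has_fourier f g)"

definition Hdot1_norm :: "('a::euclidean_space \<Rightarrow> complex) \<Rightarrow> real" where
  "Hdot1_norm f = L2_norm (\<lambda>\<xi>. of_real (norm \<xi>) * fourier f \<xi>)"

definition H1 :: "('a::euclidean_space \<Rightarrow> complex) set" where
  "H1 = {f \<in> L2. (\<lambda>\<xi>. of_real (norm \<xi>) * fourier f \<xi>) \<in> L2}"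

definition H1_norm :: "('a::euclidean_space \<Rightarrow> complex) \<Rightarrow> real" where
  "H1_norm f = sqrt ((L2_norm f)\<^sup>2 + (Hdot1_norm f)\<^sup>2)"

definition Hdot1_L2_norm ::
    "('a::euclidean_space \<Rightarrow> complex) \<Rightarrow> ('a \<Rightarrow> complex) \<Rightarrow> real" where
  "Hdot1_L2_norm f g = sqrt ((Hdot1_norm f)\<^sup>2 + (L2_norm g)\<^sup>2)"

definition cont_H1 :: "(real \<Rightarrow> 'a::euclidean_space \<Rightarrow> complex) \<Rightarrow> bool" where
  "cont_H1 v \<longleftrightarrow>
     (\<forall>t\<ge>0. v t \<in> H1) \<and>
     (\<forall>t\<ge>0. ((\<lambda>s. H1_norm (\<lambda>x. v s x - v t x)) \<longlongrightarrow> 0) (at t within {0..}))"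

text \<open>\<open>v \<in> C\<^sup>1([0,\<infinity>); L\<^sup>2)\<close> with strong time derivative \<open>v'\<close> (one-sided at \<open>t = 0\<close>).\<close>

definition C1_L2 ::
    "(real \<Rightarrow> 'a::euclidean_space \<Rightarrow> complex) \<Rightarrow> (real \<Rightarrow> 'a \<Rightarrow> complex) \<Rightarrow> bool" where
  "C1_L2 v v' \<longleftrightarrow>
     (\<forall>t\<ge>0. v t \<in> L2 \<and> v' t \<in> L2) \<and>
     (\<forall>t\<ge>0. ((\<lambda>s. L2_norm (\<lambda>x. (v s x - v t x) / of_real (s - t) - v' t x)) \<longlongrightarrow> 0)
              (at t within {0..})) \<and>
     (\<forall>t\<ge>0. ((\<lambda>s. L2_norm (\<lambda>x. v' s x - v' t x)) \<longlongrightarrow> 0) (at t within {0..}))"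

text \<open>
  \<open>y'' + k y + b(t) y' + m(t) y = 0\<close> on \<open>(0,\<infinity>)\<close>, with \<open>y\<close> continuously differentiable up to
  \<open>t = 0\<close>.
\<close>

definition solves_ode ::
    "(real \<Rightarrow> real) \<Rightarrow> (real \<Rightarrow> real) \<Rightarrow> real \<Rightarrow> (real \<Rightarrow> complex) \<Rightarrow> (real \<Rightarrow> complex) \<Rightarrow> bool" where
  "solves_ode b m k y y' \<longleftrightarrow>
     (\<forall>t\<ge>0. (y has_vector_derivative y' t) (at t within {0..})) \<and>
     continuous_on {0..} y' \<and>
     (\<forall>t>0. \<exists>y''. (y' has_vector_derivative y'') (at t) \<and>
        y'' + of_real k * y t + of_real (b t) * y' t + of_real (m t) * y t = 0)"

text \<open>
  \<open>v\<close>, with time derivative \<open>v'\<close>, is the solution in \<open>C([0,\<infinity>); H\<^sup>1) \<inter> C\<^sup>1([0,\<infinity>); L\<^sup>2)\<close> of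
  \<open>\<partial>\<^sub>t\<^sup>2 v - \<Delta> v + b(t) \<partial>\<^sub>t v + m(t) v = 0\<close>, \<open>(v(0), \<partial>\<^sub>t v(0)) = (v0, v1)\<close>. The equation is
  imposed on the spatial Fourier transform, for almost every frequency \<open>\<xi>\<close>. Since the transform
  of each \<open>v t\<close> is determined only up to a null set depending on \<open>t\<close>, this requires a choice \<open>w\<close>
  of representatives for all times. The ODE for \<open>w\<close> carries the transformed data, \<open>w 0 \<xi>\<close> and
  its time derivative at 0, by the conditions on \<open>v 0\<close> and \<open>v' 0\<close>.
\<close>

definition wave_solution ::
    "(real \<Rightarrow> real) \<Rightarrow> (real \<Rightarrow> real) \<Rightarrow>
     ('a::euclidean_space \<Rightarrow> complex) \<Rightarrow> ('a \<Rightarrow> complex) \<Rightarrow>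
     (real \<Rightarrow> 'a \<Rightarrow> complex) \<Rightarrow> (real \<Rightarrow> 'a \<Rightarrow> complex) \<Rightarrow> bool" where
  "wave_solution b m v0 v1 v v' \<longleftrightarrow>
     cont_H1 v \<and> C1_L2 v v' \<and>
     (AE x in lborel. v 0 x = v0 x) \<and> (AE x in lborel. v' 0 x = v1 x) \<and>
     (\<exists>w. (\<forall>t\<ge>0. AE \<xi> in lborel. w t \<xi> = fourier (v t) \<xi>) \<and>
          (AE \<xi> in lborel. \<exists>y'. solves_ode b m ((norm \<xi>)\<^sup>2) (\<lambda>t. w t \<xi>) y'))"

definition nu :: "real \<Rightarrow> complex" where
  "nu \<mu> = (if \<mu> \<le> 1/4 then of_real (sqrt (1 - 4 * \<mu>)) / 2
           else \<i> / 2 * of_real (sqrt (4 * \<mu> - 1)))"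

end

theory Submission
  imports Defs "HOL-Probability.Characteristic_Functions" "HOL-Real_Asymp.Real_Asymp"
begin

text \<open>
  By Plancherel everything can be estimated frequency by frequency. In logarithmic time
  \<open>\<tau> = ln (1 + t)\<close> and with \<open>x = (1 + t) powr ((\<mu>\<^sub>1 - 1) / 2) * u\<close>, both equations become
  \<open>x'' + (k e\<^sup>2\<^sup>\<tau> - \<nu>\<^sup>2) x = 0\<close> with \<open>k = |\<xi>|\<^sup>2\<close>. Lyapunov functionals, preceded by a
  perturbation argument as long as \<open>k e\<^sup>2\<^sup>\<tau> \<le> 1\<close>, bound the weighted modes by the data uniformly in \<open>k\<close>;
  this gives a square integrable majorant. For fixed \<open>k > 0\<close> the energy of the wave
  \<open>e\<^sup>\<tau>\<^sup>/\<^sup>2 x\<close>, which carries no damping, is bounded, because \<open>\<mu> / (1 + t)\<^sup>2\<close> is integrable in time; hence each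
  weighted mode tends to zero, and dominated convergence concludes.
\<close>

section \<open>Translations of integrable functions\<close>

text \<open>The weights are the growth of the largest solution at \<open>k = 0\<close>, where
  \<open>x'' = \<nu>\<^sup>2 x\<close> has the solutions exp(\<nu> \<tau>) and exp(-\<nu> \<tau>),
  or 1 and \<tau> when \<nu> = 0. After weighting this mode is bounded but does not decay, and modes
  with small \<open>k\<close> follow it for a long time. So no decay can be uniform in
  \<open>k\<close>; this forces the split into a uniform bound without decay and a decay for fixed
  \<open>k\<close> whose constants degenerate as \<open>k\<close> tends to 0. Frequency zero itself
  is a null set. For \<open>\<mu> \<le> 1/4\<close> the uniform bound has two regimes. Up to the
  time when \<open>k e\<^sup>2\<^sup>\<tau> = 1\<close> the stiffness is a perturbation of free
  growth; afterwards it dominates. A functional divided by the stiffness suits the second regime,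
  but started at time 0 it would cost a factor 1/k, hence the change of method at stiffness 1. For
  fixed \<open>k > 0\<close> the wave energy stays bounded without decaying, so the energy limit
  relies on the weight (1 + t) powr (1/2 - \<nu>) tending to 0, that is on \<mu> < 0. As
  \<open>fourier\<close> selects one of many L2 limits, its isometry and its linearity almost
  everywhere are established beforehand.\<close>

lemma lborel_affine_integrable_integral:
  fixes f :: "'a::euclidean_space \<Rightarrow> 'b::{banach, second_countable_topology}"
  assumes f [measurable]: "f \<in> borel_measurable borel" and c: "c \<noteq> 0"
  shows "integrable lborel (\<lambda>x. f (t + c *\<^sub>R x)) \<longleftrightarrow> integrable lborel f"
    and "(\<integral>x. f (t + c *\<^sub>R x) \<partial>lborel) = (1 / \<bar>c\<bar> ^ DIM('a)) *\<^sub>R (\<integral>x. f x \<partial>lborel)"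
proof -
  let ?T = "\<lambda>x::'a. t + c *\<^sub>R x"
  have eq: "lborel = density (distr lborel borel ?T) (\<lambda>_. ennreal (\<bar>c\<bar> ^ DIM('a)))"
    using lborel_affine[OF c, of t] by simp
  have "integrable lborel f \<longleftrightarrow> integrable (density (distr lborel borel ?T) (\<lambda>_. ennreal (\<bar>c\<bar> ^ DIM('a)))) f"
    using eq by simp
  also have "\<dots> \<longleftrightarrow> integrable lborel (\<lambda>x. \<bar>c\<bar> ^ DIM('a) *\<^sub>R f (?T x))"
    by (subst integrable_density) (simp_all add: integrable_distr_eq)
  also have "\<dots> \<longleftrightarrow> integrable lborel (\<lambda>x. f (?T x))"
  proof
    assume "integrable lborel (\<lambda>x. \<bar>c\<bar> ^ DIM('a) *\<^sub>R f (?T x))"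
    from integrable_scaleR_right[of "1 / \<bar>c\<bar> ^ DIM('a)", OF this] c
    show "integrable lborel (\<lambda>x. f (?T x))" by simp
  qed simp
  finally show "integrable lborel (\<lambda>x. f (t + c *\<^sub>R x)) \<longleftrightarrow> integrable lborel f" ..
  have "(\<integral>x. f x \<partial>lborel) = (\<integral>x. f x \<partial>(density (distr lborel borel ?T) (\<lambda>_. ennreal (\<bar>c\<bar> ^ DIM('a)))))"
    using eq by simp
  also have "\<dots> = \<bar>c\<bar> ^ DIM('a) *\<^sub>R (\<integral>x. f (?T x) \<partial>lborel)"
    by (subst integral_density) (simp_all add: integral_distr)
  finally show "(\<integral>x. f (t + c *\<^sub>R x) \<partial>lborel) = (1 / \<bar>c\<bar> ^ DIM('a)) *\<^sub>R (\<integral>x. f x \<partial>lborel)"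
    using c by simp
qed

lemma lborel_translate:
  fixes f :: "'a::euclidean_space \<Rightarrow> 'b::{banach, second_countable_topology}"
  assumes "f \<in> borel_measurable borel"
  shows "integrable lborel (\<lambda>x. f (x + t)) \<longleftrightarrow> integrable lborel f"
    and "(\<integral>x. f (x + t) \<partial>lborel) = (\<integral>x. f x \<partial>lborel)"
  using lborel_affine_integrable_integral[OF assms, of 1 t] by (simp_all add: add.commute)

text \<open>A point of an open \<open>U\<close> stays in \<open>U\<close> under small translations,
  while a boundary point may enter infinitely often; so only the one-sided difference, over the
  points that leave \<open>U\<close>, tends to zero pointwise. By translation invariance the signed
  difference has integral zero, hence the absolute difference integrates to twice the one-sided
  one.\<close>

lemma integral_indicator_translate_open:
  fixes U :: "'a::euclidean_space set"
  assumes U: "open U" "emeasure lborel U < \<infinity>" and u: "u \<longlonglongrightarrow> 0"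
  shows "(\<lambda>n. \<integral>x. \<bar>indicator U (x + u n) - indicator U x\<bar> \<partial>lborel) \<longlonglongrightarrow> (0::real)"
proof -
  have [measurable]: "U \<in> sets borel" using U by simp
  let ?I = "indicator U :: 'a \<Rightarrow> real"
  have int: "integrable lborel ?I"
    using U by (intro integrable_real_indicator) auto
  have intu: "integrable lborel (\<lambda>x. ?I (x + v))" for v
    using int by (subst lborel_translate) auto
  have conv: "(\<lambda>n. \<integral>x. max 0 (?I x - ?I (x + u n)) \<partial>lborel) \<longlonglongrightarrow> (\<integral>x. 0 \<partial>(lborel :: 'a measure))"
  proof (rule integral_dominated_convergence[where w="?I"])
    show "AE x in lborel. (\<lambda>n. max 0 (?I x - ?I (x + u n))) \<longlonglongrightarrow> 0"
    proof (rule AE_I2)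
      fix x :: 'a
      show "(\<lambda>n. max 0 (?I x - ?I (x + u n))) \<longlonglongrightarrow> 0"
      proof (cases "x \<in> U")
        case True
        have "(\<lambda>n. x + u n) \<longlonglongrightarrow> x + 0" by (intro tendsto_intros u)
        then have "\<forall>\<^sub>F n in sequentially. x + u n \<in> U"
          using True U(1) by (auto simp: tendsto_def)
        then have "\<forall>\<^sub>F n in sequentially. max 0 (?I x - ?I (x + u n)) = 0"
          by eventually_elim (auto split: split_indicator)
        then show ?thesis by (rule tendsto_eventually)
      next
        case False
        then have "max 0 (?I x - ?I (x + u n)) = 0" for n by (auto split: split_indicator)
        then show ?thesis by simp
      qed
    qed
  qed (use int in \<open>auto split: split_indicator\<close>)
  have "(\<integral>x. \<bar>?I (x + v) - ?I x\<bar> \<partial>lborel) = 2 * (\<integral>x. max 0 (?I x - ?I (x + v)) \<partial>lborel)" for v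
  proof -
    have im: "integrable lborel (\<lambda>x. max 0 (?I x - ?I (x + v)))"
      by (rule Bochner_Integration.integrable_bound[OF int]) (auto split: split_indicator)
    have "(\<integral>x. \<bar>?I (x + v) - ?I x\<bar> \<partial>lborel) =
        (\<integral>x. (?I (x + v) - ?I x) + 2 * max 0 (?I x - ?I (x + v)) \<partial>lborel)"
      by (rule Bochner_Integration.integral_cong) (auto split: split_indicator)
    also have "\<dots> = 2 * (\<integral>x. max 0 (?I x - ?I (x + v)) \<partial>lborel)"
      using int intu im lborel_translate(2)[of ?I v]
      by simp
    finally show ?thesis .
  qed
  then show ?thesis
    using tendsto_mult_left[OF conv, of 2] by simp
qed

lemma integral_norm_triangle_translate:
  fixes f g :: "'a::euclidean_space \<Rightarrow> 'b::{banach, second_countable_topology}"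
  assumes f: "integrable lborel f" and g: "integrable lborel g"
  shows "(\<integral>x. norm (f (x + t) - f x) \<partial>lborel) \<le>
    2 * (\<integral>x. norm (f x - g x) \<partial>lborel) + (\<integral>x. norm (g (x + t) - g x) \<partial>lborel)"
proof -
  note [measurable] = borel_measurable_integrable[OF f] borel_measurable_integrable[OF g]
  have d: "integrable lborel (\<lambda>x. norm (f x - g x))" using f g by simp
  have m: "f \<in> borel_measurable borel" "g \<in> borel_measurable borel" by measurable
  have gt: "integrable lborel (\<lambda>x. g (x + t))" "integrable lborel (\<lambda>x. f (x + t))"
    using f g m by (simp_all add: lborel_translate)
  have "(\<integral>x. norm (f (x + t) - f x) \<partial>lborel) \<le>
     (\<integral>x. norm (f (x + t) - g (x + t)) + norm (f x - g x) + norm (g (x + t) - g x) \<partial>lborel)"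
  proof (rule integral_mono)
    have "norm (a - b) \<le> norm (a - c) + norm (b - d) + norm (c - d)" for a b c d :: 'b
      using norm_triangle_ineq4[of "a - c" "b - d"] norm_triangle_ineq[of "a - c - (b - d)" "c - d"] by simp
    then show "norm (f (x + t) - f x) \<le> norm (f (x + t) - g (x + t)) + norm (f x - g x) + norm (g (x + t) - g x)" for x
      by blast
  qed (use f g gt in auto)
  also have "\<dots> = 2 * (\<integral>x. norm (f x - g x) \<partial>lborel) + (\<integral>x. norm (g (x + t) - g x) \<partial>lborel)"
    using f g gt lborel_translate(2)[of "\<lambda>x. norm (f x - g x)" t] by simp
  finally show ?thesis .
qed

text \<open>\<open>approx\<close> closes the property under L1 approximation. Outer regularity
  carries it from open sets to measurable sets of finite measure, and induction over integrable
  functions does the rest. It later yields continuity at 0 of the autocorrelation of a bounded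
  function.\<close>

lemma L1_translation_continuous:
  fixes f :: "'a::euclidean_space \<Rightarrow> 'b::{banach, second_countable_topology}"
  assumes f: "integrable lborel f" and u: "u \<longlonglongrightarrow> 0"
  shows "(\<lambda>n. \<integral>x. norm (f (x + u n) - f x) \<partial>lborel) \<longlonglongrightarrow> 0"
proof -
  have approx: "(\<lambda>n. \<integral>x. norm (f (x + u n) - f x) \<partial>lborel) \<longlonglongrightarrow> 0"
    if f: "integrable lborel f"
    and ex: "\<And>e. e > 0 \<Longrightarrow> \<exists>g. integrable lborel g \<and> (\<integral>x. norm (f x - g x) \<partial>lborel) \<le> e \<and>
      (\<lambda>n. \<integral>x. norm (g (x + u n) - g x) \<partial>lborel) \<longlonglongrightarrow> 0"
    for f :: "'a \<Rightarrow> 'b"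
  proof (rule LIMSEQ_I)
    fix e :: real assume e: "e > 0"
    obtain g where g: "integrable lborel g" "(\<integral>x. norm (f x - g x) \<partial>lborel) \<le> e / 4"
      "(\<lambda>n. \<integral>x. norm (g (x + u n) - g x) \<partial>lborel) \<longlonglongrightarrow> 0"
      using ex[of "e / 4"] e by auto
    obtain N where N: "\<And>n. n \<ge> N \<Longrightarrow> norm ((\<integral>x. norm (g (x + u n) - g x) \<partial>lborel) - 0) < e / 2"
      using LIMSEQ_D[OF g(3), of "e / 2"] e by auto
    have "norm ((\<integral>x. norm (f (x + u n) - f x) \<partial>lborel) - 0) < e" if "n \<ge> N" for n
    proof -
      have "0 \<le> (\<integral>x. norm (f (x + u n) - f x) \<partial>lborel)" by (rule integral_nonneg_AE) simp
      then show ?thesis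
        using N[OF that] integral_norm_triangle_translate[OF f g(1), of "u n"] g(2) by simp
    qed
    then show "\<exists>N. \<forall>n\<ge>N. norm ((\<integral>x. norm (f (x + u n) - f x) \<partial>lborel) - 0) < e" by blast
  qed
  show ?thesis using f
  proof (induction rule: integrable_induct)
    case (base A c)
    have [measurable]: "A \<in> sets borel" using base by simp
    show ?case
    proof (rule approx)
      show "integrable lborel (\<lambda>x. indicator A x *\<^sub>R c)" using base by simp
      fix e :: real assume e: "e > 0"
      \<comment> \<open>The \<open>+ 1\<close> keeps the quotient meaningful when
        \<open>c = 0\<close>.\<close>
      define d where "d = e / (norm c + 1)"
      have d: "d > 0" using e by (auto simp: d_def intro!: divide_pos_pos add_nonneg_pos)
      obtain U where U: "open U" "A \<subseteq> U" "emeasure lborel (U - A) < d"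
        using outer_regular_lborel[OF _ d, of A] by auto
      have [measurable]: "U \<in> sets borel" using U by simp
      have "emeasure lborel U = emeasure lborel A + emeasure lborel (U - A)"
        using U(2) by (subst plus_emeasure) (auto simp: Un_absorb1)
      also have "\<dots> < \<infinity>" using base U(3) by (simp add: less_top[symmetric]) (metis ennreal_less_top order_less_trans less_irrefl)
      finally have Uf: "emeasure lborel U < \<infinity>" .
      have "(\<integral>x. norm (indicator A x *\<^sub>R c - indicator U x *\<^sub>R c) \<partial>lborel) =
          (\<integral>x. indicator (U - A) x * norm c \<partial>lborel)"
        using U(2) by (intro Bochner_Integration.integral_cong) (auto split: split_indicator)
      also have "\<dots> = measure lborel (U - A) * norm c" by simp
      also have "\<dots> \<le> d * (norm c + 1)"
        using U(3) d by (intro mult_mono) (auto simp: measure_def intro!: enn2real_leI)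
      also have "\<dots> = e" by (simp add: d_def add_nonneg_eq_0_iff)
      finally have 1: "(\<integral>x. norm (indicator A x *\<^sub>R c - indicator U x *\<^sub>R c) \<partial>lborel) \<le> e" .
      have "(\<lambda>n. (\<integral>x. \<bar>indicator U (x + u n) - indicator U x\<bar> \<partial>lborel) * norm c) \<longlonglongrightarrow> 0 * norm c"
        by (intro tendsto_mult integral_indicator_translate_open U Uf u tendsto_const)
      moreover have "(\<integral>x. \<bar>indicator U (x + u n) - indicator U x\<bar> \<partial>lborel) * norm c =
         (\<integral>x. norm (indicator U (x + u n) *\<^sub>R c - indicator U x *\<^sub>R c) \<partial>lborel)" for n
        by (simp flip: scaleR_diff_left)
      ultimately have 2: "(\<lambda>n. \<integral>x. norm (indicator U (x + u n) *\<^sub>R c - indicator U x *\<^sub>R c) \<partial>lborel) \<longlonglongrightarrow> 0"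
        by simp
      show "\<exists>g. integrable lborel g \<and> (\<integral>x. norm (indicator A x *\<^sub>R c - g x) \<partial>lborel) \<le> e \<and>
         (\<lambda>n. \<integral>x. norm (g (x + u n) - g x) \<partial>lborel) \<longlonglongrightarrow> 0"
        using 1 2 Uf by (intro exI[of _ "\<lambda>x. indicator U x *\<^sub>R c"]) auto
    qed
  next
    case (add f g)
    note [measurable] = borel_measurable_integrable[OF add(1)] borel_measurable_integrable[OF add(2)]
    have m: "f \<in> borel_measurable borel" "g \<in> borel_measurable borel" by measurable
    have t: "integrable lborel (\<lambda>x. g (x + t))" "integrable lborel (\<lambda>x. f (x + t))" for t
      using add m by (simp_all add: lborel_translate)
    have "(\<lambda>n. (\<integral>x. norm (f (x + u n) - f x) \<partial>lborel) + (\<integral>x. norm (g (x + u n) - g x) \<partial>lborel)) \<longlonglongrightarrow> 0 + 0"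
      using add by (intro tendsto_add)
    then have l: "(\<lambda>n. (\<integral>x. norm (f (x + u n) - f x) \<partial>lborel) + (\<integral>x. norm (g (x + u n) - g x) \<partial>lborel)) \<longlonglongrightarrow> 0"
      by simp
    show ?case
    proof (rule tendsto_sandwich[OF _ _ tendsto_const l])
      show "\<forall>\<^sub>F n in sequentially. (\<integral>x. norm (f (x + u n) + g (x + u n) - (f x + g x)) \<partial>lborel)
         \<le> (\<integral>x. norm (f (x + u n) - f x) \<partial>lborel) + (\<integral>x. norm (g (x + u n) - g x) \<partial>lborel)"
      proof (rule always_eventually, rule allI)
        fix n
        have "(\<integral>x. norm (f (x + u n) + g (x + u n) - (f x + g x)) \<partial>lborel)
         \<le> (\<integral>x. norm (f (x + u n) - f x) + norm (g (x + u n) - g x) \<partial>lborel)"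
          using add t by (intro integral_mono) (auto simp: add_diff_add intro: norm_triangle_ineq)
        then show "(\<integral>x. norm (f (x + u n) + g (x + u n) - (f x + g x)) \<partial>lborel)
         \<le> (\<integral>x. norm (f (x + u n) - f x) \<partial>lborel) + (\<integral>x. norm (g (x + u n) - g x) \<partial>lborel)"
          using add t by simp
      qed
    qed auto
  next
    case (lim f s)
    show ?case
    proof (rule approx[OF lim.hyps(4)])
      fix e :: real assume e: "e > 0"
      note [measurable] = borel_measurable_integrable[OF lim.hyps(4)] borel_measurable_integrable[OF lim.hyps(1)]
      have "(\<lambda>i. \<integral>x. norm (f x - s i x) \<partial>lborel) \<longlonglongrightarrow> (\<integral>x. 0 \<partial>(lborel :: 'a measure))"
      \<comment> \<open>The approximants are bounded by \<open>2 * norm (f x)\<close>; the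
        difference adds one more \<open>norm (f x)\<close>.\<close>
      proof (rule integral_dominated_convergence[where w="\<lambda>x. 3 * norm (f x)"])
        show "AE x in lborel. (\<lambda>i. norm (f x - s i x)) \<longlonglongrightarrow> 0"
        proof (rule AE_I2)
          fix x :: 'a
          have "(\<lambda>i. norm (f x - s i x)) \<longlonglongrightarrow> norm (f x - f x)"
            using lim.hyps(2)[of x] by (intro tendsto_intros) auto
          then show "(\<lambda>i. norm (f x - s i x)) \<longlonglongrightarrow> 0" by simp
        qed
        show "AE x in lborel. norm (norm (f x - s i x)) \<le> 3 * norm (f x)" for i
        proof (rule AE_I2)
          fix x
          show "norm (norm (f x - s i x)) \<le> 3 * norm (f x)"
            using lim.hyps(3)[of x i] norm_triangle_ineq4[of "f x" "s i x"] by simp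
        qed
      qed (use lim in auto)
      then have "(\<lambda>i. \<integral>x. norm (f x - s i x) \<partial>lborel) \<longlonglongrightarrow> 0" by simp
      then obtain i where i: "norm ((\<integral>x. norm (f x - s i x) \<partial>lborel) - 0) < e"
        using e LIMSEQ_D by blast
      show "\<exists>g. integrable lborel g \<and> (\<integral>x. norm (f x - g x) \<partial>lborel) \<le> e \<and>
         (\<lambda>n. \<integral>x. norm (g (x + u n) - g x) \<partial>lborel) \<longlonglongrightarrow> 0"
        using i lim by (intro exI[of _ "s i"]) auto
    qed
  qed
qed

section \<open>The space of square integrable functions\<close>

lemma L2_measurable: "f \<in> L2 \<Longrightarrow> f \<in> borel_measurable borel"
  by (simp add: L2_def)

lemma L2_integrable: "f \<in> L2 \<Longrightarrow> integrable lborel (\<lambda>x. (cmod (f x))\<^sup>2)"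
  by (simp add: L2_def)

lemma L2_norm_nonneg [simp]: "L2_norm f \<ge> 0"
  by (simp add: L2_norm_def)

lemma L2_norm_power2: "(L2_norm f)\<^sup>2 = (\<integral>x. (cmod (f x))\<^sup>2 \<partial>lborel)"
  unfolding L2_norm_def by (intro real_sqrt_pow2 integral_nonneg_AE) auto

lemma L2_nn_integral: "f \<in> L2 \<Longrightarrow> (\<integral>\<^sup>+x. ennreal ((cmod (f x))\<^sup>2) \<partial>lborel) = ennreal ((L2_norm f)\<^sup>2)"
  unfolding L2_norm_power2 by (intro nn_integral_eq_integral L2_integrable) auto

text \<open>A bound on \<open>L2_norm\<close> alone says nothing about membership, as the integral
  defaults to 0. The extended integral delivers membership and bound together.\<close>

lemma L2_I_nn:
  assumes [measurable]: "f \<in> borel_measurable borel"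
    and le: "(\<integral>\<^sup>+x. ennreal ((cmod (f x))\<^sup>2) \<partial>lborel) \<le> ennreal (B\<^sup>2)" and B: "B \<ge> 0"
  shows "f \<in> L2" "L2_norm f \<le> B"
proof -
  have int: "integrable lborel (\<lambda>x. (cmod (f x))\<^sup>2)"
    using le by (intro integrableI_bounded) (auto simp: order_le_less_trans)
  then show f: "f \<in> L2" by (simp add: L2_def)
  have "ennreal ((L2_norm f)\<^sup>2) \<le> ennreal (B\<^sup>2)" using le L2_nn_integral[OF f] by simp
  then show "L2_norm f \<le> B" using B by (simp add: power2_le_iff_abs_le)
qed

lemma L2_bounded:
  assumes g: "g \<in> L2" and [measurable]: "f \<in> borel_measurable borel"
    and le: "AE x in lborel. cmod (f x) \<le> C * cmod (g x)"
  shows "f \<in> L2"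
proof -
  have "integrable lborel (\<lambda>x. C\<^sup>2 * (cmod (g x))\<^sup>2)" using L2_integrable[OF g] by simp
  then have "integrable lborel (\<lambda>x. (cmod (f x))\<^sup>2)"
  proof (rule Bochner_Integration.integrable_bound)
    show "AE x in lborel. norm ((cmod (f x))\<^sup>2) \<le> norm (C\<^sup>2 * (cmod (g x))\<^sup>2)"
      using le
    proof eventually_elim
      case (elim x)
      then have "(cmod (f x))\<^sup>2 \<le> (C * cmod (g x))\<^sup>2" by (intro power_mono) auto
      also have "(C * cmod (g x))\<^sup>2 = norm (C\<^sup>2 * (cmod (g x))\<^sup>2)"
        unfolding power_mult_distrib by simp
      finally show ?case by simp
    qed
    show "(\<lambda>x. (cmod (f x))\<^sup>2) \<in> borel_measurable lborel" by measurable
  qed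
  then show ?thesis by (simp add: L2_def)
qed

lemma L2_cmult: "f \<in> L2 \<Longrightarrow> (\<lambda>x. c * f x) \<in> L2"
  using L2_measurable[of f] by (rule_tac L2_bounded[of f _ "cmod c"]) (auto simp: norm_mult)

lemma L2_norm_cmult: "L2_norm (\<lambda>x. c * f x) = cmod c * L2_norm f"
  unfolding L2_norm_def by (simp add: norm_mult power_mult_distrib real_sqrt_mult)

lemma L2_norm_cong_AE:
  assumes "f \<in> borel_measurable borel" "g \<in> borel_measurable borel" "AE x in lborel. f x = g x"
  shows "L2_norm f = L2_norm g"
proof -
  have "(\<integral>x. (cmod (f x))\<^sup>2 \<partial>lborel) = (\<integral>x. (cmod (g x))\<^sup>2 \<partial>lborel)"
    using assms by (intro integral_cong_AE) auto
  then show ?thesis by (simp add: L2_norm_def)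
qed

text \<open>Minkowski's inequality by expanding the square and applying Cauchy-Schwarz to the mixed
  term, all in extended integrals so that square integrability of the sum need not be known
  beforehand.\<close>

lemma L2_add:
  assumes f: "f \<in> L2" and g: "g \<in> L2"
  shows "(\<lambda>x. f x + g x) \<in> L2" "L2_norm (\<lambda>x. f x + g x) \<le> L2_norm f + L2_norm g"
proof -
  note [measurable] = L2_measurable[OF f] L2_measurable[OF g]
  define F where "F = (\<integral>\<^sup>+x. ennreal (cmod (f x)) * ennreal (cmod (g x)) \<partial>lborel)"
  have "F\<^sup>2 \<le> (\<integral>\<^sup>+x. (ennreal (cmod (f x)))\<^sup>2 \<partial>lborel) * (\<integral>\<^sup>+x. (ennreal (cmod (g x)))\<^sup>2 \<partial>lborel)"
    unfolding F_def by (rule Cauchy_Schwarz_nn_integral) simp_all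
  also have "\<dots> = ennreal ((L2_norm f)\<^sup>2) * ennreal ((L2_norm g)\<^sup>2)"
    by (simp add: L2_nn_integral f g ennreal_power)
  also have "\<dots> = (ennreal (L2_norm f * L2_norm g))\<^sup>2"
    by (simp add: ennreal_power power_mult_distrib flip: ennreal_mult)
  finally have F2: "F\<^sup>2 \<le> (ennreal (L2_norm f * L2_norm g))\<^sup>2" .
  have F: "F \<le> ennreal (L2_norm f * L2_norm g)"
  \<comment> \<open>Squares are cancelled among finite values; an infinite \<open>F\<close>
    contradicts the finite product of the two norms.\<close>
  proof (cases F)
    case (real r)
    then have "r\<^sup>2 \<le> (L2_norm f * L2_norm g)\<^sup>2" using F2 by (simp add: ennreal_power)
    then have "r \<le> L2_norm f * L2_norm g" by (rule power2_le_imp_le) simp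
    then show ?thesis using real by (simp add: ennreal_leI)
  next
    case top
    then have "ennreal (L2_norm f * L2_norm g) * ennreal (L2_norm f * L2_norm g) = top"
      using F2 by (simp add: top_unique power2_eq_square)
    then show ?thesis by (simp flip: ennreal_mult)
  qed
  have "(\<integral>\<^sup>+x. ennreal ((cmod (f x + g x))\<^sup>2) \<partial>lborel) \<le>
     (\<integral>\<^sup>+x. ennreal ((cmod (f x))\<^sup>2) + (2 * (ennreal (cmod (f x)) * ennreal (cmod (g x))) + ennreal ((cmod (g x))\<^sup>2)) \<partial>lborel)"
  proof (rule nn_integral_mono)
    fix x
    have "(cmod (f x + g x))\<^sup>2 \<le> (cmod (f x) + cmod (g x))\<^sup>2"
      by (intro power_mono norm_triangle_ineq) auto
    also have "\<dots> = (cmod (f x))\<^sup>2 + (2 * (cmod (f x) * cmod (g x)) + (cmod (g x))\<^sup>2)"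
      by (simp add: power2_sum)
    finally have "ennreal ((cmod (f x + g x))\<^sup>2) \<le> ennreal ((cmod (f x))\<^sup>2 + (2 * (cmod (f x) * cmod (g x)) + (cmod (g x))\<^sup>2))"
      by (rule ennreal_leI)
    then show "ennreal ((cmod (f x + g x))\<^sup>2) \<le> ennreal ((cmod (f x))\<^sup>2) + (2 * (ennreal (cmod (f x)) * ennreal (cmod (g x))) + ennreal ((cmod (g x))\<^sup>2))"
      by (simp add: ennreal_plus ennreal_mult)
  qed
  also have "\<dots> = ennreal ((L2_norm f)\<^sup>2) + (2 * F + ennreal ((L2_norm g)\<^sup>2))"
    unfolding F_def by (simp add: nn_integral_add nn_integral_cmult L2_nn_integral f g)
  also have "\<dots> \<le> ennreal ((L2_norm f)\<^sup>2) + (2 * ennreal (L2_norm f * L2_norm g) + ennreal ((L2_norm g)\<^sup>2))"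
    using F by (intro add_mono mult_left_mono) auto
  also have "\<dots> = ennreal ((L2_norm f)\<^sup>2) + (ennreal (2 * (L2_norm f * L2_norm g)) + ennreal ((L2_norm g)\<^sup>2))"
    by (subst (2) ennreal_mult) auto
  also have "\<dots> = ennreal ((L2_norm f)\<^sup>2 + (2 * (L2_norm f * L2_norm g) + (L2_norm g)\<^sup>2))"
    by (subst ennreal_plus[symmetric], simp, simp, subst ennreal_plus[symmetric], simp_all)
  also have "(L2_norm f)\<^sup>2 + (2 * (L2_norm f * L2_norm g) + (L2_norm g)\<^sup>2) = (L2_norm f + L2_norm g)\<^sup>2"
    by (simp add: power2_sum)
  finally have *: "(\<integral>\<^sup>+x. ennreal ((cmod (f x + g x))\<^sup>2) \<partial>lborel) \<le> ennreal ((L2_norm f + L2_norm g)\<^sup>2)" .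
  show "(\<lambda>x. f x + g x) \<in> L2" "L2_norm (\<lambda>x. f x + g x) \<le> L2_norm f + L2_norm g"
    by (rule L2_I_nn[OF _ *]; simp)+
qed

lemma L2_diff:
  assumes f: "f \<in> L2" and g: "g \<in> L2"
  shows "(\<lambda>x. f x - g x) \<in> L2" "L2_norm (\<lambda>x. f x - g x) \<le> L2_norm f + L2_norm g"
  using L2_add[OF f L2_cmult[OF g, of "- 1"]] L2_norm_cmult[of "- 1" g] by simp_all

lemma L2_norm_minus_commute: "L2_norm (\<lambda>x. f x - g x) = L2_norm (\<lambda>x. g x - f x)"
  unfolding L2_norm_def by (simp add: norm_minus_commute)

lemma L2_norm_triangle:
  assumes "f \<in> L2" "g \<in> L2" "h \<in> L2"
  shows "L2_norm (\<lambda>x. f x - h x) \<le> L2_norm (\<lambda>x. f x - g x) + L2_norm (\<lambda>x. g x - h x)"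
  using L2_add(2)[OF L2_diff(1)[OF assms(1,2)] L2_diff(1)[OF assms(2,3)]] by simp

lemma L2_norm_diff_le:
  assumes "f \<in> L2" "g \<in> L2"
  shows "\<bar>L2_norm f - L2_norm g\<bar> \<le> L2_norm (\<lambda>x. f x - g x)"
  using L2_add(2)[OF L2_diff(1)[OF assms] assms(2)] L2_add(2)[OF L2_diff(1)[OF assms(2,1)] assms(1)]
    L2_norm_minus_commute[of f g] by simp

lemma L2_norm_tendsto:
  assumes "\<forall>\<^sub>F n in F. f n \<in> L2" "g \<in> L2" "((\<lambda>n. L2_norm (\<lambda>x. f n x - g x)) \<longlongrightarrow> 0) F"
  shows "((\<lambda>n. L2_norm (f n)) \<longlongrightarrow> L2_norm g) F"
proof -
  have "((\<lambda>n. L2_norm (f n) - L2_norm g) \<longlongrightarrow> 0) F"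
  proof (rule Lim_null_comparison[OF _ assms(3)])
    show "\<forall>\<^sub>F n in F. norm (L2_norm (f n) - L2_norm g) \<le> L2_norm (\<lambda>x. f n x - g x)"
      using assms(1) by eventually_elim (simp add: L2_norm_diff_le assms(2))
  qed
  then show ?thesis by (simp add: LIM_zero_iff)
qed

text \<open>Serves where no dominating function is at hand: for the limit in the completeness proof,
  and for passing from bounded to unbounded functions in Plancherel's theorem.\<close>

lemma L2_Fatou:
  assumes f: "\<And>n. f n \<in> L2" "\<forall>\<^sub>F n in sequentially. L2_norm (f n) \<le> B" and B: "B \<ge> 0"
    and g [measurable]: "g \<in> borel_measurable borel" and lim: "AE x in lborel. (\<lambda>n. f n x) \<longlonglongrightarrow> g x"
  shows "g \<in> L2" "L2_norm g \<le> B"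
proof -
  note [measurable] = L2_measurable[OF f(1)]
  have "(\<integral>\<^sup>+x. ennreal ((cmod (g x))\<^sup>2) \<partial>lborel) = (\<integral>\<^sup>+x. liminf (\<lambda>n. ennreal ((cmod (f n x))\<^sup>2)) \<partial>lborel)"
  proof (rule nn_integral_cong_AE)
    show "AE x in lborel. ennreal ((cmod (g x))\<^sup>2) = liminf (\<lambda>n. ennreal ((cmod (f n x))\<^sup>2))"
      using lim
    proof eventually_elim
      case (elim x)
      then have "(\<lambda>n. ennreal ((cmod (f n x))\<^sup>2)) \<longlonglongrightarrow> ennreal ((cmod (g x))\<^sup>2)"
        by (intro tendsto_intros)
      from lim_imp_Liminf[OF _ this] show ?case by simp
    qed
  qed
  also have "\<dots> \<le> liminf (\<lambda>n. \<integral>\<^sup>+x. ennreal ((cmod (f n x))\<^sup>2) \<partial>lborel)"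
    by (rule nn_integral_liminf) simp
  also have "\<dots> \<le> ennreal (B\<^sup>2)"
  proof (rule Liminf_le)
    show "\<forall>\<^sub>F n in sequentially. (\<integral>\<^sup>+x. ennreal ((cmod (f n x))\<^sup>2) \<partial>lborel) \<le> ennreal (B\<^sup>2)"
      using f(2) by eventually_elim (auto simp: L2_nn_integral f(1) intro!: ennreal_leI power_mono)
  qed simp
  finally have *: "(\<integral>\<^sup>+x. ennreal ((cmod (g x))\<^sup>2) \<partial>lborel) \<le> ennreal (B\<^sup>2)" .
  show "g \<in> L2" "L2_norm g \<le> B"
    by (rule L2_I_nn[OF g * B])+
qed

lemma L2_dominated_convergence:
  assumes D: "integrable lborel (\<lambda>x. (D x)\<^sup>2)" and f: "\<And>n. f n \<in> borel_measurable borel"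
    and le: "\<And>n. AE x in lborel. cmod (f n x) \<le> D x"
    and lim: "AE x in lborel. (\<lambda>n. f n x) \<longlonglongrightarrow> 0"
  shows "(\<lambda>n. L2_norm (f n)) \<longlonglongrightarrow> 0"
proof -
  note [measurable] = f
  have "(\<lambda>n. \<integral>x. (cmod (f n x))\<^sup>2 \<partial>lborel) \<longlonglongrightarrow> (\<integral>x. 0 \<partial>(lborel :: 'a measure))"
  proof (rule integral_dominated_convergence[OF _ _ D])
    show "AE x in lborel. (\<lambda>n. (cmod (f n x))\<^sup>2) \<longlonglongrightarrow> 0"
      using lim
    proof eventually_elim
      case (elim x)
      then have "(\<lambda>n. (cmod (f n x))\<^sup>2) \<longlonglongrightarrow> (cmod 0)\<^sup>2" by (intro tendsto_intros)
      then show ?case by simp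
    qed
    show "AE x in lborel. norm ((cmod (f n x))\<^sup>2) \<le> (D x)\<^sup>2" for n
      using le[of n] by eventually_elim (simp add: power_mono)
  qed simp_all
  then have "(\<lambda>n. sqrt (\<integral>x. (cmod (f n x))\<^sup>2 \<partial>lborel)) \<longlonglongrightarrow> sqrt 0"
    by (intro tendsto_real_sqrt) simp
  then show ?thesis by (simp add: L2_norm_def)
qed

text \<open>Norm convergence is L1 convergence of the squared moduli, which gives pointwise
  convergence along a subsequence. This is how an L2 limit is compared with a limit taken frequency
  by frequency.\<close>

lemma L2_norm_tendsto_AE_subseq:
  assumes f: "\<And>n. f n \<in> L2" and lim: "(\<lambda>n. L2_norm (f n)) \<longlonglongrightarrow> 0"
  obtains r :: "nat \<Rightarrow> nat" where "strict_mono r" "AE x in lborel. (\<lambda>n. f (r n) x) \<longlonglongrightarrow> 0"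
proof -
  have "(\<lambda>n. (L2_norm (f n))\<^sup>2) \<longlonglongrightarrow> 0\<^sup>2" using lim by (intro tendsto_intros)
  then have "(\<lambda>n. \<integral>x. norm ((cmod (f n x))\<^sup>2) \<partial>lborel) \<longlonglongrightarrow> 0" by (simp add: L2_norm_power2)
  from tendsto_L1_AE_subseq[OF L2_integrable[OF f] this]
  obtain r :: "nat \<Rightarrow> nat" where r: "strict_mono r" "AE x in lborel. (\<lambda>n. (cmod (f (r n) x))\<^sup>2) \<longlonglongrightarrow> 0" by auto
  have "AE x in lborel. (\<lambda>n. f (r n) x) \<longlonglongrightarrow> 0"
    using r(2)
  proof eventually_elim
    case (elim x)
    from tendsto_real_sqrt[OF this] show ?case by (simp add: tendsto_norm_zero_iff)
  qed
  then show thesis using that r by blast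
qed

lemma L2_norm_eq_0_AE:
  assumes f: "f \<in> L2" "L2_norm f = 0"
  shows "AE x in lborel. f x = 0"
proof -
  have "(\<integral>x. (cmod (f x))\<^sup>2 \<partial>lborel) = 0" using f(2) L2_norm_power2[of f] by simp
  then have "AE x in lborel. (cmod (f x))\<^sup>2 = 0"
    using integral_nonneg_eq_0_iff_AE[OF L2_integrable[OF f(1)]] by simp
  then show ?thesis by eventually_elim simp
qed

section \<open>Completeness of L2\<close>

lemma summable_of_weighted_square:
  fixes z :: "nat \<Rightarrow> complex"
  assumes "\<And>k. 2 ^ k * (cmod (z k))\<^sup>2 \<le> C"
  shows "summable z"
proof (rule summable_norm_cancel, rule summable_comparison_test')
  have "summable (\<lambda>k. (1 / sqrt 2) ^ k)" by (rule summable_geometric) simp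
  then show "summable (\<lambda>k. sqrt C * (1 / sqrt 2) ^ k)" by (rule summable_mult)
  fix k :: nat assume "k \<ge> 0"
  have "(cmod (z k))\<^sup>2 \<le> C / 2 ^ k" using assms[of k] by (simp add: field_simps)
  then have "sqrt ((cmod (z k))\<^sup>2) \<le> sqrt (C / 2 ^ k)" by (rule real_sqrt_le_mono)
  then show "norm (norm (z k)) \<le> sqrt C * (1 / sqrt 2) ^ k"
    by (simp add: real_sqrt_divide real_sqrt_power power_divide)
qed

lemma ennreal_finiteE:
  assumes "S \<noteq> \<infinity>"
  obtains C where "S = ennreal C" "C \<ge> 0"
  using assms by (cases S) auto

lemma ennreal_le_suminf:
  fixes f :: "nat \<Rightarrow> ennreal"
  shows "f k \<le> (\<Sum>k. f k)"
  using sum_le_suminf[of f "{k}"] by simp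

text \<open>Riesz-Fischer without an infinite Minkowski inequality. The increments
  \<open>D k\<close> have norm at most \<open>(1/2) ^ k\<close>, so even the sum of
  \<open>2 ^ k * (cmod (D k x))\<^sup>2\<close> has finite integral. Where that sum is finite the
  increments decay geometrically, like \<open>(1 / sqrt 2) ^ k\<close>, and the series converges.
  Fatou then turns the Cauchy estimate into convergence in norm.\<close>

lemma L2_complete:
  assumes f: "\<And>n. f n \<in> L2"
    and Cauchy: "\<And>e. e > 0 \<Longrightarrow> \<exists>N. \<forall>m\<ge>N. \<forall>n\<ge>N. L2_norm (\<lambda>x. f m x - f n x) \<le> e"
  obtains g where "g \<in> L2" "(\<lambda>n. L2_norm (\<lambda>x. f n x - g x)) \<longlonglongrightarrow> 0"
proof -
  have "\<forall>k. \<exists>N. \<forall>m\<ge>N. \<forall>n\<ge>N. L2_norm (\<lambda>x. f m x - f n x) \<le> (1/2) ^ k"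
    using Cauchy by simp
  then obtain N where N: "\<And>k m n. m \<ge> N k \<Longrightarrow> n \<ge> N k \<Longrightarrow> L2_norm (\<lambda>x. f m x - f n x) \<le> (1/2) ^ k"
    by metis
  \<comment> \<open>The maximum makes \<open>r\<close> monotone and at least \<open>N k\<close>; the
    summand \<open>k\<close> makes it tend to infinity.\<close>
  define r where "r k = Max (N ` {..k}) + k" for k
  have r: "r k \<ge> N k" "r k \<ge> k" for k
    unfolding r_def by (auto intro!: trans_le_add1)
  have r_mono: "r k \<le> r (Suc k)" for k
    unfolding r_def by (intro add_mono Max_mono) auto
  define D where "D k x = f (r (Suc k)) x - f (r k) x" for k x
  have D: "D k \<in> L2" for k unfolding D_def by (intro L2_diff f)
  have D_le: "L2_norm (D k) \<le> (1/2) ^ k" for k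
    unfolding D_def using r[of k] r_mono[of k] by (intro N) auto
  note [measurable] = L2_measurable[OF D] L2_measurable[OF f]
  have "(\<integral>\<^sup>+x. (\<Sum>k. ennreal (2 ^ k * (cmod (D k x))\<^sup>2)) \<partial>lborel) = (\<Sum>k. \<integral>\<^sup>+x. ennreal (2 ^ k * (cmod (D k x))\<^sup>2) \<partial>lborel)"
    by (rule nn_integral_suminf) simp
  also have "\<dots> \<le> (\<Sum>k. ennreal ((1/2) ^ k))"
  proof (rule suminf_le)
    fix k
    have "(\<integral>\<^sup>+x. ennreal (2 ^ k * (cmod (D k x))\<^sup>2) \<partial>lborel) = ennreal (2 ^ k) * ennreal ((L2_norm (D k))\<^sup>2)"
      by (simp add: ennreal_mult nn_integral_cmult L2_nn_integral D)
    also have "\<dots> = ennreal (2 ^ k * (L2_norm (D k))\<^sup>2)"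
      by (simp add: ennreal_mult)
    also have "\<dots> \<le> ennreal (2 ^ k * ((1/2) ^ k)\<^sup>2)"
      using D_le by (intro ennreal_leI mult_left_mono power_mono) auto
    also have "2 ^ k * ((1/2) ^ k)\<^sup>2 = (1/2 :: real) ^ k"
      by (simp add: power2_eq_square flip: power_mult_distrib)
    finally show "(\<integral>\<^sup>+x. ennreal (2 ^ k * (cmod (D k x))\<^sup>2) \<partial>lborel) \<le> ennreal ((1/2) ^ k)" .
  qed auto
  also have "\<dots> = ennreal (\<Sum>k. (1/2) ^ k)"
    by (intro suminf_ennreal2) auto
  also have "\<dots> < \<infinity>" by simp
  finally have fin: "(\<integral>\<^sup>+x. (\<Sum>k. ennreal (2 ^ k * (cmod (D k x))\<^sup>2)) \<partial>lborel) \<noteq> \<infinity>" by simp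
  have "AE x in lborel. (\<Sum>k. ennreal (2 ^ k * (cmod (D k x))\<^sup>2)) \<noteq> \<infinity>"
    by (rule nn_integral_PInf_AE[OF _ fin]) simp
  then have conv: "AE x in lborel. convergent (\<lambda>k. f (r k) x)"
  proof eventually_elim
    case (elim x)
    define S where "S = (\<Sum>k. ennreal (2 ^ k * (cmod (D k x))\<^sup>2))"
    have "S \<noteq> \<infinity>" using elim unfolding S_def .
    then obtain C where C: "S = ennreal C" "C \<ge> 0"
      by (rule ennreal_finiteE)
    have "2 ^ k * (cmod (D k x))\<^sup>2 \<le> C" for k
    proof -
      have "ennreal (2 ^ k * (cmod (D k x))\<^sup>2) \<le> S"
        unfolding S_def by (rule ennreal_le_suminf)
      then show ?thesis unfolding C(1) by (rule ennreal_le_iff[OF C(2), THEN iffD1])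
    qed
    then have "summable (\<lambda>k. D k x)" by (rule summable_of_weighted_square)
    then have "(\<lambda>n. (\<Sum>k<n. D k x) + f (r 0) x) \<longlonglongrightarrow> (\<Sum>k. D k x) + f (r 0) x"
      by (intro tendsto_intros summable_LIMSEQ)
    moreover have "(\<Sum>k<n. D k x) + f (r 0) x = f (r n) x" for n
      using sum_lessThan_telescope[of "\<lambda>k. f (r k) x" n] by (simp add: D_def)
    ultimately show ?case by (auto simp: convergent_def)
  qed
  \<comment> \<open>\<open>lim\<close> is total, so \<open>g\<close> is measurable everywhere
    although the sequence converges only almost everywhere.\<close>
  define g where "g x = lim (\<lambda>k. f (r k) x)" for x
  have g [measurable]: "g \<in> borel_measurable borel"
    unfolding g_def by measurable
  have lim: "AE x in lborel. (\<lambda>k. f (r k) x) \<longlonglongrightarrow> g x"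
    using conv by eventually_elim (simp add: g_def convergent_LIMSEQ_iff)
  have *: "(\<lambda>x. f m x - g x) \<in> L2 \<and> L2_norm (\<lambda>x. f m x - g x) \<le> (1/2) ^ k" if m: "m \<ge> N k" for m k
  proof -
    have "(\<lambda>x. f m x - f (r n) x) \<in> L2" for n by (intro L2_diff f)
    moreover have "\<forall>\<^sub>F n in sequentially. L2_norm (\<lambda>x. f m x - f (r n) x) \<le> (1/2) ^ k"
      using eventually_ge_at_top[of "N k"]
      by eventually_elim (use m r(2) in \<open>auto intro!: N intro: order_trans\<close>)
    moreover have "AE x in lborel. (\<lambda>n. f m x - f (r n) x) \<longlonglongrightarrow> f m x - g x"
      using lim by eventually_elim (intro tendsto_intros)
    ultimately show ?thesis
      using L2_Fatou[of "\<lambda>n x. f m x - f (r n) x" "(1/2) ^ k" "\<lambda>x. f m x - g x"] by simp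
  qed
  have "(\<lambda>x. f (N 0) x - g x) \<in> L2" using *[of 0 "N 0"] by simp
  from L2_diff(1)[OF f[of "N 0"] this] have "g \<in> L2" by simp
  moreover have "(\<lambda>n. L2_norm (\<lambda>x. f n x - g x)) \<longlonglongrightarrow> 0"
  proof (rule LIMSEQ_I)
    fix e :: real assume "e > 0"
    then obtain k where k: "(1/2 :: real) ^ k < e" using real_arch_pow_inv[of e "1/2"] by auto
    show "\<exists>no. \<forall>n\<ge>no. norm (L2_norm (\<lambda>x. f n x - g x) - 0) < e"
      using *[of k] k by (intro exI[of _ "N k"]) (auto intro: le_less_trans)
  qed
  ultimately show thesis by (rule that)
qed

section \<open>The Fourier integral of a Gaussian\<close>

text \<open>No normalising constant here, so that the multiplication formula and the autocorrelation
  identity are free of constants; \<open>fourier_trunc\<close> puts the factor back.\<close>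

definition fourier_integral :: "('a::euclidean_space \<Rightarrow> complex) \<Rightarrow> 'a \<Rightarrow> complex" where
  "fourier_integral f \<xi> = (\<integral>x. exp (- \<i> * of_real (x \<bullet> \<xi>)) * f x \<partial>lborel)"

lemma norm_exp_i_inner [simp]: "cmod (exp (- (\<i> * of_real r))) = 1"
  using norm_exp_i_times[of "- r"] by simp

lemma fourier_integrable:
  assumes f: "integrable lborel f"
  shows "integrable lborel (\<lambda>x. exp (- \<i> * of_real (x \<bullet> \<xi>)) * f x)"
proof -
  note [measurable] = borel_measurable_integrable[OF f]
  show ?thesis
    by (rule Bochner_Integration.integrable_bound[OF f]) (simp_all add: norm_mult)
qed

lemma fourier_integral_measurable:
  assumes "f \<in> borel_measurable borel"
  shows "fourier_integral f \<in> borel_measurable borel"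
proof -
  have [measurable]: "f \<in> borel_measurable lborel" using assms by simp
  have "(\<lambda>\<xi>. \<integral>x. exp (- \<i> * of_real (x \<bullet> \<xi>)) * f x \<partial>lborel) \<in> borel_measurable borel"
    by (rule lborel.borel_measurable_lebesgue_integral) measurable
  then show ?thesis by (simp add: fourier_integral_def[abs_def])
qed

lemma integrable_gaussian_1: "integrable lborel (\<lambda>t::real. exp (- t\<^sup>2 / 2))"
proof -
  have "integrable lborel (\<lambda>t. sqrt (2 * pi) * std_normal_density t)"
    by (intro integrable_mult_right) (auto intro: integrable_normal_density)
  then show ?thesis by (simp add: std_normal_density_def)
qed

text \<open>This is the characteristic function of the standard normal law, evaluated at
  \<open>- s\<close> because of the sign of the phase.\<close>

lemma fourier_gaussian_1:
  "(\<integral>t. exp (- \<i> * of_real (t * s)) * of_real (exp (- t\<^sup>2 / 2)) \<partial>lborel) = of_real (sqrt (2 * pi) * exp (- s\<^sup>2 / 2))"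
proof -
  have "of_real (exp (- s\<^sup>2 / 2)) = char std_normal_distribution (- s)"
    by (simp add: char_std_normal_distribution)
  also have "\<dots> = (\<integral>t. std_normal_density t *\<^sub>R iexp (- s * t) \<partial>lborel)"
    unfolding char_def by (subst integral_density) simp_all
  also have "\<dots> = (\<integral>t. of_real (1 / sqrt (2 * pi)) * (exp (- \<i> * of_real (t * s)) * of_real (exp (- t\<^sup>2 / 2))) \<partial>lborel)"
    by (intro Bochner_Integration.integral_cong) (simp_all add: std_normal_density_def scaleR_conv_of_real mult_ac)
  also have "\<dots> = of_real (1 / sqrt (2 * pi)) * (\<integral>t. exp (- \<i> * of_real (t * s)) * of_real (exp (- t\<^sup>2 / 2)) \<partial>lborel)"
    by (rule integral_mult_right_zero)
  finally have "of_real (sqrt (2 * pi)) * complex_of_real (exp (- s\<^sup>2 / 2)) =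
     of_real (sqrt (2 * pi)) * (of_real (1 / sqrt (2 * pi)) * (\<integral>t. exp (- \<i> * of_real (t * s)) * of_real (exp (- t\<^sup>2 / 2)) \<partial>lborel))"
    by simp
  then show ?thesis
    by (simp only: mult.assoc[symmetric] of_real_mult[symmetric]) simp
qed

text \<open>Fubini over the coordinates, since \<open>lborel\<close> is the image of the product of
  one-dimensional Lebesgue measures. It reduces the Gaussian on the whole space to dimension
  one.\<close>

lemma
  fixes \<phi> :: "'a::euclidean_space \<Rightarrow> real \<Rightarrow> complex"
  assumes int: "\<And>b. b \<in> Basis \<Longrightarrow> integrable lborel (\<phi> b)"
  shows integrable_lborel_prod: "integrable lborel (\<lambda>x::'a. \<Prod>b\<in>Basis. \<phi> b (x \<bullet> b))"
    and integral_lborel_prod: "(\<integral>x. (\<Prod>b\<in>Basis. \<phi> b (x \<bullet> b)) \<partial>lborel) = (\<Prod>b\<in>Basis. \<integral>t. \<phi> b t \<partial>lborel)"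
proof -
  interpret product_sigma_finite "\<lambda>_::'a. lborel :: real measure" ..
  have meas [measurable]: "\<phi> b \<in> borel_measurable borel" if "b \<in> Basis" for b
    using borel_measurable_integrable[OF int[OF that]] by simp
  let ?T = "\<lambda>f::'a \<Rightarrow> real. \<Sum>b\<in>Basis. f b *\<^sub>R b"
  have T [measurable]: "?T \<in> (\<Pi>\<^sub>M b\<in>Basis. lborel) \<rightarrow>\<^sub>M borel"
    by measurable
  have P [measurable]: "(\<lambda>x::'a. \<Prod>b\<in>Basis. \<phi> b (x \<bullet> b)) \<in> borel_measurable borel"
    by measurable
  have eq: "(\<Prod>b\<in>Basis. \<phi> b (?T f \<bullet> b)) = (\<Prod>b\<in>Basis. \<phi> b (f b))" for f
    by (rule prod.cong) (simp_all add: inner_sum_left inner_Basis if_distrib sum.delta' cong: if_cong)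
  show "integrable lborel (\<lambda>x::'a. \<Prod>b\<in>Basis. \<phi> b (x \<bullet> b))"
    unfolding lborel_eq[where 'a='a] integrable_distr_eq[OF T P] eq
    by (intro product_integrable_prod int) auto
  show "(\<integral>x. (\<Prod>b\<in>Basis. \<phi> b (x \<bullet> b)) \<partial>lborel) = (\<Prod>b\<in>Basis. \<integral>t. \<phi> b t \<partial>lborel)"
    unfolding lborel_eq[where 'a='a] integral_distr[OF T P] eq
    by (intro product_integral_prod int) auto
qed

definition gaussian :: "'a::euclidean_space \<Rightarrow> real" where
  "gaussian x = exp (- (norm x)\<^sup>2 / 2)"

lemma gaussian_prod: "gaussian x = (\<Prod>b\<in>Basis. exp (- (x \<bullet> b)\<^sup>2 / 2))"
proof -
  have "(\<Prod>b\<in>Basis. exp (- (x \<bullet> b)\<^sup>2 / 2)) = exp (\<Sum>b\<in>Basis. - (x \<bullet> b)\<^sup>2 / 2)"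
    by (rule exp_sum[symmetric]) simp
  also have "(\<Sum>b\<in>Basis. - (x \<bullet> b)\<^sup>2 / 2) = - (\<Sum>b\<in>Basis. (x \<bullet> b) * (x \<bullet> b)) / 2"
    by (simp only: sum_negf sum_divide_distrib[symmetric] power2_eq_square)
  also have "(\<Sum>b\<in>Basis. (x \<bullet> b) * (x \<bullet> b)) = (norm x)\<^sup>2"
    unfolding power2_norm_eq_inner by (rule euclidean_inner[symmetric])
  finally show ?thesis by (simp add: gaussian_def)
qed

lemma gaussian_measurable [measurable]: "gaussian \<in> borel_measurable borel"
  unfolding gaussian_def by measurable

lemma gaussian_pos: "gaussian x > 0"
  by (simp add: gaussian_def)

lemma integrable_gaussian: "integrable lborel (gaussian :: 'a::euclidean_space \<Rightarrow> real)"
proof -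
  have "integrable lborel (\<lambda>x::'a. \<Prod>b\<in>Basis. complex_of_real (exp (- (x \<bullet> b)\<^sup>2 / 2)))"
    by (rule integrable_lborel_prod[of "\<lambda>_ t. complex_of_real (exp (- t\<^sup>2 / 2))"])
       (rule integrable_of_real[OF integrable_gaussian_1])
  then have "integrable lborel (\<lambda>x::'a. complex_of_real (gaussian x))"
    by (simp add: gaussian_prod)
  from integrable_Re[OF this] show ?thesis by (simp add: comp_def)
qed

lemma fourier_gaussian:
  fixes \<xi> :: "'a::euclidean_space"
  shows "fourier_integral (\<lambda>x. of_real (gaussian x)) \<xi> = of_real ((2 * pi) powr (DIM('a) / 2) * gaussian \<xi>)"
proof -
  define \<phi> where "\<phi> b t = exp (- \<i> * of_real (t * (\<xi> \<bullet> b))) * complex_of_real (exp (- t\<^sup>2 / 2))" for b t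
  have "integrable lborel (\<lambda>t. complex_of_real (exp (- t\<^sup>2 / 2)))"
    by (rule integrable_of_real[OF integrable_gaussian_1])
  then have int: "integrable lborel (\<phi> b)" for b
    unfolding \<phi>_def using fourier_integrable[where 'a=real, of "\<lambda>t. complex_of_real (exp (- t\<^sup>2 / 2))" "\<xi> \<bullet> b"]
    by simp
  have "exp (- \<i> * of_real (x \<bullet> \<xi>)) * complex_of_real (gaussian x) = (\<Prod>b\<in>Basis. \<phi> b (x \<bullet> b))" for x
  proof -
    have "exp (- \<i> * of_real (x \<bullet> \<xi>)) = (\<Prod>b\<in>Basis. exp (- \<i> * of_real ((x \<bullet> b) * (\<xi> \<bullet> b))))"
      unfolding euclidean_inner[of x \<xi>] by (simp add: exp_sum[symmetric] sum_distrib_left sum_negf)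
    then show ?thesis unfolding \<phi>_def gaussian_prod by (simp add: prod.distrib)
  qed
  then have "fourier_integral (\<lambda>x. of_real (gaussian x)) \<xi> = (\<integral>x. (\<Prod>b\<in>Basis. \<phi> b (x \<bullet> b)) \<partial>lborel)"
    by (simp add: fourier_integral_def)
  also have "\<dots> = (\<Prod>b\<in>Basis. \<integral>t. \<phi> b t \<partial>lborel)"
    by (rule integral_lborel_prod[OF int])
  also have "\<dots> = (\<Prod>b\<in>Basis. of_real (sqrt (2 * pi) * exp (- (\<xi> \<bullet> b)\<^sup>2 / 2)))"
    unfolding \<phi>_def by (simp only: fourier_gaussian_1)
  also have "\<dots> = of_real (\<Prod>b\<in>Basis. sqrt (2 * pi) * exp (- (\<xi> \<bullet> b)\<^sup>2 / 2))"
    by (rule of_real_prod[symmetric])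
  also have "(\<Prod>b\<in>Basis. sqrt (2 * pi) * exp (- (\<xi> \<bullet> b)\<^sup>2 / 2)) = sqrt (2 * pi) ^ DIM('a) * gaussian \<xi>"
    unfolding gaussian_prod prod.distrib by simp
  also have "sqrt (2 * pi) ^ DIM('a) = (2 * pi) powr (DIM('a) / 2)"
  proof -
    have "sqrt (2 * pi) ^ DIM('a) = ((2 * pi) powr (1 / 2)) powr (real DIM('a))"
      by (simp add: powr_half_sqrt powr_realpow)
    then show ?thesis by (simp add: powr_powr)
  qed
  finally show ?thesis .
qed

text \<open>The kernel is symmetric in \<open>x\<close> and \<open>\<xi>\<close>, so both sides are
  iterated integrals of the same \<open>F\<close>, which is integrable because its modulus is the
  product of the moduli of \<open>f\<close> and \<open>g\<close>.\<close>

lemma multiplication_formula: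
  fixes f g :: "'a::euclidean_space \<Rightarrow> complex"
  assumes f: "integrable lborel f" and g: "integrable lborel g"
  shows "(\<integral>\<xi>. fourier_integral f \<xi> * g \<xi> \<partial>lborel) = (\<integral>x. f x * fourier_integral g x \<partial>lborel)"
proof -
  note [measurable] = borel_measurable_integrable[OF f] borel_measurable_integrable[OF g]
  define F where "F = (\<lambda>(x, \<xi>). exp (- \<i> * of_real (x \<bullet> \<xi>)) * f x * g \<xi>)"
  have [measurable]: "F \<in> borel_measurable (lborel \<Otimes>\<^sub>M lborel)"
    unfolding F_def by measurable
  have F: "integrable (lborel \<Otimes>\<^sub>M lborel) F"
  proof (rule lborel_pair.Fubini_integrable)
    have "integrable lborel (\<lambda>x. norm (f x) * (\<integral>\<xi>. norm (g \<xi>) \<partial>lborel))"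
      using f by simp
    then show "integrable lborel (\<lambda>x. \<integral>\<xi>. norm (F (x, \<xi>)) \<partial>lborel)"
      by (simp add: F_def norm_mult)
    have "integrable lborel (\<lambda>\<xi>. F (x, \<xi>))" for x
      using integrable_mult_right[OF fourier_integrable[OF g, of x], of "f x"]
      by (simp add: F_def mult_ac inner_commute)
    then show "AE x in lborel. integrable lborel (\<lambda>\<xi>. F (x, \<xi>))" by simp
  qed simp
  have "(\<integral>\<xi>. fourier_integral f \<xi> * g \<xi> \<partial>lborel) = (\<integral>\<xi>. (\<integral>x. F (x, \<xi>) \<partial>lborel) \<partial>lborel)"
    unfolding fourier_integral_def F_def by (simp add: integral_mult_left_zero[symmetric] del: integral_mult_left_zero)
  also have "\<dots> = (\<integral>x. (\<integral>\<xi>. F (x, \<xi>) \<partial>lborel) \<partial>lborel)"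
    using lborel_pair.Fubini_integral[of "\<lambda>x \<xi>. F (x, \<xi>)"] F by simp
  also have "\<dots> = (\<integral>x. f x * fourier_integral g x \<partial>lborel)"
    unfolding fourier_integral_def F_def
    by (simp add: integral_mult_right_zero[symmetric] inner_commute mult_ac del: integral_mult_right_zero)
  finally show ?thesis .
qed

section \<open>Plancherel's theorem\<close>

text \<open>\<open>h\<close> is the convolution of \<open>f\<close> with its reflected conjugate, so
  its transform factorises into a modulus squared. The squared norm of the transform thereby becomes
  the integral of a single transform, to which the multiplication formula applies.\<close>

lemma
  fixes f :: "'a::euclidean_space \<Rightarrow> complex"
  assumes f: "integrable lborel f"
  defines "h \<equiv> \<lambda>u. \<integral>y. f (y + u) * cnj (f y) \<partial>lborel"
  shows integrable_autocorrelation: "integrable lborel h"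
    and fourier_autocorrelation: "fourier_integral h \<xi> = of_real ((cmod (fourier_integral f \<xi>))\<^sup>2)"
proof -
  have m: "f \<in> borel_measurable borel" using borel_measurable_integrable[OF f] by simp
  note [measurable] = m
  have [measurable]: "cnj \<in> borel_measurable borel"
    by (intro borel_measurable_continuous_onI continuous_intros)
  have fu: "integrable lborel (\<lambda>u. f (y + u))" for y
    using f lborel_translate(1)[OF m, of y] by (simp add: add.commute)
  define e where "e u = exp (- \<i> * of_real (u \<bullet> \<xi>))" for u
  have [measurable]: "e \<in> borel_measurable borel" unfolding e_def by measurable
  have e: "cmod (e u) = 1" "e (- u) = cnj (e u)" "e (u + v) = e u * e v" for u v
    unfolding e_def by (simp_all add: exp_cnj inner_add_left algebra_simps flip: exp_add)
  define G where "G = (\<lambda>(y, u). f (y + u) * cnj (f y))"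
  have [measurable]: "G \<in> borel_measurable (lborel \<Otimes>\<^sub>M lborel)" unfolding G_def by measurable
  have G: "integrable (lborel \<Otimes>\<^sub>M lborel) G"
  proof (rule lborel_pair.Fubini_integrable)
    have eq: "(\<integral>u. norm (G (y, u)) \<partial>lborel) = norm (f y) * (\<integral>u. norm (f u) \<partial>lborel)" for y
    proof -
      have "(\<integral>u. norm (G (y, u)) \<partial>lborel) = (\<integral>u. norm (f y) * norm (f (u + y)) \<partial>lborel)"
        unfolding G_def by (intro Bochner_Integration.integral_cong) (simp_all add: norm_mult mult.commute add.commute)
      also have "\<dots> = norm (f y) * (\<integral>u. norm (f (u + y)) \<partial>lborel)" by simp
      also have "(\<integral>u. norm (f (u + y)) \<partial>lborel) = (\<integral>u. norm (f u) \<partial>lborel)"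
        by (rule lborel_translate(2)) measurable
      finally show ?thesis .
    qed
    show "integrable lborel (\<lambda>y. \<integral>u. norm (G (y, u)) \<partial>lborel)"
      unfolding eq using f by simp
    show "AE y in lborel. integrable lborel (\<lambda>u. G (y, u))"
      unfolding G_def using fu by simp
  qed simp
  have h_eq: "h = (\<lambda>u. \<integral>y. G (y, u) \<partial>lborel)" by (simp add: h_def G_def)
  show "integrable lborel h"
    unfolding h_eq using lborel_pair.integrable_snd[of "\<lambda>y u. G (y, u)"] G by simp
  have eG: "integrable (lborel \<Otimes>\<^sub>M lborel) (\<lambda>(y, u). e u * G (y, u))"
  proof (rule Bochner_Integration.integrable_bound[OF G])
    show "(\<lambda>(y, u). e u * G (y, u)) \<in> borel_measurable (lborel \<Otimes>\<^sub>M lborel)" by measurable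
    show "AE p in lborel \<Otimes>\<^sub>M lborel. norm (case p of (y, u) \<Rightarrow> e u * G (y, u)) \<le> norm (G p)"
      by (rule AE_I2) (auto simp: norm_mult e)
  qed
  have "fourier_integral h \<xi> = (\<integral>u. e u * (\<integral>y. G (y, u) \<partial>lborel) \<partial>lborel)"
    unfolding fourier_integral_def h_eq e_def ..
  also have "\<dots> = (\<integral>u. (\<integral>y. e u * G (y, u) \<partial>lborel) \<partial>lborel)"
    by (simp only: integral_mult_right_zero)
  also have "\<dots> = (\<integral>y. (\<integral>u. e u * G (y, u) \<partial>lborel) \<partial>lborel)"
    using lborel_pair.Fubini_integral[OF eG] by simp
  also have "\<dots> = (\<integral>y. cnj (e y) * cnj (f y) * fourier_integral f \<xi> \<partial>lborel)"
  proof (rule Bochner_Integration.integral_cong[OF refl])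
    fix y
    have "(\<integral>u. e u * G (y, u) \<partial>lborel) = (\<integral>u. cnj (e y) * cnj (f y) * (e (u + y) * f (u + y)) \<partial>lborel)"
    proof (rule Bochner_Integration.integral_cong[OF refl])
      fix u
      have "cnj (e y) * e y = 1" using complex_norm_square[of "e y"] e(1)[of y] by (simp add: mult.commute)
      then have "e u = cnj (e y) * e (u + y)" unfolding e(3) by (simp add: mult.left_commute)
      then show "e u * G (y, u) = cnj (e y) * cnj (f y) * (e (u + y) * f (u + y))"
        by (simp add: G_def add.commute mult_ac)
    qed
    also have "\<dots> = cnj (e y) * cnj (f y) * (\<integral>u. e (u + y) * f (u + y) \<partial>lborel)"
      by (rule integral_mult_right_zero)
    also have "(\<integral>u. e (u + y) * f (u + y) \<partial>lborel) = (\<integral>u. e u * f u \<partial>lborel)"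
      by (rule lborel_translate(2)[of "\<lambda>u. e u * f u"]) measurable
    finally show "(\<integral>u. e u * G (y, u) \<partial>lborel) = cnj (e y) * cnj (f y) * fourier_integral f \<xi>"
      by (simp add: fourier_integral_def e_def)
  qed
  also have "\<dots> = (\<integral>y. cnj (e y * f y) \<partial>lborel) * fourier_integral f \<xi>"
    by simp
  also have "(\<integral>y. cnj (e y * f y) \<partial>lborel) = cnj (\<integral>y. e y * f y \<partial>lborel)"
    by (rule Bochner_Integration.integral_cnj)
  also have "(\<integral>y. e y * f y \<partial>lborel) = fourier_integral f \<xi>"
    unfolding fourier_integral_def e_def ..
  finally show "fourier_integral h \<xi> = of_real ((cmod (fourier_integral f \<xi>))\<^sup>2)"
    unfolding complex_norm_square by (simp add: mult.commute)
qed

lemma norm_fourier_integral_le: "cmod (fourier_integral f \<xi>) \<le> (\<integral>x. norm (f x) \<partial>lborel)"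
proof -
  have "cmod (fourier_integral f \<xi>) \<le> (\<integral>x. norm (exp (- \<i> * of_real (x \<bullet> \<xi>)) * f x) \<partial>lborel)"
    unfolding fourier_integral_def by (rule integral_norm_bound)
  then show ?thesis by (simp add: norm_mult)
qed

lemma fourier_integral_scale:
  fixes f :: "'a::euclidean_space \<Rightarrow> complex"
  assumes [measurable]: "f \<in> borel_measurable borel" and e: "e > 0"
  shows "fourier_integral (\<lambda>x. f (e *\<^sub>R x)) \<xi> = (1 / e ^ DIM('a)) *\<^sub>R fourier_integral f ((1/e) *\<^sub>R \<xi>)"
  using lborel_affine_integrable_integral(2)[of "\<lambda>x. exp (- \<i> * of_real (x \<bullet> (1/e) *\<^sub>R \<xi>)) * f x" e 0] e
  by (simp add: fourier_integral_def)

text \<open>The Gaussian acts as an approximate identity on the autocorrelation, whose value at 0 is the squared norm.\<close>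

lemma gaussian_regularisation:
  fixes f :: "'a::euclidean_space \<Rightarrow> complex"
  assumes f: "integrable lborel f" and e: "e > 0"
  shows "complex_of_real (\<integral>\<xi>. (cmod (fourier_integral f \<xi>))\<^sup>2 * gaussian (e *\<^sub>R \<xi>) \<partial>lborel) =
    (\<integral>x. (\<integral>y. f (y + e *\<^sub>R x) * cnj (f y) \<partial>lborel) * of_real ((2 * pi) powr (DIM('a) / 2) * gaussian x) \<partial>lborel)"
proof -
  define h where "h u = (\<integral>y. f (y + u) * cnj (f y) \<partial>lborel)" for u
  have h: "integrable lborel h" unfolding h_def by (rule integrable_autocorrelation[OF f])
  have [measurable]: "h \<in> borel_measurable borel" using borel_measurable_integrable[OF h] by simp
  have ge: "integrable lborel (\<lambda>\<xi>::'a. gaussian (e *\<^sub>R \<xi>))"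
    using lborel_affine_integrable_integral(1)[of "gaussian :: 'a \<Rightarrow> real" e 0] e integrable_gaussian by simp
  have "complex_of_real (\<integral>\<xi>. (cmod (fourier_integral f \<xi>))\<^sup>2 * gaussian (e *\<^sub>R \<xi>) \<partial>lborel) =
     (\<integral>\<xi>. complex_of_real ((cmod (fourier_integral f \<xi>))\<^sup>2 * gaussian (e *\<^sub>R \<xi>)) \<partial>lborel)"
    by (rule integral_complex_of_real[symmetric])
  also have "\<dots> = (\<integral>\<xi>. fourier_integral h \<xi> * complex_of_real (gaussian (e *\<^sub>R \<xi>)) \<partial>lborel)"
    unfolding h_def fourier_autocorrelation[OF f] by simp
  also have "\<dots> = (\<integral>x. h x * fourier_integral (\<lambda>\<xi>. complex_of_real (gaussian (e *\<^sub>R \<xi>))) x \<partial>lborel)"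
    by (rule multiplication_formula[OF h integrable_of_real[OF ge]])
  also have "\<dots> = (\<integral>x. (1 / e ^ DIM('a)) *\<^sub>R (h x * fourier_integral (\<lambda>\<xi>. complex_of_real (gaussian \<xi>)) ((1/e) *\<^sub>R x)) \<partial>lborel)"
    using fourier_integral_scale[OF _ e, of "\<lambda>\<xi>::'a. complex_of_real (gaussian \<xi>)"] by simp
  also have "\<dots> = (1 / e ^ DIM('a)) *\<^sub>R (\<integral>x. h x * fourier_integral (\<lambda>\<xi>. complex_of_real (gaussian \<xi>)) ((1/e) *\<^sub>R x) \<partial>lborel)"
    by (rule integral_scaleR_right)
  \<comment> \<open>Replacing \<open>x\<close> by \<open>e *\<^sub>R x\<close> cancels the power of
    \<open>e\<close> and moves the small parameter from the Gaussian into \<open>h\<close>.\<close>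
  also have "\<dots> = (\<integral>x. h (e *\<^sub>R x) * fourier_integral (\<lambda>\<xi>. complex_of_real (gaussian \<xi>)) x \<partial>lborel)"
    using lborel_affine_integrable_integral(2)[of "\<lambda>x. h x * fourier_integral (\<lambda>\<xi>. complex_of_real (gaussian \<xi>)) ((1/e) *\<^sub>R x)" e 0] e
      fourier_integral_measurable[of "\<lambda>\<xi>::'a. complex_of_real (gaussian \<xi>)"]
    by simp
  finally show ?thesis unfolding h_def fourier_gaussian .
qed

text \<open>The bound \<open>B\<close> on the second factor lets the L1 modulus of continuity
  control the pairing.\<close>

lemma continuous_autocorrelation_0:
  fixes f :: "'a::euclidean_space \<Rightarrow> complex"
  assumes f: "integrable lborel f" and B: "\<And>x. cmod (f x) \<le> B" and u: "u \<longlonglongrightarrow> 0"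
  shows "(\<lambda>n. \<integral>y. f (y + u n) * cnj (f y) \<partial>lborel) \<longlonglongrightarrow> (\<integral>y. f y * cnj (f y) \<partial>lborel)"
proof -
  have m: "f \<in> borel_measurable borel" using borel_measurable_integrable[OF f] by simp
  note [measurable] = m
  have [measurable]: "cnj \<in> borel_measurable borel"
    by (intro borel_measurable_continuous_onI continuous_intros)
  have fu: "integrable lborel (\<lambda>y. f (y + v))" for v
    using f lborel_translate(1)[OF m, of v] by simp
  have bound: "integrable lborel (\<lambda>y. g y * cnj (f y))" if g: "integrable lborel g" for g
  proof (rule Bochner_Integration.integrable_bound)
    note [measurable] = borel_measurable_integrable[OF g]
    show "integrable lborel (\<lambda>y. B * norm (g y))" using g by simp
    show "(\<lambda>y. g y * cnj (f y)) \<in> borel_measurable lborel" by measurable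
    show "AE y in lborel. norm (g y * cnj (f y)) \<le> norm (B * norm (g y))"
    proof (rule AE_I2)
      fix y
      have "norm (g y * cnj (f y)) = norm (f y) * norm (g y)" by (simp add: norm_mult)
      also have "\<dots> \<le> B * norm (g y)" using B by (intro mult_right_mono) auto
      finally show "norm (g y * cnj (f y)) \<le> norm (B * norm (g y))" by simp
    qed
  qed
  have "(\<lambda>n. (\<integral>y. f (y + u n) * cnj (f y) \<partial>lborel) - (\<integral>y. f y * cnj (f y) \<partial>lborel)) \<longlonglongrightarrow> 0"
  proof (rule Lim_null_comparison[OF always_eventually, OF allI])
    have "(\<lambda>n. B * (\<integral>y. norm (f (y + u n) - f y) \<partial>lborel)) \<longlonglongrightarrow> B * 0"
      by (intro tendsto_intros L1_translation_continuous f u)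
    then show "(\<lambda>n. B * (\<integral>y. norm (f (y + u n) - f y) \<partial>lborel)) \<longlonglongrightarrow> 0" by simp
    fix n
    have "(\<integral>y. f (y + u n) * cnj (f y) \<partial>lborel) - (\<integral>y. f y * cnj (f y) \<partial>lborel) =
        (\<integral>y. (f (y + u n) - f y) * cnj (f y) \<partial>lborel)"
      using bound[OF fu] bound[OF f] by (simp add: left_diff_distrib)
    also have "norm \<dots> \<le> (\<integral>y. norm ((f (y + u n) - f y) * cnj (f y)) \<partial>lborel)"
      by (rule integral_norm_bound)
    also have "\<dots> \<le> (\<integral>y. B * norm (f (y + u n) - f y) \<partial>lborel)"
    proof (rule integral_mono)
      show "integrable lborel (\<lambda>y. norm ((f (y + u n) - f y) * cnj (f y)))"
        by (intro integrable_norm bound Bochner_Integration.integrable_diff fu f)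
      show "integrable lborel (\<lambda>y. B * norm (f (y + u n) - f y))"
        using fu f by simp
      show "norm ((f (y + u n) - f y) * cnj (f y)) \<le> B * norm (f (y + u n) - f y)" for y
        using mult_right_mono[OF B[of y] norm_ge_zero[of "f (y + u n) - f y"]]
        by (simp add: norm_mult mult.commute)
    qed
    also have "\<dots> = B * (\<integral>y. norm (f (y + u n) - f y) \<partial>lborel)" by simp
    finally show "norm ((\<integral>y. f (y + u n) * cnj (f y) \<partial>lborel) - (\<integral>y. f y * cnj (f y) \<partial>lborel)) \<le>
      B * (\<integral>y. norm (f (y + u n) - f y) \<partial>lborel)" .
  qed
  then show ?thesis by (simp add: LIM_zero_iff)
qed

text \<open>The Gaussian-regularised integrals \<open>I n\<close> have limit \<open>h 0\<close>
  times the mass of the kernel, by dominated convergence on the side of \<open>h\<close>. On the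
  frequency side the integrands are nonnegative and increase with \<open>n\<close>, so monotone
  convergence yields integrability and the value at once.\<close>

lemma plancherel_bounded:
  fixes f :: "'a::euclidean_space \<Rightarrow> complex"
  assumes f: "integrable lborel f" and B: "\<And>x. cmod (f x) \<le> B"
  shows "integrable lborel (\<lambda>\<xi>. (cmod (fourier_integral f \<xi>))\<^sup>2)"
    and "(\<integral>\<xi>. (cmod (fourier_integral f \<xi>))\<^sup>2 \<partial>lborel) = (2 * pi) powr DIM('a) * (\<integral>x. (cmod (f x))\<^sup>2 \<partial>lborel)"
proof -
  have m: "f \<in> borel_measurable borel" using borel_measurable_integrable[OF f] by simp
  note [measurable] = m fourier_integral_measurable[OF m]
  have [measurable]: "cnj \<in> borel_measurable borel"
    by (intro borel_measurable_continuous_onI continuous_intros)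
  define h where "h u = (\<integral>y. f (y + u) * cnj (f y) \<partial>lborel)" for u
  have h: "integrable lborel h" unfolding h_def by (rule integrable_autocorrelation[OF f])
  have [measurable]: "h \<in> borel_measurable borel" using borel_measurable_integrable[OF h] by simp
  define c where "c = (2 * pi) powr (DIM('a) / 2)"
  have h0: "h 0 = of_real (\<integral>x. (cmod (f x))\<^sup>2 \<partial>lborel)"
    unfolding h_def add_0_right complex_norm_square[symmetric] by (rule integral_complex_of_real)
  have h_le: "cmod (h u) \<le> B * (\<integral>y. norm (f y) \<partial>lborel)" for u
  proof -
    have "cmod (h u) \<le> (\<integral>y. norm (f (y + u) * cnj (f y)) \<partial>lborel)"
      unfolding h_def by (rule integral_norm_bound)
    also have "\<dots> \<le> (\<integral>y. B * norm (f y) \<partial>lborel)"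
    proof (rule integral_mono')
      show "norm (f (y + u) * cnj (f y)) \<le> B * norm (f y)" for y
        unfolding norm_mult complex_mod_cnj using B by (intro mult_right_mono) auto
      show "0 \<le> B * norm (f y)" for y
        using order_trans[OF norm_ge_zero B] by (intro mult_nonneg_nonneg) auto
    qed (use f in simp)
    finally show ?thesis by simp
  qed
  define e where "e n = inverse (real (Suc n))" for n
  have e: "e n > 0" "e \<longlonglongrightarrow> 0" "m \<le> n \<Longrightarrow> e n \<le> e m" for m n
    unfolding e_def using LIMSEQ_inverse_real_of_nat by (simp_all del: of_nat_Suc)
  define I where "I n = (\<integral>\<xi>. (cmod (fourier_integral f \<xi>))\<^sup>2 * gaussian (e n *\<^sub>R \<xi>) \<partial>lborel)" for n
  have ge: "integrable lborel (\<lambda>\<xi>::'a. gaussian (e n *\<^sub>R \<xi>))" for n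
    using lborel_affine_integrable_integral(1)[of "gaussian :: 'a \<Rightarrow> real" "e n" 0] e(1)[of n] integrable_gaussian by simp
  \<comment> \<open>The transform of the Gaussian at 0 is its integral, \<open>c\<close>; the second
    factor \<open>c\<close> stems from \<open>fourier_gaussian\<close>.\<close>
  have cg: "(\<integral>x. complex_of_real (c * gaussian (x::'a)) \<partial>lborel) = of_real ((2 * pi) powr DIM('a))"
  proof -
    have "(\<integral>x. complex_of_real (gaussian (x::'a)) \<partial>lborel) = fourier_integral (\<lambda>x::'a. of_real (gaussian x)) 0"
      by (simp add: fourier_integral_def)
    also have "\<dots> = of_real c"
      unfolding fourier_gaussian c_def by (simp add: gaussian_def)
    finally have "(\<integral>x. complex_of_real (c * gaussian (x::'a)) \<partial>lborel) = of_real (c * c)" by simp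
    also have "c * c = (2 * pi) powr DIM('a)"
      unfolding c_def by (simp flip: powr_add)
    finally show ?thesis .
  qed
  have "(\<lambda>n. \<integral>x. h (e n *\<^sub>R x) * of_real (c * gaussian x) \<partial>lborel) \<longlonglongrightarrow>
      (\<integral>x. h 0 * of_real (c * gaussian x) \<partial>(lborel :: 'a measure))"
  proof (rule integral_dominated_convergence[where w="\<lambda>x. (B * (\<integral>y. norm (f y) \<partial>lborel)) * (c * gaussian x)"])
    show "integrable lborel (\<lambda>x::'a. (B * (\<integral>y. norm (f y) \<partial>lborel)) * (c * gaussian x))"
      by (intro integrable_mult_right integrable_gaussian)
    show "AE x in lborel. (\<lambda>n. h (e n *\<^sub>R x) * of_real (c * gaussian x)) \<longlonglongrightarrow> h 0 * of_real (c * gaussian x)"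
    proof (rule AE_I2)
      fix x :: 'a
      have "(\<lambda>n. e n *\<^sub>R x) \<longlonglongrightarrow> 0 *\<^sub>R x" by (intro tendsto_intros e)
      then have "(\<lambda>n. e n *\<^sub>R x) \<longlonglongrightarrow> 0" by simp
      from continuous_autocorrelation_0[OF f B this]
      have "(\<lambda>n. h (e n *\<^sub>R x)) \<longlonglongrightarrow> h 0" by (simp add: h_def)
      then show "(\<lambda>n. h (e n *\<^sub>R x) * of_real (c * gaussian x)) \<longlonglongrightarrow> h 0 * of_real (c * gaussian x)"
        by (intro tendsto_intros)
    qed
    show "AE x in lborel. norm (h (e n *\<^sub>R x) * of_real (c * gaussian x)) \<le> (B * (\<integral>y. norm (f y) \<partial>lborel)) * (c * gaussian x)" for n
    proof (rule AE_I2)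
      fix x :: 'a
      have "c * gaussian x \<ge> 0" unfolding c_def using gaussian_pos[of x] by simp
      then have "norm (h (e n *\<^sub>R x) * of_real (c * gaussian x)) = norm (h (e n *\<^sub>R x)) * (c * gaussian x)"
        unfolding norm_mult norm_of_real by simp
      then show "norm (h (e n *\<^sub>R x) * of_real (c * gaussian x)) \<le> (B * (\<integral>y. norm (f y) \<partial>lborel)) * (c * gaussian x)"
        using mult_right_mono[OF h_le \<open>c * gaussian x \<ge> 0\<close>] by simp
    qed
  qed measurable
  also have "(\<lambda>n. \<integral>x. h (e n *\<^sub>R x) * of_real (c * gaussian x) \<partial>lborel) = (\<lambda>n. complex_of_real (I n))"
    unfolding I_def h_def c_def gaussian_regularisation[OF f e(1)] ..
  also have "(\<integral>x. h 0 * of_real (c * gaussian x) \<partial>(lborel :: 'a measure)) =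
      of_real ((2 * pi) powr DIM('a) * (\<integral>x. (cmod (f x))\<^sup>2 \<partial>lborel))"
    unfolding integral_mult_right_zero cg h0 by simp
  finally have I_lim: "I \<longlonglongrightarrow> (2 * pi) powr DIM('a) * (\<integral>x. (cmod (f x))\<^sup>2 \<partial>lborel)"
    unfolding tendsto_of_real_iff .
  have int: "integrable lborel (\<lambda>\<xi>. (cmod (fourier_integral f \<xi>))\<^sup>2 * gaussian (e n *\<^sub>R \<xi>))" for n
  proof (rule Bochner_Integration.integrable_bound)
    show "integrable lborel (\<lambda>\<xi>::'a. (\<integral>x. norm (f x) \<partial>lborel)\<^sup>2 * gaussian (e n *\<^sub>R \<xi>))"
      using ge by simp
    show "AE \<xi> in lborel. norm ((cmod (fourier_integral f \<xi>))\<^sup>2 * gaussian (e n *\<^sub>R \<xi>)) \<le>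
        norm ((\<integral>x. norm (f x) \<partial>lborel)\<^sup>2 * gaussian (e n *\<^sub>R \<xi>))"
    proof (rule AE_I2)
      fix \<xi> :: 'a
      have "(cmod (fourier_integral f \<xi>))\<^sup>2 \<le> (\<integral>x. norm (f x) \<partial>lborel)\<^sup>2"
        by (intro power_mono norm_fourier_integral_le) simp
      then show "norm ((cmod (fourier_integral f \<xi>))\<^sup>2 * gaussian (e n *\<^sub>R \<xi>)) \<le>
        norm ((\<integral>x. norm (f x) \<partial>lborel)\<^sup>2 * gaussian (e n *\<^sub>R \<xi>))"
        unfolding norm_mult by (intro mult_right_mono) simp_all
    qed
  qed measurable
  have mono: "AE \<xi> in lborel. mono (\<lambda>n. (cmod (fourier_integral f \<xi>))\<^sup>2 * gaussian (e n *\<^sub>R \<xi>))"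
  proof (rule AE_I2, rule monoI)
    fix \<xi> :: 'a and m n :: nat assume "m \<le> n"
    then have "norm (e n *\<^sub>R \<xi>) \<le> norm (e m *\<^sub>R \<xi>)"
      using e(1)[of m] e(1)[of n] e(3)[of m n] by (simp add: mult_right_mono)
    then have "(norm (e n *\<^sub>R \<xi>))\<^sup>2 \<le> (norm (e m *\<^sub>R \<xi>))\<^sup>2" by (intro power_mono) auto
    then show "(cmod (fourier_integral f \<xi>))\<^sup>2 * gaussian (e m *\<^sub>R \<xi>) \<le> (cmod (fourier_integral f \<xi>))\<^sup>2 * gaussian (e n *\<^sub>R \<xi>)"
      unfolding gaussian_def by (intro mult_left_mono) auto
  qed
  have lim: "AE \<xi> in lborel. (\<lambda>n. (cmod (fourier_integral f \<xi>))\<^sup>2 * gaussian (e n *\<^sub>R \<xi>)) \<longlonglongrightarrow> (cmod (fourier_integral f \<xi>))\<^sup>2"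
  proof (rule AE_I2)
    fix \<xi> :: 'a
    have "(\<lambda>n. (cmod (fourier_integral f \<xi>))\<^sup>2 * exp (- (norm (e n *\<^sub>R \<xi>))\<^sup>2 / 2)) \<longlonglongrightarrow>
      (cmod (fourier_integral f \<xi>))\<^sup>2 * exp (- (norm (0 *\<^sub>R \<xi>))\<^sup>2 / 2)"
      by (intro tendsto_intros e) simp
    then show "(\<lambda>n. (cmod (fourier_integral f \<xi>))\<^sup>2 * gaussian (e n *\<^sub>R \<xi>)) \<longlonglongrightarrow> (cmod (fourier_integral f \<xi>))\<^sup>2"
      by (simp add: gaussian_def)
  qed
  have meas: "(\<lambda>\<xi>. (cmod (fourier_integral f \<xi>))\<^sup>2) \<in> borel_measurable lborel" by measurable
  show "integrable lborel (\<lambda>\<xi>. (cmod (fourier_integral f \<xi>))\<^sup>2)"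
    by (rule integrable_monotone_convergence[OF int mono lim I_lim[unfolded I_def] meas])
  show "(\<integral>\<xi>. (cmod (fourier_integral f \<xi>))\<^sup>2 \<partial>lborel) = (2 * pi) powr DIM('a) * (\<integral>x. (cmod (f x))\<^sup>2 \<partial>lborel)"
    by (rule integral_monotone_convergence[OF int mono lim I_lim[unfolded I_def] meas])
qed

lemma fourier_integral_diff:
  assumes "integrable lborel f" "integrable lborel g"
  shows "fourier_integral (\<lambda>x. f x - g x) \<xi> = fourier_integral f \<xi> - fourier_integral g \<xi>"
  unfolding fourier_integral_def
  using fourier_integrable[OF assms(1), of \<xi>] fourier_integrable[OF assms(2), of \<xi>]
  by (simp add: right_diff_distrib)

lemma fourier_integral_cmult: "fourier_integral (\<lambda>x. c * f x) \<xi> = c * fourier_integral f \<xi>"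
proof -
  have "fourier_integral (\<lambda>x. c * f x) \<xi> = (\<integral>x. c * (exp (- \<i> * of_real (x \<bullet> \<xi>)) * f x) \<partial>lborel)"
    unfolding fourier_integral_def by (simp only: mult.left_commute)
  then show ?thesis unfolding fourier_integral_def by simp
qed

text \<open>Removes boundedness by truncating values at height \<open>n\<close>. Fatou gives
  membership and an upper bound for the transform; applied to \<open>f - T f n\<close>, that upper
  bound shows that the transforms of the truncations converge in norm, and the identity passes to
  the limit.\<close>

lemma plancherel_L1_L2:
  fixes f :: "'a::euclidean_space \<Rightarrow> complex"
  assumes f: "integrable lborel f" and f2: "f \<in> L2"
  shows "fourier_integral f \<in> L2" "L2_norm (fourier_integral f) = (2 * pi) powr (DIM('a) / 2) * L2_norm f"
proof -
  define c where "c = (2 * pi) powr (DIM('a) / 2)"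
  have c: "c \<ge> 0" "c\<^sup>2 = (2 * pi) powr DIM('a)"
    unfolding c_def by (simp_all add: power2_eq_square flip: powr_add)
  define T where "T f n x = (if cmod (f x) \<le> real n then f x else 0)" for f :: "'a \<Rightarrow> complex" and n x
  have T_meas: "T f n \<in> borel_measurable borel" if "f \<in> borel_measurable borel" for f n
    unfolding T_def using that by measurable
  have T_lim: "(\<lambda>n. T f n x) \<longlonglongrightarrow> f x" for f x
  proof (rule tendsto_eventually)
    have "\<forall>\<^sub>F n in sequentially. cmod (f x) \<le> real n"
      using eventually_ge_at_top[of "nat \<lceil>cmod (f x)\<rceil>"] by eventually_elim linarith
    then show "\<forall>\<^sub>F n in sequentially. T f n x = f x" by eventually_elim (simp add: T_def)
  qed
  have T_le: "cmod (T f n x) \<le> cmod (f x)" "cmod (f x - T f n x) \<le> cmod (f x)" "cmod (T f n x) \<le> real n" for f n x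
    by (simp_all add: T_def)
  have T_int: "integrable lborel (T f n)" if "integrable lborel f" for f n
    using T_meas[of f n] borel_measurable_integrable[OF that] T_le
    by (intro Bochner_Integration.integrable_bound[OF that]) auto
  have T_L2: "T f n \<in> L2" if "f \<in> L2" for f n
    by (rule L2_bounded[OF that, of _ 1]) (auto simp: T_le intro: T_meas L2_measurable[OF that])
  have T_fourier: "fourier_integral (T f n) \<in> L2" "L2_norm (fourier_integral (T f n)) = c * L2_norm (T f n)"
    if "integrable lborel f" for f n
  proof -
    have m: "T f n \<in> borel_measurable borel"
      using borel_measurable_integrable[OF that] by (intro T_meas) simp
    have "sqrt (c\<^sup>2 * (\<integral>x. (cmod (T f n x))\<^sup>2 \<partial>lborel)) = c * L2_norm (T f n)"
      unfolding L2_norm_def real_sqrt_mult real_sqrt_abs abs_of_nonneg[OF c(1)] ..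
    then show "fourier_integral (T f n) \<in> L2" "L2_norm (fourier_integral (T f n)) = c * L2_norm (T f n)"
      using plancherel_bounded[OF T_int[OF that] T_le(3)] fourier_integral_measurable[OF m]
      unfolding c(2) L2_norm_def L2_def by simp_all
  qed
  \<comment> \<open>Stated for every integrable function in \<open>L2\<close> because it is needed
    for the remainders \<open>f - T f n\<close> as well as for \<open>f\<close>.\<close>
  have upper: "fourier_integral f \<in> L2" "L2_norm (fourier_integral f) \<le> c * L2_norm f"
    if f: "integrable lborel f" and f2: "f \<in> L2" for f :: "'a \<Rightarrow> complex"
  proof -
    note [measurable] = L2_measurable[OF f2] T_meas[OF L2_measurable[OF f2]]
    have le: "L2_norm (T f n) \<le> L2_norm f" for n
    proof (rule L2_I_nn(2)[OF T_meas[OF L2_measurable[OF f2]]])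
      have "(\<integral>\<^sup>+x. ennreal ((cmod (T f n x))\<^sup>2) \<partial>lborel) \<le> (\<integral>\<^sup>+x. ennreal ((cmod (f x))\<^sup>2) \<partial>lborel)"
        by (intro nn_integral_mono ennreal_leI power_mono T_le) auto
      then show "(\<integral>\<^sup>+x. ennreal ((cmod (T f n x))\<^sup>2) \<partial>lborel) \<le> ennreal ((L2_norm f)\<^sup>2)"
        using L2_nn_integral[OF f2] by simp
    qed simp
    have lim: "(\<lambda>n. fourier_integral (T f n) \<xi>) \<longlonglongrightarrow> fourier_integral f \<xi>" for \<xi>
      unfolding fourier_integral_def
    proof (rule integral_dominated_convergence)
      show "integrable lborel (\<lambda>x. norm (f x))" using f by simp
      show "AE x in lborel. (\<lambda>n. exp (- \<i> * of_real (x \<bullet> \<xi>)) * T f n x) \<longlonglongrightarrow> exp (- \<i> * of_real (x \<bullet> \<xi>)) * f x"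
        by (intro AE_I2 tendsto_intros T_lim)
    qed (auto simp: norm_mult T_le)
    have bound: "L2_norm (fourier_integral (T f n)) \<le> c * L2_norm f" for n
      unfolding T_fourier(2)[OF f] using le c by (intro mult_left_mono)
    show "fourier_integral f \<in> L2" "L2_norm (fourier_integral f) \<le> c * L2_norm f"
      using L2_Fatou[of "\<lambda>n. fourier_integral (T f n)" "c * L2_norm f" "fourier_integral f"]
        T_fourier(1)[OF f] bound c lim fourier_integral_measurable[OF L2_measurable[OF f2]] by simp_all
  qed
  show L2: "fourier_integral f \<in> L2" by (rule upper[OF f f2])
  have dom: "(\<lambda>n. L2_norm (\<lambda>x. f x - T f n x)) \<longlonglongrightarrow> 0"
  proof (rule L2_dominated_convergence)
    show "integrable lborel (\<lambda>x. (cmod (f x))\<^sup>2)" by (rule L2_integrable[OF f2])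
    show "(\<lambda>x. f x - T f n x) \<in> borel_measurable borel" for n
      using L2_measurable[OF f2] T_meas[OF L2_measurable[OF f2], of n] by measurable
    show "AE x in lborel. cmod (f x - T f n x) \<le> cmod (f x)" for n by (simp add: T_le)
    show "AE x in lborel. (\<lambda>n. f x - T f n x) \<longlonglongrightarrow> 0"
    proof (rule AE_I2)
      fix x
      have "(\<lambda>n. f x - T f n x) \<longlonglongrightarrow> f x - f x" by (intro tendsto_intros T_lim)
      then show "(\<lambda>n. f x - T f n x) \<longlonglongrightarrow> 0" by simp
    qed
  qed
  have "(\<lambda>n. L2_norm (fourier_integral (T f n))) \<longlonglongrightarrow> L2_norm (fourier_integral f)"
  proof (rule L2_norm_tendsto[OF _ L2])
    show "\<forall>\<^sub>F n in sequentially. fourier_integral (T f n) \<in> L2" by (simp add: T_fourier(1)[OF f])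
    show "(\<lambda>n. L2_norm (\<lambda>\<xi>. fourier_integral (T f n) \<xi> - fourier_integral f \<xi>)) \<longlonglongrightarrow> 0"
    proof (rule Lim_null_comparison[OF always_eventually, OF allI])
      fix n
      have "(\<lambda>\<xi>. fourier_integral f \<xi> - fourier_integral (T f n) \<xi>) = fourier_integral (\<lambda>x. f x - T f n x)"
        by (rule ext) (simp add: fourier_integral_diff f T_int)
      then have "L2_norm (\<lambda>\<xi>. fourier_integral (T f n) \<xi> - fourier_integral f \<xi>) = L2_norm (fourier_integral (\<lambda>x. f x - T f n x))"
        by (subst L2_norm_minus_commute) simp
      also have "\<dots> \<le> c * L2_norm (\<lambda>x. f x - T f n x)"
        using f f2 by (intro upper Bochner_Integration.integrable_diff T_int L2_diff T_L2)
      finally show "norm (L2_norm (\<lambda>\<xi>. fourier_integral (T f n) \<xi> - fourier_integral f \<xi>)) \<le> c * L2_norm (\<lambda>x. f x - T f n x)"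
        by simp
      show "(\<lambda>n. c * L2_norm (\<lambda>x. f x - T f n x)) \<longlonglongrightarrow> 0"
        using tendsto_mult_left[OF dom, of c] by simp
    qed
  qed
  moreover have "(\<lambda>n. L2_norm (T f n)) \<longlonglongrightarrow> L2_norm f"
    using dom by (intro L2_norm_tendsto f2) (simp_all add: T_L2 f2 L2_norm_minus_commute[of "T f _" f])
  then have "(\<lambda>n. L2_norm (fourier_integral (T f n))) \<longlonglongrightarrow> c * L2_norm f"
    unfolding T_fourier(2)[OF f] by (intro tendsto_intros)
  ultimately show "L2_norm (fourier_integral f) = (2 * pi) powr (DIM('a) / 2) * L2_norm f"
    unfolding c_def by (rule LIMSEQ_unique)
qed

section \<open>The Fourier transform on L2 as a limit of truncated integrals\<close>

definition cutoff :: "real \<Rightarrow> ('a::euclidean_space \<Rightarrow> complex) \<Rightarrow> 'a \<Rightarrow> complex" where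
  "cutoff R f x = indicator (cball 0 R) x *\<^sub>R f x"

lemma cutoff_L2:
  assumes f: "f \<in> L2"
  shows "cutoff R f \<in> L2" "integrable lborel (cutoff R f)"
proof -
  note [measurable] = L2_measurable[OF f]
  have [measurable]: "cball 0 R \<in> sets borel" by simp
  have m [measurable]: "cutoff R f \<in> borel_measurable borel"
    unfolding cutoff_def[abs_def] by measurable
  show "cutoff R f \<in> L2"
    by (rule L2_bounded[OF f m, of 1]) (auto simp: cutoff_def split: split_indicator)
  \<comment> \<open>Majorant from \<open>r \<le> r\<^sup>2 + 1\<close>, the constant 1 being
    integrable on the ball.\<close>
  have "integrable lborel (\<lambda>x. (cmod (f x))\<^sup>2 + indicator (cball 0 R) x)"
    using L2_integrable[OF f] by (intro Bochner_Integration.integrable_add integrable_real_indicator) (auto simp: emeasure_bounded_finite[OF bounded_cball, unfolded infinity_ennreal_def])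
  then show "integrable lborel (cutoff R f)"
  proof (rule Bochner_Integration.integrable_bound)
    show "AE x in lborel. norm (cutoff R f x) \<le> norm ((cmod (f x))\<^sup>2 + indicator (cball 0 R) x)"
    proof (rule AE_I2)
      fix x
      have "cmod (f x) \<le> (cmod (f x))\<^sup>2 + 1"
        using sum_power2_ge_zero[of "cmod (f x) - 1/2" 0] by (simp add: power2_eq_square algebra_simps)
      then show "norm (cutoff R f x) \<le> norm ((cmod (f x))\<^sup>2 + indicator (cball 0 R) x)"
        by (auto simp: cutoff_def split: split_indicator)
    qed
  qed simp
qed

lemma cutoff_tendsto:
  assumes f: "f \<in> L2" and X: "filterlim X at_top sequentially"
  shows "(\<lambda>n. L2_norm (\<lambda>x. cutoff (X n) f x - f x)) \<longlonglongrightarrow> 0"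
proof (rule L2_dominated_convergence)
  show "integrable lborel (\<lambda>x. (cmod (f x))\<^sup>2)" by (rule L2_integrable[OF f])
  show "(\<lambda>x. cutoff (X n) f x - f x) \<in> borel_measurable borel" for n
    by (rule L2_measurable[OF L2_diff(1)[OF cutoff_L2(1)[OF f] f]])
  show "AE x in lborel. cmod (cutoff (X n) f x - f x) \<le> cmod (f x)" for n
    by (auto simp: cutoff_def split: split_indicator)
  show "AE x in lborel. (\<lambda>n. cutoff (X n) f x - f x) \<longlonglongrightarrow> 0"
  proof (intro AE_I2 tendsto_eventually)
    fix x :: 'a
    have "\<forall>\<^sub>F n in sequentially. X n \<ge> norm x"
      using X by (simp add: filterlim_at_top)
    then show "\<forall>\<^sub>F n in sequentially. cutoff (X n) f x - f x = 0"
      by eventually_elim (simp add: cutoff_def)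
  qed
qed

lemma fourier_trunc_eq:
  "fourier_trunc R (f :: 'a::euclidean_space \<Rightarrow> complex) =
    (\<lambda>\<xi>. of_real ((2 * pi) powr (- real DIM('a) / 2)) * fourier_integral (cutoff R f) \<xi>)"
  unfolding fourier_trunc_def[abs_def] fourier_integral_def cutoff_def set_lebesgue_integral_def
  by (simp only: mult_scaleR_right)

text \<open>The normalising factor makes Plancherel an isometry. The third identity transports the
  Cauchy property from the spatial cutoffs to their transforms.\<close>

lemma fourier_trunc_L2:
  fixes f :: "'a::euclidean_space \<Rightarrow> complex"
  assumes f: "f \<in> L2"
  shows "fourier_trunc R f \<in> L2" "L2_norm (fourier_trunc R f) = L2_norm (cutoff R f)"
    "L2_norm (\<lambda>\<xi>. fourier_trunc R f \<xi> - fourier_trunc S f \<xi>) = L2_norm (\<lambda>x. cutoff R f x - cutoff S f x)"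
proof -
  define c where "c = (2 * pi) powr (DIM('a) / 2)"
  have c: "c > 0" "(2 * pi) powr (- real DIM('a) / 2) = inverse c"
    unfolding c_def by (simp_all add: powr_minus)
  have eq: "L2_norm (\<lambda>\<xi>. of_real ((2 * pi) powr (- real DIM('a) / 2)) * fourier_integral g \<xi>) = L2_norm g"
    if "integrable lborel g" "g \<in> L2" for g :: "'a \<Rightarrow> complex"
    unfolding L2_norm_cmult plancherel_L1_L2(2)[OF that] c using c(1) by (simp add: c_def[symmetric] norm_inverse)
  show "fourier_trunc R f \<in> L2" unfolding fourier_trunc_eq
    by (intro L2_cmult plancherel_L1_L2 cutoff_L2 f)
  show "L2_norm (fourier_trunc R f) = L2_norm (cutoff R f)"
    unfolding fourier_trunc_eq by (rule eq) (rule cutoff_L2[OF f])+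
  have "(\<lambda>\<xi>. fourier_trunc R f \<xi> - fourier_trunc S f \<xi>) =
     (\<lambda>\<xi>. of_real ((2 * pi) powr (- real DIM('a) / 2)) * fourier_integral (\<lambda>x. cutoff R f x - cutoff S f x) \<xi>)"
    unfolding fourier_trunc_eq fourier_integral_diff[OF cutoff_L2(2)[OF f] cutoff_L2(2)[OF f]] right_diff_distrib ..
  then show "L2_norm (\<lambda>\<xi>. fourier_trunc R f \<xi> - fourier_trunc S f \<xi>) = L2_norm (\<lambda>x. cutoff R f x - cutoff S f x)"
    using eq[of "\<lambda>x. cutoff R f x - cutoff S f x"] cutoff_L2[OF f] L2_diff(1)[OF cutoff_L2(1)[OF f] cutoff_L2(1)[OF f]]
    by simp
qed

text \<open>Completeness is applied along integer radii, while \<open>has_fourier\<close> asks for a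
  limit over real radii. The isometry bridges the gap: transforms at radii \<open>X n\<close> and
  \<open>n\<close> differ by at most the sum of two cutoff errors of \<open>f\<close>.\<close>

lemma has_fourier_exists:
  fixes f :: "'a::euclidean_space \<Rightarrow> complex"
  assumes f: "f \<in> L2"
  obtains g where "has_fourier f g"
proof -
  note cut = cutoff_L2(1)[OF f]
  have diff_le: "L2_norm (\<lambda>\<xi>. fourier_trunc R f \<xi> - fourier_trunc S f \<xi>) \<le>
      L2_norm (\<lambda>x. cutoff R f x - f x) + L2_norm (\<lambda>x. cutoff S f x - f x)" for R S
    unfolding fourier_trunc_L2(3)[OF f]
    using L2_norm_triangle[OF cut f cut, of R S] by (simp add: L2_norm_minus_commute[of f])
  define t where "t n = L2_norm (\<lambda>x. cutoff (real n) f x - f x)" for n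
  have t: "t \<longlonglongrightarrow> 0"
    unfolding t_def by (rule cutoff_tendsto[OF f filterlim_real_sequentially])
  have Cauchy: "\<exists>N. \<forall>m\<ge>N. \<forall>n\<ge>N. L2_norm (\<lambda>\<xi>. fourier_trunc (real m) f \<xi> - fourier_trunc (real n) f \<xi>) \<le> e"
    if e: "e > 0" for e
  proof -
    obtain N where N: "\<And>n. n \<ge> N \<Longrightarrow> norm (t n - 0) < e / 2"
      using LIMSEQ_D[OF t half_gt_zero[OF e]] by blast
    have "L2_norm (\<lambda>\<xi>. fourier_trunc (real m) f \<xi> - fourier_trunc (real n) f \<xi>) \<le> e" if "m \<ge> N" "n \<ge> N" for m n
      using diff_le[of "real m" "real n"] N[OF that(1)] N[OF that(2)] unfolding t_def[symmetric] by simp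
    then show ?thesis by blast
  qed
  obtain g where g: "g \<in> L2" "(\<lambda>n. L2_norm (\<lambda>\<xi>. fourier_trunc (real n) f \<xi> - g \<xi>)) \<longlonglongrightarrow> 0"
    using L2_complete[of "\<lambda>n. fourier_trunc (real n) f", OF fourier_trunc_L2(1)[OF f] Cauchy] by auto
  have "((\<lambda>R. L2_norm (\<lambda>\<xi>. fourier_trunc R f \<xi> - g \<xi>)) \<longlongrightarrow> 0) at_top"
  proof (rule tendsto_at_topI_sequentially)
    fix X :: "nat \<Rightarrow> real" assume X: "filterlim X at_top sequentially"
    show "(\<lambda>n. L2_norm (\<lambda>\<xi>. fourier_trunc (X n) f \<xi> - g \<xi>)) \<longlonglongrightarrow> 0"
    proof (rule Lim_null_comparison[OF always_eventually, OF allI])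
      have "(\<lambda>n. (L2_norm (\<lambda>x. cutoff (X n) f x - f x) + t n) + L2_norm (\<lambda>\<xi>. fourier_trunc (real n) f \<xi> - g \<xi>)) \<longlonglongrightarrow> (0 + 0) + 0"
        by (intro tendsto_add cutoff_tendsto[OF f X] t g)
      then show "(\<lambda>n. (L2_norm (\<lambda>x. cutoff (X n) f x - f x) + t n) + L2_norm (\<lambda>\<xi>. fourier_trunc (real n) f \<xi> - g \<xi>)) \<longlonglongrightarrow> 0"
        by simp
      fix n
      show "norm (L2_norm (\<lambda>\<xi>. fourier_trunc (X n) f \<xi> - g \<xi>)) \<le>
         (L2_norm (\<lambda>x. cutoff (X n) f x - f x) + t n) + L2_norm (\<lambda>\<xi>. fourier_trunc (real n) f \<xi> - g \<xi>)"
        using L2_norm_triangle[OF fourier_trunc_L2(1)[OF f] fourier_trunc_L2(1)[OF f] g(1), of "X n" "real n"]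
          diff_le[of "X n" "real n"] unfolding t_def by simp
    qed
  qed
  then have "has_fourier f g"
    unfolding has_fourier_def using g(1) L2_diff(1)[OF fourier_trunc_L2(1)[OF f] g(1)] by simp
  then show thesis by (rule that)
qed

lemma has_fourier_fourier: "f \<in> L2 \<Longrightarrow> has_fourier f (fourier f)"
  unfolding fourier_def using has_fourier_exists by (metis someI)

lemma fourier_L2: "f \<in> L2 \<Longrightarrow> fourier f \<in> L2"
  using has_fourier_fourier by (auto simp: has_fourier_def)

lemma L2_norm_fourier:
  assumes f: "f \<in> L2"
  shows "L2_norm (fourier f) = L2_norm f"
proof (rule LIMSEQ_unique)
  have "((\<lambda>R. L2_norm (\<lambda>\<xi>. fourier_trunc R f \<xi> - fourier f \<xi>)) \<longlongrightarrow> 0) at_top"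
    using has_fourier_fourier[OF f] by (simp add: has_fourier_def)
  from filterlim_compose[OF this filterlim_real_sequentially]
  show "(\<lambda>n. L2_norm (fourier_trunc (real n) f)) \<longlonglongrightarrow> L2_norm (fourier f)"
    by (intro L2_norm_tendsto fourier_L2[OF f] always_eventually allI fourier_trunc_L2(1)[OF f])
  show "(\<lambda>n. L2_norm (fourier_trunc (real n) f)) \<longlonglongrightarrow> L2_norm f"
    unfolding fourier_trunc_L2(2)[OF f]
    by (intro L2_norm_tendsto f always_eventually allI cutoff_L2(1)[OF f] cutoff_tendsto[OF f filterlim_real_sequentially])
qed

lemma fourier_trunc_diff:
  assumes "f \<in> L2" "g \<in> L2"
  shows "fourier_trunc R (\<lambda>x. f x - g x) \<xi> = fourier_trunc R f \<xi> - fourier_trunc R g \<xi>"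
proof -
  have "cutoff R (\<lambda>x. f x - g x) = (\<lambda>x. cutoff R f x - cutoff R g x)"
    by (rule ext) (simp add: cutoff_def scaleR_diff_right)
  then show ?thesis
    unfolding fourier_trunc_eq
    by (simp add: fourier_integral_diff cutoff_L2(2)[OF assms(1)] cutoff_L2(2)[OF assms(2)] right_diff_distrib)
qed

lemma fourier_trunc_cmult: "fourier_trunc R (\<lambda>x. c * f x) \<xi> = c * fourier_trunc R f \<xi>"
proof -
  have "cutoff R (\<lambda>x. c * f x) = (\<lambda>x. c * cutoff R f x)"
    by (rule ext) (simp add: cutoff_def)
  then show ?thesis
    unfolding fourier_trunc_eq by (simp add: fourier_integral_cmult mult.left_commute)
qed

lemma has_fourier_unique:
  assumes f: "f \<in> L2" and "has_fourier f g" "has_fourier f h"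
  shows "AE \<xi> in lborel. g \<xi> = h \<xi>"
proof -
  have g: "g \<in> L2" "((\<lambda>R. L2_norm (\<lambda>\<xi>. fourier_trunc R f \<xi> - g \<xi>)) \<longlongrightarrow> 0) at_top"
    and h: "h \<in> L2" "((\<lambda>R. L2_norm (\<lambda>\<xi>. fourier_trunc R f \<xi> - h \<xi>)) \<longlongrightarrow> 0) at_top"
    using assms by (simp_all add: has_fourier_def)
  have "((\<lambda>R. L2_norm (\<lambda>\<xi>. fourier_trunc R f \<xi> - g \<xi>) + L2_norm (\<lambda>\<xi>. fourier_trunc R f \<xi> - h \<xi>)) \<longlongrightarrow> 0 + 0) at_top"
    by (intro tendsto_add g h)
  moreover have "L2_norm (\<lambda>\<xi>. g \<xi> - h \<xi>) \<le> L2_norm (\<lambda>\<xi>. fourier_trunc R f \<xi> - g \<xi>) + L2_norm (\<lambda>\<xi>. fourier_trunc R f \<xi> - h \<xi>)" for R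
    using L2_norm_triangle[OF g(1) fourier_trunc_L2(1)[OF f] h(1), of R]
    by (simp add: L2_norm_minus_commute[of g])
  ultimately have "L2_norm (\<lambda>\<xi>. g \<xi> - h \<xi>) \<le> 0 + 0"
    by (intro tendsto_lowerbound) (auto intro: always_eventually)
  then have "L2_norm (\<lambda>\<xi>. g \<xi> - h \<xi>) = 0" by (simp add: antisym)
  from L2_norm_eq_0_AE[OF L2_diff(1)[OF g(1) h(1)] this] show ?thesis by simp
qed

text \<open>\<open>fourier\<close> picks representatives, so linearity can be claimed only almost
  everywhere, through uniqueness of the L2 limit. The shape \<open>c * (f - g)\<close> is that of a
  difference quotient in time.\<close>

lemma fourier_diff_cmult:
  assumes f: "f \<in> L2" and g: "g \<in> L2"
  shows "AE \<xi> in lborel. fourier (\<lambda>x. c * (f x - g x)) \<xi> = c * (fourier f \<xi> - fourier g \<xi>)"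
proof (rule has_fourier_unique[OF _ has_fourier_fourier])
  show L2: "(\<lambda>x. c * (f x - g x)) \<in> L2" by (intro L2_cmult L2_diff f g)
  then show "(\<lambda>x. c * (f x - g x)) \<in> L2" .
  have F: "((\<lambda>R. L2_norm (\<lambda>\<xi>. fourier_trunc R f \<xi> - fourier f \<xi>)) \<longlongrightarrow> 0) at_top"
    and G: "((\<lambda>R. L2_norm (\<lambda>\<xi>. fourier_trunc R g \<xi> - fourier g \<xi>)) \<longlongrightarrow> 0) at_top"
    using has_fourier_fourier[OF f] has_fourier_fourier[OF g] by (simp_all add: has_fourier_def)
  have L2': "(\<lambda>\<xi>. c * (fourier f \<xi> - fourier g \<xi>)) \<in> L2"
    by (intro L2_cmult L2_diff fourier_L2 f g)
  have eq: "fourier_trunc R (\<lambda>x. c * (f x - g x)) \<xi> - c * (fourier f \<xi> - fourier g \<xi>) =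
     c * ((fourier_trunc R f \<xi> - fourier f \<xi>) - (fourier_trunc R g \<xi> - fourier g \<xi>))" for R \<xi>
    unfolding fourier_trunc_cmult fourier_trunc_diff[OF f g] by (simp add: algebra_simps)
  have d: "(\<lambda>\<xi>. fourier_trunc R f \<xi> - fourier f \<xi>) \<in> L2" "(\<lambda>\<xi>. fourier_trunc R g \<xi> - fourier g \<xi>) \<in> L2" for R
    by (intro L2_diff fourier_trunc_L2 fourier_L2 f g)+
  have "((\<lambda>R. L2_norm (\<lambda>\<xi>. fourier_trunc R (\<lambda>x. c * (f x - g x)) \<xi> - c * (fourier f \<xi> - fourier g \<xi>))) \<longlongrightarrow> 0) at_top"
  proof (rule Lim_null_comparison[OF always_eventually, OF allI])
    fix R
    show "norm (L2_norm (\<lambda>\<xi>. fourier_trunc R (\<lambda>x. c * (f x - g x)) \<xi> - c * (fourier f \<xi> - fourier g \<xi>))) \<le>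
       cmod c * (L2_norm (\<lambda>\<xi>. fourier_trunc R f \<xi> - fourier f \<xi>) + L2_norm (\<lambda>\<xi>. fourier_trunc R g \<xi> - fourier g \<xi>))"
      unfolding eq L2_norm_cmult using L2_diff(2)[OF d] by (simp add: mult_left_mono)
    have "((\<lambda>R. cmod c * (L2_norm (\<lambda>\<xi>. fourier_trunc R f \<xi> - fourier f \<xi>) + L2_norm (\<lambda>\<xi>. fourier_trunc R g \<xi> - fourier g \<xi>))) \<longlongrightarrow> cmod c * (0 + 0)) at_top"
      by (intro tendsto_intros F G)
    then show "((\<lambda>R. cmod c * (L2_norm (\<lambda>\<xi>. fourier_trunc R f \<xi> - fourier f \<xi>) + L2_norm (\<lambda>\<xi>. fourier_trunc R g \<xi> - fourier g \<xi>))) \<longlongrightarrow> 0) at_top"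
      by simp
  qed
  then show "has_fourier (\<lambda>x. c * (f x - g x)) (\<lambda>\<xi>. c * (fourier f \<xi> - fourier g \<xi>))"
    unfolding has_fourier_def using L2' L2_diff(1)[OF fourier_trunc_L2(1)[OF L2] L2'] by simp
qed

section \<open>Oscillators with growing stiffness\<close>

lemma has_real_derivative_inner:
  fixes f g :: "real \<Rightarrow> 'b::real_inner"
  assumes "(f has_vector_derivative f') (at x)" "(g has_vector_derivative g') (at x)"
  shows "((\<lambda>t. f t \<bullet> g t) has_real_derivative (f x \<bullet> g' + f' \<bullet> g x)) (at x)"
  using bounded_bilinear.has_vector_derivative[OF bounded_bilinear_inner assms]
  by (simp add: has_real_derivative_iff_has_vector_derivative)

text \<open>Form used for all Lyapunov functionals: the differential equation holds at positive
  times, and the starting point is reached by continuity.\<close>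

lemma decreasing_on_interval:
  fixes f f' :: "real \<Rightarrow> real"
  assumes "a \<le> b" "continuous_on {a..b} f"
    and "\<And>t. a < t \<Longrightarrow> t < b \<Longrightarrow> (f has_real_derivative f' t) (at t)"
    and "\<And>t. a < t \<Longrightarrow> t < b \<Longrightarrow> f' t \<le> 0"
  shows "f b \<le> f a"
proof (rule DERIV_nonpos_imp_decreasing_open[OF assms(1) _ assms(2)])
  fix t assume "a < t" "t < b"
  then show "\<exists>y. (f has_real_derivative y) (at t) \<and> y \<le> 0"
    using assms(3,4) by (intro exI[of _ "f' t"] conjI)
qed

lemma continuous_on_DERIV:
  fixes f f' :: "real \<Rightarrow> real"
  assumes "\<And>s. (f has_real_derivative f' s) (at s)"
  shows "continuous_on S f"
  by (rule DERIV_continuous_on[of S f f']) (rule has_field_derivative_at_within[OF assms])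

lemma norm_increment_le:
  fixes f :: "real \<Rightarrow> 'a::real_normed_vector"
  assumes ab: "a \<le> b" and f: "continuous_on {a..b} f"
    and f': "\<And>s. a < s \<Longrightarrow> s < b \<Longrightarrow> (f has_vector_derivative f' s) (at s)"
    and phi: "\<And>s. (\<phi> has_real_derivative \<phi>' s) (at s)"
    and le: "\<And>s. a < s \<Longrightarrow> s < b \<Longrightarrow> norm (f' s) \<le> \<phi>' s"
  shows "norm (f b - f a) \<le> \<phi> b - \<phi> a"
proof (cases "a = b")
  case False
  show ?thesis
  proof (rule differentiable_bound_general[OF _ f continuous_on_DERIV[OF phi] f' _ le])
    show "(\<phi> has_vector_derivative \<phi>' s) (at s)" for s
      using phi by (simp add: has_real_derivative_iff_has_vector_derivative)
  qed (use False ab in auto)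
qed simp

text \<open>In the variable \<open>\<tau> = ln (1 + t)\<close> the damped wave equation at frequency \<open>\<xi>\<close>, \<open>k = |\<xi>|\<^sup>2\<close>,
  becomes an oscillator with exponentially growing stiffness.\<close>

locale oscillator =
  fixes k \<kappa> :: real and x x' :: "real \<Rightarrow> complex"
  assumes k_nonneg: "k \<ge> 0"
    and cont_x: "continuous_on {0..} x" and cont_x': "continuous_on {0..} x'"
    and deriv_x: "\<And>\<tau>. \<tau> > 0 \<Longrightarrow> (x has_vector_derivative x' \<tau>) (at \<tau>)"
    and deriv_x': "\<And>\<tau>. \<tau> > 0 \<Longrightarrow> (x' has_vector_derivative ((\<kappa> - k * exp (2 * \<tau>)) *\<^sub>R x \<tau>)) (at \<tau>)"
begin

text \<open>The quantities \<open>K\<close>, \<open>a\<close>, \<open>b\<close>, \<open>c\<close>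
  form a closed system: \<open>K' = 2K\<close>, \<open>a' = 2b\<close>,
  \<open>b' = (\<kappa> - K) a + c\<close>, \<open>c' = 2 (\<kappa> - K) b\<close>. Differentiating
  any functional built from them is then pure algebra.\<close>

definition K :: "real \<Rightarrow> real" where "K \<tau> = k * exp (2 * \<tau>)"
definition a :: "real \<Rightarrow> real" where "a \<tau> = x \<tau> \<bullet> x \<tau>"
definition b :: "real \<Rightarrow> real" where "b \<tau> = x \<tau> \<bullet> x' \<tau>"
definition c :: "real \<Rightarrow> real" where "c \<tau> = x' \<tau> \<bullet> x' \<tau>"

lemma K_nonneg [simp]: "K \<tau> \<ge> 0" using k_nonneg by (simp add: K_def)
lemma a_nonneg [simp]: "a \<tau> \<ge> 0" and c_nonneg [simp]: "c \<tau> \<ge> 0" by (simp_all add: a_def c_def)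
lemma a_eq: "a \<tau> = (norm (x \<tau>))\<^sup>2" by (simp add: a_def power2_norm_eq_inner)

lemma norm_combination: "(norm (x' \<tau> + r *\<^sub>R x \<tau>))\<^sup>2 = c \<tau> + 2 * r * b \<tau> + r\<^sup>2 * a \<tau>"
  unfolding a_def b_def c_def power2_norm_eq_inner
  by (simp add: inner_add_left inner_add_right inner_commute power2_eq_square algebra_simps)

lemma deriv_K: "(K has_real_derivative 2 * K \<tau>) (at \<tau>)"
  unfolding K_def by (auto intro!: derivative_eq_intros)

lemma deriv_a: "(a has_real_derivative 2 * b \<tau>) (at \<tau>)" if "\<tau> > 0"
  unfolding a_def b_def
  using has_real_derivative_inner[OF deriv_x deriv_x, OF that that] by (simp add: inner_commute)

lemma deriv_b: "(b has_real_derivative (\<kappa> - K \<tau>) * a \<tau> + c \<tau>) (at \<tau>)" if "\<tau> > 0"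
  unfolding a_def b_def c_def K_def
  using has_real_derivative_inner[OF deriv_x deriv_x', OF that that] by simp

lemma deriv_c: "(c has_real_derivative 2 * (\<kappa> - K \<tau>) * b \<tau>) (at \<tau>)" if "\<tau> > 0"
proof -
  have "(c has_real_derivative (x' \<tau> \<bullet> (\<kappa> - k * exp (2 * \<tau>)) *\<^sub>R x \<tau> + (\<kappa> - k * exp (2 * \<tau>)) *\<^sub>R x \<tau> \<bullet> x' \<tau>)) (at \<tau>)"
    unfolding c_def by (rule has_real_derivative_inner[OF deriv_x' deriv_x', OF that that])
  also have "x' \<tau> \<bullet> (\<kappa> - k * exp (2 * \<tau>)) *\<^sub>R x \<tau> + (\<kappa> - k * exp (2 * \<tau>)) *\<^sub>R x \<tau> \<bullet> x' \<tau> = 2 * (\<kappa> - K \<tau>) * b \<tau>"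
    unfolding inner_scaleR_left inner_scaleR_right inner_commute[of "x' \<tau>"] K_def b_def by (rule mult_2[symmetric, THEN trans]) (rule mult.assoc[symmetric])
  finally show ?thesis .
qed

lemma continuous_quadratic:
  assumes "S \<subseteq> {0..}"
  shows "continuous_on S a" "continuous_on S b" "continuous_on S c" "continuous_on S K"
proof -
  have "continuous_on S x" "continuous_on S x'"
    using cont_x cont_x' assms by (blast intro: continuous_on_subset)+
  then show "continuous_on S a" "continuous_on S b" "continuous_on S c"
    unfolding a_def b_def c_def by (simp_all add: continuous_on_inner)
  show "continuous_on S K" unfolding K_def by (intro continuous_intros)
qed

text \<open>Here the full stiffness \<open>K - \<kappa>\<close> is positive and increasing. The
  energy divided by the stiffness, \<open>a + c / (K - \<kappa>)\<close>, has cancelling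
  \<open>b\<close> terms and loses only through the growth of the denominator.\<close>

lemma norm_bound_negative:
  assumes \<kappa>: "\<kappa> < 0" and t: "\<tau> \<ge> 0"
  shows "(norm (x \<tau>))\<^sup>2 \<le> (norm (x 0))\<^sup>2 + (norm (x' 0))\<^sup>2 / - \<kappa>"
proof -
  have pos: "K s - \<kappa> > 0" for s using \<kappa> K_nonneg[of s] by linarith
  define i where "i s = inverse (K s - \<kappa>)" for s
  have i_pos: "i s > 0" and i: "(\<kappa> - K s) * i s = - 1" for s
    using pos[of s] by (simp_all add: i_def divide_simps flip: divide_inverse)
  have deriv_i: "(i has_real_derivative - 2 * K s * (i s)\<^sup>2) (at s)" for s
  proof -
    have "((\<lambda>s. K s - \<kappa>) has_real_derivative 2 * K s) (at s)"
      using DERIV_diff[OF deriv_K DERIV_const] by simp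
    from DERIV_inverse_fun[OF this] show ?thesis
      unfolding i_def using pos[of s] by (simp add: power2_eq_square mult_ac)
  qed
  define E where "E s = a s + c s * i s" for s
  define E' where "E' s = - 2 * K s * c s * (i s)\<^sup>2" for s
  have "E \<tau> \<le> E 0"
  proof (rule decreasing_on_interval[where f = E and f' = E'])
    show "continuous_on {0..\<tau>} E" unfolding E_def
      by (intro continuous_on_add continuous_on_mult continuous_quadratic continuous_on_DERIV[OF deriv_i]) auto
    show "(E has_real_derivative E' s) (at s)" if "0 < s" for s
    proof -
      have eq: "2 * (\<kappa> - K s) * b s * i s = - 2 * b s"
      proof -
        have "2 * (\<kappa> - K s) * b s * i s = 2 * b s * ((\<kappa> - K s) * i s)" by (simp only: mult_ac)
        then show ?thesis unfolding i by simp
      qed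
      show ?thesis
        unfolding E_def E'_def
        by (intro DERIV_cong[OF DERIV_add[OF deriv_a[OF that] DERIV_mult[OF deriv_c[OF that] deriv_i]]])
           (simp only: eq, simp)
    qed
    show "E' s \<le> 0" for s
      unfolding E'_def by simp
  qed (use t in auto)
  moreover have "E \<tau> \<ge> a \<tau>" unfolding E_def using i_pos[of \<tau>] by simp
  moreover have "E 0 \<le> a 0 + c 0 / - \<kappa>"
    unfolding E_def i_def divide_inverse using \<kappa> K_nonneg[of 0]
    by (intro add_mono mult_left_mono le_imp_inverse_le) auto
  ultimately show ?thesis by (simp add: a_def c_def power2_norm_eq_inner)
qed

text \<open>The combination \<open>z = x' + \<nu> x\<close> satisfies
  \<open>z' = \<nu> z - K x\<close>. Dividing \<open>|z|\<^sup>2 + K |x|\<^sup>2\<close> by the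
  square of the growing mode cancels the mixed terms and leaves the rate
  \<open>(2 - 4\<nu>) K a\<close>, whose sign is what requires \<open>\<nu> \<ge> 1/2\<close>. The
  estimate contains no constant depending on \<open>k\<close>.\<close>

lemma energy_bound:
  assumes \<kappa>: "\<kappa> = \<nu>\<^sup>2" and \<nu>: "\<nu> \<ge> 1/2" and t: "\<tau> \<ge> 0"
  shows "(norm (x' \<tau> + \<nu> *\<^sub>R x \<tau>))\<^sup>2 + k * exp (2 * \<tau>) * (norm (x \<tau>))\<^sup>2 \<le>
    exp (2 * \<nu> * \<tau>) * ((norm (x' 0 + \<nu> *\<^sub>R x 0))\<^sup>2 + k * (norm (x 0))\<^sup>2)"
proof -
  define g where "g s = exp (- 2 * \<nu> * s)" for s
  have deriv_g: "(g has_real_derivative - 2 * \<nu> * g s) (at s)" for s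
    unfolding g_def by (auto intro!: derivative_eq_intros)
  define E where "E s = g s * (c s + 2 * \<nu> * b s + \<nu>\<^sup>2 * a s + K s * a s)" for s
  define E' where "E' s = g s * ((2 - 4 * \<nu>) * K s * a s)" for s
  have "E \<tau> \<le> E 0"
  proof (rule decreasing_on_interval[where f = E and f' = E'])
    show "continuous_on {0..\<tau>} E" unfolding E_def g_def
      by (intro continuous_intros continuous_quadratic) auto
    show "(E has_real_derivative E' s) (at s)" if "0 < s" for s
      unfolding E_def
      apply (rule DERIV_cong)
       apply (rule deriv_a[OF that] deriv_b[OF that] deriv_c[OF that] deriv_K deriv_g
          DERIV_const DERIV_add DERIV_mult)+
      unfolding E'_def \<kappa> by (simp add: algebra_simps power2_eq_square)
    show "E' s \<le> 0" for s
      unfolding E'_def g_def using \<nu> by (intro mult_nonneg_nonpos mult_nonpos_nonneg) auto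
  qed (use t in auto)
  then have "exp (2 * \<nu> * \<tau>) * E \<tau> \<le> exp (2 * \<nu> * \<tau>) * E 0" by simp
  moreover have "exp (2 * \<nu> * \<tau>) * E \<tau> = c \<tau> + 2 * \<nu> * b \<tau> + \<nu>\<^sup>2 * a \<tau> + K \<tau> * a \<tau>"
    unfolding E_def g_def by (simp flip: mult.assoc exp_add)
  moreover have "E 0 = c 0 + 2 * \<nu> * b 0 + \<nu>\<^sup>2 * a 0 + k * a 0"
    by (simp add: E_def K_def g_def)
  ultimately show ?thesis
    by (simp only: norm_combination K_def flip: a_eq)
qed

text \<open>\<open>h * (K * a + p)\<close> is the classical energy, in the original time, of the
  undamped wave. Its derivative comes from the potential alone and is at most
  \<open>m * exp (- s)\<close> times itself; \<open>g\<close> is the matching Gronwall factor, lying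
  between 1 and \<open>exp m\<close> at nonnegative times. As \<open>m\<close> blows up when
  \<open>k\<close> tends to 0, the bound serves limits at fixed frequency.\<close>

lemma wave_energy_bounded:
  assumes k: "k > 0"
  obtains C where "C \<ge> 0" "\<And>\<tau>. \<tau> \<ge> 0 \<Longrightarrow> k * exp (2 * \<tau>) * (norm (x \<tau>))\<^sup>2 + (norm (x' \<tau> + (1/2) *\<^sub>R x \<tau>))\<^sup>2 \<le> C * exp \<tau>"
proof -
  \<comment> \<open>From Cauchy-Schwarz and 2uv \<le> u^2 + v^2:
    \<open>2 * sqrt k * exp s * \<bar>b s + a s / 2\<bar>\<close> is at most
    \<open>K s * a s + p s\<close>.\<close>
  define m where "m = \<bar>\<kappa> - 1/4\<bar> / sqrt k"
  have m: "m \<ge> 0" using k by (simp add: m_def)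
  define p where "p s = c s + b s + (1/4) * a s" for s
  have p: "p s = (norm (x' s + (1/2) *\<^sub>R x s))\<^sup>2" for s
    using norm_combination[of s "1/2"] by (simp add: p_def field_simps power_divide)
  define h where "h s = exp (- s)" for s :: real
  define g where "g s = exp (m * exp (- s))" for s
  define E where "E s = h s * (K s * a s + p s) * g s" for s
  define E' where "E' s = h s * g s *
      (2 * (\<kappa> - 1/4) * (b s + a s / 2) - m * h s * (K s * a s + p s))" for s
  have deriv_h: "(h has_real_derivative - h s) (at s)" for s
    unfolding h_def by (auto intro!: derivative_eq_intros)
  have deriv_g: "(g has_real_derivative - m * h s * g s) (at s)" for s
    unfolding g_def h_def by (auto intro!: derivative_eq_intros)
  have g: "g s \<ge> 1" for s using m by (simp add: g_def)
  have E: "E \<tau> \<le> E 0" if t: "\<tau> \<ge> 0" for \<tau>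
  proof (rule decreasing_on_interval[where f = E and f' = E'])
    have "continuous_on {0..\<tau>} h" "continuous_on {0..\<tau>} g"
      by (rule continuous_on_DERIV[OF deriv_h]) (rule continuous_on_DERIV[OF deriv_g])
    then show "continuous_on {0..\<tau>} E" unfolding E_def p_def
      by (intro continuous_intros continuous_quadratic) auto
    show "(E has_real_derivative E' s) (at s)" if "0 < s" for s
      unfolding E_def p_def
      apply (rule DERIV_cong)
       apply (rule deriv_a[OF that] deriv_b[OF that] deriv_c[OF that] deriv_K deriv_g deriv_h
          DERIV_const DERIV_add DERIV_mult)+
      unfolding E'_def p_def by (simp add: algebra_simps power2_eq_square)
    show "E' s \<le> 0" for s
    proof -
      have "b s + a s / 2 = x s \<bullet> (x' s + (1/2) *\<^sub>R x s)"
        by (simp add: a_def b_def inner_add_right)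
      then have ba: "\<bar>b s + a s / 2\<bar> \<le> norm (x s) * norm (x' s + (1/2) *\<^sub>R x s)"
        by (metis Cauchy_Schwarz_ineq2)
      have "0 \<le> (sqrt k * exp s * norm (x s) - norm (x' s + (1/2) *\<^sub>R x s))\<^sup>2" by simp
      also have "\<dots> = K s * a s + p s - 2 * sqrt k * exp s * (norm (x s) * norm (x' s + (1/2) *\<^sub>R x s))"
        using k unfolding p a_eq K_def
        by (simp add: power2_diff power_mult_distrib exp_double)
      finally have "2 * sqrt k * exp s * (norm (x s) * norm (x' s + (1/2) *\<^sub>R x s)) \<le> K s * a s + p s"
        by simp
      moreover have "2 * sqrt k * exp s * \<bar>b s + a s / 2\<bar> \<le> 2 * sqrt k * exp s * (norm (x s) * norm (x' s + (1/2) *\<^sub>R x s))"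
        using ba k by (intro mult_left_mono) auto
      ultimately have "2 * sqrt k * exp s * \<bar>b s + a s / 2\<bar> \<le> K s * a s + p s"
        by (rule order_trans[rotated])
      then have "m * exp (- s) * (2 * sqrt k * exp s * \<bar>b s + a s / 2\<bar>) \<le> m * exp (- s) * (K s * a s + p s)"
        using m by (intro mult_left_mono) auto
      moreover have "m * exp (- s) * (2 * sqrt k * exp s * \<bar>b s + a s / 2\<bar>) = 2 * \<bar>\<kappa> - 1/4\<bar> * \<bar>b s + a s / 2\<bar>"
        using k by (simp add: m_def exp_minus field_simps)
      moreover have "2 * (\<kappa> - 1/4) * (b s + a s / 2) \<le> 2 * \<bar>\<kappa> - 1/4\<bar> * \<bar>b s + a s / 2\<bar>"
        using abs_ge_self[of "2 * (\<kappa> - 1/4) * (b s + a s / 2)"] unfolding abs_mult by simp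
      ultimately show ?thesis
        unfolding E'_def h_def using g[of s] by (intro mult_nonneg_nonpos) auto
    qed
  qed (use t in auto)
  have E0: "E 0 \<ge> 0" unfolding E_def p h_def using g[of 0] by simp
  show thesis
  proof (rule that[OF E0])
    fix \<tau> :: real assume t: "\<tau> \<ge> 0"
    have "exp (- \<tau>) * (K \<tau> * a \<tau> + p \<tau>) * 1 \<le> E \<tau>"
      unfolding E_def p h_def using g by (intro mult_left_mono) auto
    then have "exp (- \<tau>) * (K \<tau> * a \<tau> + p \<tau>) \<le> E 0" using E[OF t] by simp
    then show "k * exp (2 * \<tau>) * (norm (x \<tau>))\<^sup>2 + (norm (x' \<tau> + (1/2) *\<^sub>R x \<tau>))\<^sup>2 \<le> E 0 * exp \<tau>"
      unfolding p[symmetric] by (simp add: K_def a_eq exp_minus field_simps)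
  qed
qed

lemma K_mono: "s \<le> t \<Longrightarrow> K s \<le> K t"
  unfolding K_def using k_nonneg by (intro mult_left_mono) auto

text \<open>Integrating the equation for \<open>z = exp (- \<nu> \<tau>) x\<close> twice while \<open>K \<le> 1\<close> changes \<open>z\<close> by the free
  evolution and at most a quarter of \<open>max |z|\<close>, which is absorbed.\<close>

lemma early_bound:
  assumes \<kappa>: "\<kappa> = \<nu>\<^sup>2" and \<nu>: "\<nu> \<ge> 0" and T: "T \<ge> 0" "K T \<le> 1"
    and A: "\<And>s. (A has_real_derivative exp (- 2 * \<nu> * s)) (at s)" "A 0 = 0"
  defines "p0 \<equiv> norm (x' 0 - \<nu> *\<^sub>R x 0)"
  shows "exp (- \<nu> * T) * norm (x T) \<le> 4/3 * (norm (x 0) + A T * p0)"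
    and "exp (- \<nu> * T) * norm (x' T - \<nu> *\<^sub>R x T) \<le> p0 + 2/3 * (norm (x 0) + A T * p0)"
proof -
  define z where "z s = exp (- \<nu> * s) *\<^sub>R x s" for s
  \<comment> \<open>This is \<open>exp (2 * \<nu> * s)\<close> times the derivative of
    \<open>z\<close>. It is constant when \<open>K = 0\<close>, and then
    \<open>z = z 0 + A * p 0\<close>, which explains \<open>A\<close>.\<close>
  define p where "p s = exp (\<nu> * s) *\<^sub>R (x' s - \<nu> *\<^sub>R x s)" for s
  have sub: "{0..T} \<subseteq> {0..}" for T :: real by auto
  have cz: "continuous_on {0..T} z" and cp: "continuous_on {0..T} p" for T
    unfolding z_def p_def
    by (intro continuous_intros continuous_on_subset[OF cont_x sub] continuous_on_subset[OF cont_x' sub])+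
  have z': "(z has_vector_derivative exp (- 2 * \<nu> * s) *\<^sub>R p s) (at s)" if "s > 0" for s
  proof -
    have "((\<lambda>s. exp (- \<nu> * s)) has_real_derivative - \<nu> * exp (- \<nu> * s)) (at s)"
      by (auto intro!: derivative_eq_intros)
    from has_vector_derivative_scaleR[OF this deriv_x[OF that]]
    have "(z has_vector_derivative exp (- \<nu> * s) *\<^sub>R x' s + (- \<nu> * exp (- \<nu> * s)) *\<^sub>R x s) (at s)"
      by (simp add: z_def[abs_def])
    moreover have "exp (- 2 * \<nu> * s) * exp (\<nu> * s) = exp (- \<nu> * s)"
      by (simp flip: exp_add)
    then have "exp (- \<nu> * s) *\<^sub>R x' s + (- \<nu> * exp (- \<nu> * s)) *\<^sub>R x s = exp (- 2 * \<nu> * s) *\<^sub>R p s"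
      by (simp add: p_def scaleR_diff_right mult.commute)
    ultimately show ?thesis by simp
  qed
  have p': "(p has_vector_derivative - ((exp (\<nu> * s) * K s) *\<^sub>R x s)) (at s)" if "s > 0" for s
  proof -
    have "((\<lambda>s. exp (\<nu> * s)) has_real_derivative \<nu> * exp (\<nu> * s)) (at s)"
      by (auto intro!: derivative_eq_intros)
    moreover have "((\<lambda>s. x' s - \<nu> *\<^sub>R x s) has_vector_derivative (\<kappa> - k * exp (2 * s)) *\<^sub>R x s - \<nu> *\<^sub>R x' s) (at s)"
      using has_vector_derivative_diff[OF deriv_x'[OF that]
          bounded_linear.has_vector_derivative[OF bounded_linear_scaleR_right deriv_x[OF that], of \<nu>]] .
    ultimately have "(p has_vector_derivative exp (\<nu> * s) *\<^sub>R ((\<kappa> - k * exp (2 * s)) *\<^sub>R x s - \<nu> *\<^sub>R x' s) +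
        (\<nu> * exp (\<nu> * s)) *\<^sub>R (x' s - \<nu> *\<^sub>R x s)) (at s)"
      unfolding p_def by (rule has_vector_derivative_scaleR)
    moreover have "exp (\<nu> * s) *\<^sub>R ((\<kappa> - k * exp (2 * s)) *\<^sub>R x s - \<nu> *\<^sub>R x' s) +
        (\<nu> * exp (\<nu> * s)) *\<^sub>R (x' s - \<nu> *\<^sub>R x s) = - ((exp (\<nu> * s) * K s) *\<^sub>R x s)"
      unfolding K_def \<kappa> by (simp add: algebra_simps power2_eq_square)
    ultimately show ?thesis by simp
  qed
  obtain m where m: "m \<in> {0..T}" and max: "\<And>s. s \<in> {0..T} \<Longrightarrow> norm (z s) \<le> norm (z m)"
    using continuous_attains_sup[of "{0..T}" "\<lambda>s. norm (z s)"] T(1) continuous_on_norm[OF cz] by auto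
  define M where "M = norm (z m)"
  have M: "M \<ge> 0" by (simp add: M_def)
  have p0: "p0 = norm (p 0)" by (simp add: p0_def p_def)
  have p_bound: "norm (p s) \<le> p0 + M * k / 2 * exp ((2 * \<nu> + 2) * s)" if s: "s \<in> {0..T}" for s
  proof -
    \<comment> \<open>Its derivative exceeds the true rate by the factor
      \<open>\<nu> + 1 \<ge> 1\<close>. This slack gives the primitive the coefficient 1/2 for every
      \<open>\<nu>\<close>, instead of \<open>1 / (2 * \<nu> + 2)\<close>.\<close>
    define \<phi> where "\<phi> s = M * k / 2 * exp ((2 * \<nu> + 2) * s)" for s
    have "norm (p s - p 0) \<le> \<phi> s - \<phi> 0"
    proof (rule norm_increment_le[where \<phi> = \<phi> and \<phi>' = "\<lambda>s. M * k * (\<nu> + 1) * exp ((2 * \<nu> + 2) * s)"])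
      show "(\<phi> has_real_derivative M * k * (\<nu> + 1) * exp ((2 * \<nu> + 2) * s)) (at s)" for s
        unfolding \<phi>_def by (auto intro!: derivative_eq_intros simp: algebra_simps)
      fix r assume r: "0 < r" "r < s"
      have "norm (- ((exp (\<nu> * r) * K r) *\<^sub>R x r)) = exp (\<nu> * r) * K r * norm (x r)" by simp
      also have "norm (x r) = exp (\<nu> * r) * norm (z r)"
        by (simp add: z_def exp_minus field_simps)
      also have "exp (\<nu> * r) * K r * (exp (\<nu> * r) * norm (z r)) = k * exp ((2 * \<nu> + 2) * r) * norm (z r)"
        unfolding K_def by (simp add: algebra_simps flip: exp_add)
      also have "\<dots> \<le> k * exp ((2 * \<nu> + 2) * r) * M"
        unfolding M_def using r s k_nonneg by (intro mult_left_mono max) auto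
      also have "\<dots> = M * k * 1 * exp ((2 * \<nu> + 2) * r)" by simp
      also have "\<dots> \<le> M * k * (\<nu> + 1) * exp ((2 * \<nu> + 2) * r)"
        using M k_nonneg \<nu> by (intro mult_right_mono mult_left_mono) auto
      finally show "norm (- ((exp (\<nu> * r) * K r) *\<^sub>R x r)) \<le> M * k * (\<nu> + 1) * exp ((2 * \<nu> + 2) * r)" .
    qed (use s cp p' in auto)
    moreover have "\<phi> 0 \<ge> 0" using M k_nonneg by (simp add: \<phi>_def)
    ultimately show ?thesis
      using norm_triangle_ineq2[of "p s" "p 0"] unfolding p0 \<phi>_def by linarith
  qed
  have z_bound: "exp (- 2 * \<nu> * s) * norm (p s) \<le> exp (- 2 * \<nu> * s) * p0 + M * K s / 2" if s: "s \<in> {0..T}" for s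
  proof -
    have "exp (- 2 * \<nu> * s) * norm (p s) \<le> exp (- 2 * \<nu> * s) * (p0 + M * k / 2 * exp ((2 * \<nu> + 2) * s))"
      using p_bound[OF s] by (intro mult_left_mono) auto
    also have "\<dots> = exp (- 2 * \<nu> * s) * p0 + M * k / 2 * (exp (- 2 * \<nu> * s) * exp ((2 * \<nu> + 2) * s))"
      by (simp add: distrib_left)
    also have "exp (- 2 * \<nu> * s) * exp ((2 * \<nu> + 2) * s) = exp (2 * s)"
      by (simp add: algebra_simps flip: exp_add)
    finally show ?thesis by (simp add: K_def)
  qed
  have A_mono: "A s \<le> A t" if "s \<le> t" for s t
    by (rule DERIV_nonneg_imp_nondecreasing[OF that]) (use A(1) in force)
  have M_bound: "M \<le> 4/3 * (norm (x 0) + A T * p0)"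
  proof -
    \<comment> \<open>Since \<open>K' = 2K\<close>, integrating \<open>M * K / 2\<close> yields
      \<open>M * K / 4\<close>. Solving the resulting inequality for \<open>M\<close> gives the 4/3;
      the 2/3 of the second bound is half of it.\<close>
    define \<psi> where "\<psi> s = A s * p0 + M * K s / 4" for s
    have "norm (z m - z 0) \<le> \<psi> m - \<psi> 0"
    proof (rule norm_increment_le[where \<phi> = \<psi> and \<phi>' = "\<lambda>s. exp (- 2 * \<nu> * s) * p0 + M * K s / 2"])
      show "(\<psi> has_real_derivative exp (- 2 * \<nu> * s) * p0 + M * K s / 2) (at s)" for s
        unfolding \<psi>_def by (auto intro!: derivative_eq_intros A(1) deriv_K)
      show "(z has_vector_derivative exp (- 2 * \<nu> * s) *\<^sub>R p s) (at s)" if "0 < s" for s by (rule z'[OF that])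
      show "norm (exp (- 2 * \<nu> * s) *\<^sub>R p s) \<le> exp (- 2 * \<nu> * s) * p0 + M * K s / 2" if "0 < s" "s < m" for s
        using z_bound[of s] that m by simp
    qed (use m cz in auto)
    moreover have "M * K m \<le> M * 1" using M T(2) K_mono[of m T] m by (intro mult_left_mono) auto
    moreover have "M * K 0 \<ge> 0" using M by simp
    moreover have "A m * p0 \<le> A T * p0" using A_mono[of m T] m by (intro mult_right_mono) (auto simp: p0)
    moreover have "norm (z m) \<le> norm (x 0) + norm (z m - z 0)"
      using norm_triangle_ineq2[of "z m" "z 0"] by (simp add: z_def)
    ultimately show ?thesis unfolding \<psi>_def M_def[symmetric] A(2) by simp
  qed
  have "exp (- \<nu> * T) * norm (x T) = norm (z T)" by (simp add: z_def)
  then show "exp (- \<nu> * T) * norm (x T) \<le> 4/3 * (norm (x 0) + A T * p0)"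
    using max[of T] T M_bound unfolding M_def by simp
  have "exp (- \<nu> * T) * norm (x' T - \<nu> *\<^sub>R x T) = exp (- 2 * \<nu> * T) * norm (p T)"
    by (simp add: p_def flip: mult.assoc exp_add)
  also have "\<dots> \<le> exp (- 2 * \<nu> * T) * p0 + M * K T / 2" using z_bound[of T] T by simp
  also have "\<dots> \<le> 1 * p0 + M * 1 / 2"
    using T \<nu> M by (intro add_mono mult_right_mono divide_right_mono mult_left_mono) (auto simp: p0)
  also have "1 * p0 + M * 1 / 2 \<le> p0 + 2/3 * (norm (x 0) + A T * p0)"
    using divide_right_mono[OF M_bound, of 2] by simp
  finally show "exp (- \<nu> * T) * norm (x' T - \<nu> *\<^sub>R x T) \<le> p0 + 2/3 * (norm (x 0) + A T * p0)" .
qed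

text \<open>With \<open>q = |x' - \<nu> x|\<^sup>2\<close>, the mixed terms in the derivative of
  \<open>q / K\<close> cancel \<open>a' = 2b\<close> and leave \<open>2\<nu> a\<close>, which the
  factor \<open>exp (- 2\<nu> s)\<close> removes; the remaining rate is
  \<open>-(4\<nu> + 2) q / K\<close>. The assumption \<open>K T \<ge> 1\<close> bounds the initial
  weight \<open>1 / K T\<close> by 1.\<close>

lemma late_bound:
  assumes \<kappa>: "\<kappa> = \<nu>\<^sup>2" and \<nu>: "\<nu> \<ge> 0" and T: "0 \<le> T" "T \<le> \<tau>" "K T \<ge> 1"
  shows "exp (- \<nu> * \<tau>) * norm (x \<tau>) \<le> exp (- \<nu> * T) * norm (x T) + exp (- \<nu> * T) * norm (x' T - \<nu> *\<^sub>R x T)"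
proof -
  have k: "k > 0" using T(3) k_nonneg unfolding K_def by (cases "k = 0") auto
  then have pos: "K s > 0" for s by (simp add: K_def)
  define i where "i s = inverse (K s)" for s
  have i_pos: "i s > 0" and i: "K s * i s = 1" for s
    using pos[of s] by (simp_all add: i_def)
  have deriv_i: "(i has_real_derivative - 2 * i s) (at s)" for s
  proof -
    have "K s \<noteq> 0" using pos[of s] by simp
    then show ?thesis
      unfolding i_def by (intro DERIV_cong[OF DERIV_inverse_fun[OF deriv_K]]) simp_all
  qed
  define g where "g s = exp (- 2 * \<nu> * s)" for s
  have deriv_g: "(g has_real_derivative - 2 * \<nu> * g s) (at s)" for s
    unfolding g_def by (auto intro!: derivative_eq_intros)
  have q: "c s + - 2 * \<nu> * b s + \<nu>\<^sup>2 * a s = (norm (x' s - \<nu> *\<^sub>R x s))\<^sup>2" for s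
    using norm_combination[of s "- \<nu>"] by simp
  define E where "E s = g s * (a s + (c s + - 2 * \<nu> * b s + \<nu>\<^sup>2 * a s) * i s)" for s
  define E' where "E' s = - (4 * \<nu> + 2) * (g s * ((c s + - 2 * \<nu> * b s + \<nu>\<^sup>2 * a s) * i s))" for s
  have E: "E \<tau> \<le> E T"
  proof (rule decreasing_on_interval[where f = E and f' = E'])
    have "{T..\<tau>} \<subseteq> {0..}" using T by auto
    then show "continuous_on {T..\<tau>} E" unfolding E_def
      by (intro continuous_on_add continuous_on_mult continuous_on_const continuous_quadratic
          continuous_on_DERIV[OF deriv_i] continuous_on_DERIV[OF deriv_g]) auto
    show "(E has_real_derivative E' s) (at s)" if "T < s" for s
    proof -
      have s: "s > 0" using that T by simp
      have "K s * i s * r = r" for r using i by simp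
      then have eq: "i s * (2 * (K s * r)) = 2 * r" for r by (simp add: mult_ac)
      show ?thesis
        unfolding E_def
        apply (rule DERIV_cong)
         apply (rule deriv_a[OF s] deriv_b[OF s] deriv_c[OF s] deriv_g deriv_i
            DERIV_const DERIV_add DERIV_mult)+
        unfolding E'_def \<kappa> by (simp add: algebra_simps power2_eq_square eq)
    qed
    show "E' s \<le> 0" for s
      unfolding E'_def g_def q using \<nu> i_pos[of s] by (intro mult_nonpos_nonneg) auto
  qed (use T in auto)
  have sq: "g s * r\<^sup>2 = (exp (- \<nu> * s) * r)\<^sup>2" for s r
    by (simp add: g_def power_mult_distrib flip: exp_double)
  have "(exp (- \<nu> * \<tau>) * norm (x \<tau>))\<^sup>2 = g \<tau> * a \<tau>"
    by (simp only: sq a_eq)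
  also have "\<dots> \<le> E \<tau>"
    unfolding E_def q using i_pos[of \<tau>] by (simp add: g_def)
  also note E
  also have "E T \<le> g T * (a T + (norm (x' T - \<nu> *\<^sub>R x T))\<^sup>2 * 1)"
    unfolding E_def q i_def using T(3) by (intro mult_left_mono add_left_mono) (auto simp: g_def inverse_le_1_iff)
  also have "\<dots> = (exp (- \<nu> * T) * norm (x T))\<^sup>2 + (exp (- \<nu> * T) * norm (x' T - \<nu> *\<^sub>R x T))\<^sup>2"
    unfolding a_eq mult_1_right distrib_left sq by (rule refl)
  also have "\<dots> \<le> (exp (- \<nu> * T) * norm (x T) + exp (- \<nu> * T) * norm (x' T - \<nu> *\<^sub>R x T))\<^sup>2"
    by (simp add: power2_sum)
  finally show ?thesis
    by (rule power2_le_imp_le) auto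
qed

text \<open>The phases are glued at the time \<open>T = - ln k / 2\<close> where
  \<open>K T = 1\<close>; one of them is absent if \<open>K \<tau> \<le> 1\<close> or
  \<open>k \<ge> 1\<close>. The 2 is 4/3 + 2/3 from \<open>early_bound\<close>, and nothing depends
  on \<open>k\<close>. Keeping the primitive \<open>A\<close> abstract covers the double root
  \<open>\<nu> = 0\<close>, where \<open>A \<tau> = \<tau>\<close> produces the logarithm of the
  theorem.\<close>

lemma growth_bound:
  assumes \<kappa>: "\<kappa> = \<nu>\<^sup>2" and \<nu>: "\<nu> \<ge> 0" and \<tau>: "\<tau> \<ge> 0"
    and A: "\<And>s. (A has_real_derivative exp (- 2 * \<nu> * s)) (at s)" "A 0 = 0"
  shows "exp (- \<nu> * \<tau>) * norm (x \<tau>) \<le> 2 * (norm (x 0) + (1 + A \<tau>) * norm (x' 0 - \<nu> *\<^sub>R x 0))"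
proof -
  define p0 where "p0 = norm (x' 0 - \<nu> *\<^sub>R x 0)"
  have p0: "p0 \<ge> 0" by (simp add: p0_def)
  have A_mono: "A s * p0 \<le> A t * p0" if "s \<le> t" for s t
    by (rule mult_right_mono[OF _ p0], rule DERIV_nonneg_imp_nondecreasing[OF that]) (use A(1) in force)
  have A_nn: "A \<tau> * p0 \<ge> 0" using A_mono[OF \<tau>] A(2) by simp
  consider "K \<tau> \<le> 1" | "K \<tau> > 1" "k \<ge> 1" | "K \<tau> > 1" "k < 1" by linarith
  then have "exp (- \<nu> * \<tau>) * norm (x \<tau>) \<le> 2 * (norm (x 0) + p0 + A \<tau> * p0)"
  proof cases
    case 1
    have "exp (- \<nu> * \<tau>) * norm (x \<tau>) \<le> 4/3 * (norm (x 0) + A \<tau> * p0)"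
      using early_bound(1)[OF \<kappa> \<nu> \<tau> 1 A] by (simp add: p0_def)
    also have "\<dots> \<le> 2 * (norm (x 0) + p0 + A \<tau> * p0)"
      using A_nn p0 by (intro mult_mono add_right_mono) auto
    finally show ?thesis .
  next
    case 2
    have "exp (- \<nu> * \<tau>) * norm (x \<tau>) \<le> 1 * (norm (x 0) + p0)"
      using late_bound[OF \<kappa> \<nu> order_refl \<tau>] 2 by (simp add: K_def p0_def)
    also have "\<dots> \<le> 2 * (norm (x 0) + p0 + A \<tau> * p0)"
      using A_nn p0 by (intro mult_mono) auto
    finally show ?thesis .
  next
    case 3
    have k: "k > 0" using 3(1) k_nonneg unfolding K_def by (cases "k = 0") auto
    define T where "T = - ln k / 2"
    have "exp (2 * T) = 1 / k" using k by (simp add: T_def exp_minus inverse_eq_divide)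
    then have KT: "K T = 1" using k by (simp add: K_def)
    have T0: "T \<ge> 0" using 3(2) k by (simp add: T_def ln_le_zero_iff)
    have T\<tau>: "T \<le> \<tau>" using K_mono[of \<tau> T] 3(1) KT by linarith
    have "exp (- \<nu> * \<tau>) * norm (x \<tau>) \<le> exp (- \<nu> * T) * norm (x T) + exp (- \<nu> * T) * norm (x' T - \<nu> *\<^sub>R x T)"
      using late_bound[OF \<kappa> \<nu> T0 T\<tau>] KT by simp
    also have "\<dots> \<le> 4/3 * (norm (x 0) + A T * p0) + (p0 + 2/3 * (norm (x 0) + A T * p0))"
      using early_bound[OF \<kappa> \<nu> T0 _ A] KT unfolding p0_def by (intro add_mono) auto
    also have "\<dots> = 2 * norm (x 0) + p0 + 2 * (A T * p0)" by (simp add: field_simps)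
    also have "\<dots> \<le> 2 * norm (x 0) + 2 * p0 + 2 * (A \<tau> * p0)"
      using A_mono[OF T\<tau>] p0 by (intro add_mono) auto
    also have "\<dots> = 2 * (norm (x 0) + p0 + A \<tau> * p0)" by (simp only: distrib_left)
    finally show ?thesis .
  qed
  then show ?thesis by (simp add: p0_def algebra_simps)
qed

end

section \<open>Limits at fixed stiffness and bounds uniform in it\<close>

context oscillator
begin

text \<open>Bounded wave energy forces \<open>norm (x \<tau>)\<close> down to a multiple of
  \<open>exp (- \<tau> / 2)\<close>, whatever the sign of \<open>\<kappa>\<close>. Weights in
  logarithmic time that are at most 1 can then be ignored.\<close>

lemma x_tendsto_0:
  assumes k: "k > 0"
  shows "(x \<longlongrightarrow> 0) at_top"
proof -
  obtain C where C: "C \<ge> 0" "\<And>\<tau>. \<tau> \<ge> 0 \<Longrightarrow> k * exp (2 * \<tau>) * (norm (x \<tau>))\<^sup>2 + (norm (x' \<tau> + (1/2) *\<^sub>R x \<tau>))\<^sup>2 \<le> C * exp \<tau>"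
    using wave_energy_bounded[OF k] by blast
  show ?thesis
  proof (rule Lim_null_comparison)
    show "\<forall>\<^sub>F \<tau> in at_top. norm (x \<tau>) \<le> sqrt (C / k) * exp (- \<tau> / 2)"
      using eventually_ge_at_top[of 0]
    proof eventually_elim
      case (elim \<tau>)
      have "k * exp (2 * \<tau>) * (norm (x \<tau>))\<^sup>2 \<le> C * exp \<tau>"
        using C(2)[OF elim] zero_le_power2[of "norm (x' \<tau> + (1/2) *\<^sub>R x \<tau>)"] by linarith
      then have "(norm (x \<tau>))\<^sup>2 \<le> C / k * (exp \<tau> / exp (2 * \<tau>))"
        using k by (simp add: field_simps)
      also have "exp \<tau> / exp (2 * \<tau>) = (exp (- \<tau> / 2))\<^sup>2"
        by (simp flip: exp_diff exp_double)
      finally have "(norm (x \<tau>))\<^sup>2 \<le> (sqrt (C / k) * exp (- \<tau> / 2))\<^sup>2"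
        using C(1) k by (simp add: power_mult_distrib)
      then show ?case by (rule power2_le_imp_le) (use C(1) k in simp)
    qed
    show "((\<lambda>\<tau>. sqrt (C / k) * exp (- \<tau> / 2)) \<longlongrightarrow> 0) at_top"
      by real_asymp
  qed
qed

text \<open>At fixed \<open>k\<close> both quantities grow at most like
  \<open>exp (\<tau> / 2)\<close> up to a vanishing term, and the weight beats this because
  \<open>\<nu> > 1/2\<close>. The free parameter \<open>r\<close> anticipates that the time
  derivative of a mode corresponds to \<open>x' - r x\<close>.\<close>

lemma energy_tendsto_0:
  assumes k: "k > 0" and \<nu>: "\<nu> > 1/2"
  shows "((\<lambda>\<tau>. exp (- \<nu> * \<tau>) * (sqrt k * exp \<tau> * norm (x \<tau>))) \<longlongrightarrow> 0) at_top"
    and "((\<lambda>\<tau>. exp (- \<nu> * \<tau>) * norm (x' \<tau> - r *\<^sub>R x \<tau>)) \<longlongrightarrow> 0) at_top"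
proof -
  obtain C where C: "C \<ge> 0" "\<And>\<tau>. \<tau> \<ge> 0 \<Longrightarrow> k * exp (2 * \<tau>) * (norm (x \<tau>))\<^sup>2 + (norm (x' \<tau> + (1/2) *\<^sub>R x \<tau>))\<^sup>2 \<le> C * exp \<tau>"
    using wave_energy_bounded[OF k] by blast
  have ex: "exp \<tau> = (exp (\<tau> / 2))\<^sup>2" for \<tau> :: real by (simp flip: exp_double)
  have le1: "sqrt k * exp \<tau> * norm (x \<tau>) \<le> sqrt C * exp (\<tau> / 2)" if "\<tau> \<ge> 0" for \<tau>
  proof (rule power2_le_imp_le)
    have "(sqrt k * exp \<tau> * norm (x \<tau>))\<^sup>2 = k * exp (2 * \<tau>) * (norm (x \<tau>))\<^sup>2"
      using k by (simp add: power_mult_distrib exp_double)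
    also have "\<dots> \<le> C * exp \<tau>"
      using C(2)[OF that] zero_le_power2[of "norm (x' \<tau> + (1/2) *\<^sub>R x \<tau>)"] by linarith
    also have "\<dots> = (sqrt C * exp (\<tau> / 2))\<^sup>2"
      using C(1) unfolding power_mult_distrib ex[symmetric] by simp
    finally show "(sqrt k * exp \<tau> * norm (x \<tau>))\<^sup>2 \<le> (sqrt C * exp (\<tau> / 2))\<^sup>2" .
  qed (use C in simp)
  have le2: "norm (x' \<tau> + (1/2) *\<^sub>R x \<tau>) \<le> sqrt C * exp (\<tau> / 2)" if "\<tau> \<ge> 0" for \<tau>
  proof (rule power2_le_imp_le)
    have "0 \<le> k * exp (2 * \<tau>) * (norm (x \<tau>))\<^sup>2" using k by simp
    then have "(norm (x' \<tau> + (1/2) *\<^sub>R x \<tau>))\<^sup>2 \<le> C * exp \<tau>"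
      using C(2)[OF that] by linarith
    also have "\<dots> = (sqrt C * exp (\<tau> / 2))\<^sup>2"
      using C(1) unfolding power_mult_distrib ex[symmetric] by simp
    finally show "(norm (x' \<tau> + (1/2) *\<^sub>R x \<tau>))\<^sup>2 \<le> (sqrt C * exp (\<tau> / 2))\<^sup>2" .
  qed (use C in simp)
  have lim: "((\<lambda>\<tau>. exp (- \<nu> * \<tau>) * (sqrt C * exp (\<tau> / 2))) \<longlongrightarrow> 0) at_top"
  proof -
    have eq: "exp (- \<nu> * \<tau>) * (sqrt C * exp (\<tau> / 2)) = sqrt C * exp (- (\<nu> - 1/2) * \<tau>)" for \<tau>
      by (simp add: algebra_simps flip: exp_add)
    show ?thesis unfolding eq using \<nu> by real_asymp
  qed
  show "((\<lambda>\<tau>. exp (- \<nu> * \<tau>) * (sqrt k * exp \<tau> * norm (x \<tau>))) \<longlongrightarrow> 0) at_top"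
  proof (rule Lim_null_comparison[OF _ lim])
    show "\<forall>\<^sub>F \<tau> in at_top. norm (exp (- \<nu> * \<tau>) * (sqrt k * exp \<tau> * norm (x \<tau>))) \<le> exp (- \<nu> * \<tau>) * (sqrt C * exp (\<tau> / 2))"
      using eventually_ge_at_top[of 0]
    proof eventually_elim
      case (elim \<tau>)
      then show ?case using le1[of \<tau>] k by (simp add: mult.assoc)
    qed
  qed
  have lim2: "((\<lambda>\<tau>. exp (- \<nu> * \<tau>) * (sqrt C * exp (\<tau> / 2)) + (1/2 + \<bar>r\<bar>) * norm (x \<tau>)) \<longlongrightarrow> 0 + (1/2 + \<bar>r\<bar>) * norm (0 :: complex)) at_top"
    by (intro tendsto_intros lim x_tendsto_0 k)
  show "((\<lambda>\<tau>. exp (- \<nu> * \<tau>) * norm (x' \<tau> - r *\<^sub>R x \<tau>)) \<longlongrightarrow> 0) at_top"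
  proof (rule Lim_null_comparison)
    show "((\<lambda>\<tau>. exp (- \<nu> * \<tau>) * (sqrt C * exp (\<tau> / 2)) + (1/2 + \<bar>r\<bar>) * norm (x \<tau>)) \<longlongrightarrow> 0) at_top"
      using lim2 by simp
    show "\<forall>\<^sub>F \<tau> in at_top. norm (exp (- \<nu> * \<tau>) * norm (x' \<tau> - r *\<^sub>R x \<tau>)) \<le>
        exp (- \<nu> * \<tau>) * (sqrt C * exp (\<tau> / 2)) + (1/2 + \<bar>r\<bar>) * norm (x \<tau>)"
      using eventually_ge_at_top[of 0]
    proof eventually_elim
      case (elim \<tau>)
      have "x' \<tau> - r *\<^sub>R x \<tau> = (x' \<tau> + (1/2) *\<^sub>R x \<tau>) - (1/2 + r) *\<^sub>R x \<tau>"
        by (simp add: scaleR_add_left)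
      then have "norm (x' \<tau> - r *\<^sub>R x \<tau>) \<le> norm (x' \<tau> + (1/2) *\<^sub>R x \<tau>) + \<bar>1/2 + r\<bar> * norm (x \<tau>)"
        by (metis norm_triangle_ineq4 norm_scaleR)
      also have "\<dots> \<le> sqrt C * exp (\<tau> / 2) + (1/2 + \<bar>r\<bar>) * norm (x \<tau>)"
        using le2[OF elim] by (intro add_mono mult_right_mono) auto
      finally have "exp (- \<nu> * \<tau>) * norm (x' \<tau> - r *\<^sub>R x \<tau>) \<le> exp (- \<nu> * \<tau>) * (sqrt C * exp (\<tau> / 2) + (1/2 + \<bar>r\<bar>) * norm (x \<tau>))"
        by (rule mult_left_mono) simp
      also have "\<dots> = exp (- \<nu> * \<tau>) * (sqrt C * exp (\<tau> / 2)) + exp (- \<nu> * \<tau>) * ((1/2 + \<bar>r\<bar>) * norm (x \<tau>))"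
        by (rule distrib_left)
      also have "\<dots> \<le> exp (- \<nu> * \<tau>) * (sqrt C * exp (\<tau> / 2)) + 1 * ((1/2 + \<bar>r\<bar>) * norm (x \<tau>))"
        using elim \<nu> by (intro add_left_mono mult_right_mono) auto
      finally show ?case by simp
    qed
  qed
qed

text \<open>For a mode, \<open>sqrt k\<close> is the length of the frequency, so the last term of
  \<open>J\<close> is square integrable over frequencies exactly because the data are in H1.\<close>

lemma energy_norm_bounds:
  assumes \<kappa>: "\<kappa> = \<nu>\<^sup>2" and \<nu>: "\<nu> \<ge> 1/2" and \<tau>: "\<tau> \<ge> 0"
  defines "J \<equiv> norm (x' 0) + \<nu> * norm (x 0) + sqrt k * norm (x 0)"
  shows "exp (- \<nu> * \<tau>) * (sqrt k * exp \<tau> * norm (x \<tau>)) \<le> J"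
    and "exp (- \<nu> * \<tau>) * norm (x' \<tau> + \<nu> *\<^sub>R x \<tau>) \<le> J"
proof -
  have J: "J \<ge> 0" unfolding J_def using \<nu> k_nonneg by simp
  define u where "u = norm (x' 0 + \<nu> *\<^sub>R x 0)"
  define v where "v = sqrt k * norm (x 0)"
  have uv: "u \<ge> 0" "v \<ge> 0" unfolding u_def v_def using k_nonneg by simp_all
  have "u \<le> norm (x' 0) + \<nu> * norm (x 0)"
    unfolding u_def using norm_triangle_ineq[of "x' 0" "\<nu> *\<^sub>R x 0"] \<nu> by simp
  then have "u + v \<le> J" by (simp add: J_def v_def)
  then have "(u + v)\<^sup>2 \<le> J\<^sup>2" using uv by (intro power_mono) auto
  moreover have "u\<^sup>2 + v\<^sup>2 \<le> (u + v)\<^sup>2" using uv by (simp add: power2_sum)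
  moreover have "v\<^sup>2 = k * (norm (x 0))\<^sup>2" unfolding v_def using k_nonneg by (simp add: power_mult_distrib)
  ultimately have "(norm (x' 0 + \<nu> *\<^sub>R x 0))\<^sup>2 + k * (norm (x 0))\<^sup>2 \<le> J\<^sup>2"
    unfolding u_def by linarith
  then have "exp (2 * \<nu> * \<tau>) * ((norm (x' 0 + \<nu> *\<^sub>R x 0))\<^sup>2 + k * (norm (x 0))\<^sup>2) \<le> exp (2 * \<nu> * \<tau>) * J\<^sup>2"
    by (rule mult_left_mono) simp
  with energy_bound[OF \<kappa> \<nu> \<tau>]
  have E: "(norm (x' \<tau> + \<nu> *\<^sub>R x \<tau>))\<^sup>2 + k * exp (2 * \<tau>) * (norm (x \<tau>))\<^sup>2 \<le> exp (2 * \<nu> * \<tau>) * J\<^sup>2"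
    by (rule order_trans)
  have root: "exp (- \<nu> * \<tau>) * R \<le> J" if "R\<^sup>2 \<le> exp (2 * \<nu> * \<tau>) * J\<^sup>2" for R
  proof (rule power2_le_imp_le[OF _ J])
    have "(exp (- \<nu> * \<tau>) * R)\<^sup>2 = exp (- (2 * \<nu> * \<tau>)) * R\<^sup>2"
      by (simp add: power_mult_distrib flip: exp_double)
    also have "\<dots> \<le> exp (- (2 * \<nu> * \<tau>)) * (exp (2 * \<nu> * \<tau>) * J\<^sup>2)"
      using that by (intro mult_left_mono) auto
    also have "\<dots> = J\<^sup>2" by (simp add: mult.assoc[symmetric] flip: exp_add)
    finally show "(exp (- \<nu> * \<tau>) * R)\<^sup>2 \<le> J\<^sup>2" .
  qed
  have "(sqrt k * exp \<tau> * norm (x \<tau>))\<^sup>2 = k * exp (2 * \<tau>) * (norm (x \<tau>))\<^sup>2"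
    using k_nonneg by (simp add: power_mult_distrib exp_double)
  also have "\<dots> \<le> exp (2 * \<nu> * \<tau>) * J\<^sup>2"
    using E zero_le_power2[of "norm (x' \<tau> + \<nu> *\<^sub>R x \<tau>)"] by linarith
  finally show "exp (- \<nu> * \<tau>) * (sqrt k * exp \<tau> * norm (x \<tau>)) \<le> J" by (rule root)
  have "0 \<le> k * exp (2 * \<tau>) * (norm (x \<tau>))\<^sup>2" using k_nonneg by simp
  then show "exp (- \<nu> * \<tau>) * norm (x' \<tau> + \<nu> *\<^sub>R x \<tau>) \<le> J"
    using E by (intro root) linarith
qed

lemma growth_bound_pos:
  assumes \<kappa>: "\<kappa> = \<nu>\<^sup>2" and \<nu>: "\<nu> > 0" and \<tau>: "\<tau> \<ge> 0"
  shows "exp (- \<nu> * \<tau>) * norm (x \<tau>) \<le> 2 * (norm (x 0) + (1 + 1 / (2 * \<nu>)) * (norm (x' 0) + \<nu> * norm (x 0)))"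
proof -
  define A where "A s = (1 - exp (- 2 * \<nu> * s)) / (2 * \<nu>)" for s
  have A: "(A has_real_derivative exp (- 2 * \<nu> * s)) (at s)" "A 0 = 0" for s
    unfolding A_def using \<nu> by (auto intro!: derivative_eq_intros)
  have "A \<tau> \<le> 1 / (2 * \<nu>)" unfolding A_def using \<nu> by (intro divide_right_mono) auto
  moreover have "A \<tau> \<ge> 0" unfolding A_def using \<nu> \<tau> by (intro divide_nonneg_pos) auto
  moreover have "norm (x' 0 - \<nu> *\<^sub>R x 0) \<le> norm (x' 0) + \<nu> * norm (x 0)"
    using norm_triangle_ineq4[of "x' 0" "\<nu> *\<^sub>R x 0"] \<nu> by simp
  moreover have "0 \<le> 1 + 1 / (2 * \<nu>)" by (rule add_nonneg_nonneg) (use \<nu> in simp_all)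
  ultimately have le: "(1 + A \<tau>) * norm (x' 0 - \<nu> *\<^sub>R x 0) \<le> (1 + 1 / (2 * \<nu>)) * (norm (x' 0) + \<nu> * norm (x 0))"
    by (intro mult_mono) auto
  have "exp (- \<nu> * \<tau>) * norm (x \<tau>) \<le> 2 * (norm (x 0) + (1 + A \<tau>) * norm (x' 0 - \<nu> *\<^sub>R x 0))"
    by (rule growth_bound[OF \<kappa> less_imp_le[OF \<nu>] \<tau> A])
  also have "\<dots> \<le> 2 * (norm (x 0) + (1 + 1 / (2 * \<nu>)) * (norm (x' 0) + \<nu> * norm (x 0)))"
    by (rule mult_left_mono[OF add_left_mono[OF le]]) simp
  finally show ?thesis .
qed

text \<open>The primitive is \<open>A s = s\<close>; the factor \<open>1 + \<tau>\<close> becomes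
  \<open>1 + ln (1 + t)\<close>.\<close>

lemma growth_bound_zero:
  assumes \<kappa>: "\<kappa> = 0" and \<tau>: "\<tau> \<ge> 0"
  shows "inverse (1 + \<tau>) * norm (x \<tau>) \<le> 2 * (norm (x 0) + norm (x' 0))"
proof -
  have "norm (x \<tau>) \<le> 2 * (norm (x 0) + (1 + \<tau>) * norm (x' 0))"
    using growth_bound[of 0 \<tau> "\<lambda>s. s"] \<kappa> \<tau> by simp
  also have "\<dots> \<le> 2 * ((1 + \<tau>) * norm (x 0) + (1 + \<tau>) * norm (x' 0))"
    using \<tau> mult_right_mono[of 1 "1 + \<tau>" "norm (x 0)"] by simp
  also have "\<dots> = (1 + \<tau>) * (2 * (norm (x 0) + norm (x' 0)))" by (simp add: algebra_simps)
  finally have "inverse (1 + \<tau>) * norm (x \<tau>) \<le> inverse (1 + \<tau>) * ((1 + \<tau>) * (2 * (norm (x 0) + norm (x' 0))))"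
    using \<tau> by (intro mult_left_mono) auto
  also have "\<dots> = 2 * (norm (x 0) + norm (x' 0))" using \<tau> by (simp add: mult.assoc[symmetric])
  finally show ?thesis .
qed

end

section \<open>Modes of the damped wave equation\<close>

locale wave_mode =
  fixes \<mu>\<^sub>1 \<mu>\<^sub>2 k :: real and y y' :: "real \<Rightarrow> complex"
  assumes sol: "solves_ode (\<lambda>t. \<mu>\<^sub>1 / (1 + t)) (\<lambda>t. \<mu>\<^sub>2 / (1 + t)\<^sup>2) k y y'" and k: "k \<ge> 0"
begin

text \<open>In logarithmic time the mode obeys an equation with first-order coefficient
  \<open>\<mu>\<^sub>1 - 1\<close>; half of it is the exponent that removes this term. What remains
  is \<open>r\<^sup>2 - \<mu>\<^sub>2 = 1/4 - \<mu>\<close>, which equals the square of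
  \<nu>.\<close>

definition r :: real where "r = (\<mu>\<^sub>1 - 1) / 2"

definition x :: "real \<Rightarrow> complex" where
  "x \<tau> = exp (r * \<tau>) *\<^sub>R y (exp \<tau> - 1)"

definition x' :: "real \<Rightarrow> complex" where
  "x' \<tau> = exp (r * \<tau>) *\<^sub>R (exp \<tau> *\<^sub>R y' (exp \<tau> - 1) + r *\<^sub>R y (exp \<tau> - 1))"

lemma y_deriv: "(y has_vector_derivative y' t) (at t)" if "t > 0"
proof -
  have "(y has_vector_derivative y' t) (at t within {0..})"
    using sol that by (simp add: solves_ode_def)
  moreover have "at t within {0..} = at t" using that by (intro at_within_interior) simp
  ultimately show ?thesis by simp
qed

lemma y'_deriv: "(y' has_vector_derivative - (k *\<^sub>R y t + (\<mu>\<^sub>1 / (1 + t)) *\<^sub>R y' t + (\<mu>\<^sub>2 / (1 + t)\<^sup>2) *\<^sub>R y t)) (at t)" if t: "t > 0"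
proof -
  obtain y'' where y'': "(y' has_vector_derivative y'') (at t)"
    "y'' + of_real k * y t + of_real (\<mu>\<^sub>1 / (1 + t)) * y' t + of_real (\<mu>\<^sub>2 / (1 + t)\<^sup>2) * y t = 0"
    using sol t unfolding solves_ode_def by blast
  have "y'' = - (k *\<^sub>R y t + (\<mu>\<^sub>1 / (1 + t)) *\<^sub>R y' t + (\<mu>\<^sub>2 / (1 + t)\<^sup>2) *\<^sub>R y t)"
    using y''(2) unfolding scaleR_conv_of_real eq_neg_iff_add_eq_0 add.assoc[symmetric] .
  with y''(1) show ?thesis by simp
qed

lemma compose_exp: "((\<lambda>\<tau>. f (exp \<tau> - 1)) has_vector_derivative exp \<tau> *\<^sub>R f') (at \<tau>)"
  if "(f has_vector_derivative f') (at (exp \<tau> - 1))" for f :: "real \<Rightarrow> complex" and f' \<tau>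
proof -
  have "((\<lambda>\<tau>. exp \<tau> - 1) has_real_derivative exp \<tau>) (at \<tau>)"
    by (auto intro!: derivative_eq_intros)
  then have "((\<lambda>\<tau>. exp \<tau> - 1) has_vector_derivative exp \<tau>) (at \<tau>)"
    by (simp add: has_real_derivative_iff_has_vector_derivative)
  from vector_diff_chain_at[OF this that] show ?thesis by (simp add: o_def)
qed

lemma weight_deriv: "((\<lambda>\<tau>. exp (r * \<tau>)) has_real_derivative r * exp (r * \<tau>)) (at \<tau>)"
  by (auto intro!: derivative_eq_intros)

lemma x_deriv: "(x has_vector_derivative x' \<tau>) (at \<tau>)" if "\<tau> > 0"
proof -
  have "exp \<tau> - 1 > 0" using that by simp
  note has_vector_derivative_scaleR[OF weight_deriv compose_exp[OF y_deriv[OF this]]]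
  then show ?thesis unfolding x_def[abs_def] x'_def by (simp add: scaleR_add_right mult.commute)
qed

lemma x'_deriv: "(x' has_vector_derivative ((1/4 - (\<mu>\<^sub>1 * (2 - \<mu>\<^sub>1) / 4 + \<mu>\<^sub>2)) - k * exp (2 * \<tau>)) *\<^sub>R x \<tau>) (at \<tau>)" if "\<tau> > 0"
proof -
  define t where "t = exp \<tau> - 1"
  have t: "t > 0" "1 + t = exp \<tau>" using that by (simp_all add: t_def)
  define y2 where "y2 = - (k *\<^sub>R y t + (\<mu>\<^sub>1 / exp \<tau>) *\<^sub>R y' t + (\<mu>\<^sub>2 / (exp \<tau>)\<^sup>2) *\<^sub>R y t)"
  have y2: "(y' has_vector_derivative y2) (at (exp \<tau> - 1))"
    using y'_deriv[OF t(1)] unfolding t(2) y2_def[symmetric] by (simp add: t_def)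
  have "((\<lambda>\<tau>. exp \<tau>) has_real_derivative exp \<tau>) (at \<tau>)" by (rule DERIV_exp)
  from has_vector_derivative_scaleR[OF this compose_exp[OF y2]]
  have 1: "((\<lambda>\<tau>. exp \<tau> *\<^sub>R y' (exp \<tau> - 1)) has_vector_derivative exp \<tau> *\<^sub>R exp \<tau> *\<^sub>R y2 + exp \<tau> *\<^sub>R y' t) (at \<tau>)"
    by (simp add: t_def)
  have 2: "((\<lambda>\<tau>. r *\<^sub>R y (exp \<tau> - 1)) has_vector_derivative r *\<^sub>R exp \<tau> *\<^sub>R y' t) (at \<tau>)"
    using bounded_linear.has_vector_derivative[OF bounded_linear_scaleR_right compose_exp[OF y_deriv[OF t(1)[unfolded t_def]]], of r]
    by (simp add: t_def)
  have 3: "(x' has_vector_derivative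
      exp (r * \<tau>) *\<^sub>R (exp \<tau> *\<^sub>R exp \<tau> *\<^sub>R y2 + exp \<tau> *\<^sub>R y' t + r *\<^sub>R exp \<tau> *\<^sub>R y' t) +
      (r * exp (r * \<tau>)) *\<^sub>R (exp \<tau> *\<^sub>R y' t + r *\<^sub>R y t)) (at \<tau>)"
    using has_vector_derivative_scaleR[OF weight_deriv has_vector_derivative_add[OF 1 2]]
    unfolding x'_def[abs_def] t_def .
  have y2_eq: "exp \<tau> *\<^sub>R exp \<tau> *\<^sub>R y2 = - ((k * exp (2 * \<tau>)) *\<^sub>R y t + (\<mu>\<^sub>1 * exp \<tau>) *\<^sub>R y' t + \<mu>\<^sub>2 *\<^sub>R y t)"
    unfolding y2_def scaleR_minus_right scaleR_add_right scaleR_scaleR exp_double power2_eq_square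
    by (simp add: mult.commute mult.left_commute)
  have "exp (r * \<tau>) *\<^sub>R (exp \<tau> *\<^sub>R exp \<tau> *\<^sub>R y2 + exp \<tau> *\<^sub>R y' t + r *\<^sub>R exp \<tau> *\<^sub>R y' t) +
      (r * exp (r * \<tau>)) *\<^sub>R (exp \<tau> *\<^sub>R y' t + r *\<^sub>R y t) =
     exp (r * \<tau>) *\<^sub>R ((r * r - \<mu>\<^sub>2 - k * exp (2 * \<tau>)) *\<^sub>R y t + ((2 * r + 1 - \<mu>\<^sub>1) * exp \<tau>) *\<^sub>R y' t)"
    unfolding y2_eq
    unfolding scaleR_conv_of_real of_real_mult of_real_diff of_real_add of_real_1 of_real_numeral
    by algebra
  also have "2 * r + 1 - \<mu>\<^sub>1 = 0" unfolding r_def by (simp add: field_simps)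
  also have "r * r - \<mu>\<^sub>2 = 1/4 - (\<mu>\<^sub>1 * (2 - \<mu>\<^sub>1) / 4 + \<mu>\<^sub>2)"
    unfolding r_def by (simp add: field_simps)
  finally show ?thesis
    using 3 unfolding x_def t_def[symmetric] by (simp add: mult.commute)
qed

lemma continuous_x: "continuous_on {0..} x" and continuous_x': "continuous_on {0..} x'"
proof -
  have y: "continuous_on {0..} y"
    using sol unfolding solves_ode_def
    by (intro continuous_on_vector_derivative[of "{0..}" y y']) auto
  have y': "continuous_on {0..} y'" using sol by (simp add: solves_ode_def)
  have e: "continuous_on {0..} (\<lambda>\<tau>. exp \<tau> - 1 :: real)" by (intro continuous_intros)
  have sub: "(\<lambda>\<tau>. exp \<tau> - 1 :: real) ` {0..} \<subseteq> {0..}" by auto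
  note c = continuous_on_compose2[OF y e sub] continuous_on_compose2[OF y' e sub]
  show "continuous_on {0..} x" "continuous_on {0..} x'"
    unfolding x_def[abs_def] x'_def[abs_def] by (intro continuous_intros c)+
qed

sublocale oscillator k "1/4 - (\<mu>\<^sub>1 * (2 - \<mu>\<^sub>1) / 4 + \<mu>\<^sub>2)" x x'
  by (unfold_locales; (fact k continuous_x continuous_x' | erule x_deriv x'_deriv))

lemma initial_x: "norm (x 0) = norm (y 0)" "norm (x' 0) \<le> norm (y' 0) + \<bar>r\<bar> * norm (y 0)"
  using norm_triangle_ineq[of "y' 0" "r *\<^sub>R y 0"] by (simp_all add: x_def x'_def)

lemma norm_y: "(1 + t) powr r * norm (y t) = norm (x (ln (1 + t)))" if "t \<ge> 0"
  using that by (simp add: x_def powr_def mult.commute)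

text \<open>Subtracting \<open>r x\<close> undoes the derivative of the weight, so that only the
  time derivative of the mode is left.\<close>

lemma norm_y': "(1 + t) powr (r + 1) * norm (y' t) = norm (x' (ln (1 + t)) - r *\<^sub>R x (ln (1 + t)))" if "t \<ge> 0"
proof -
  have "x' \<tau> - r *\<^sub>R x \<tau> = (exp (r * \<tau>) * exp \<tau>) *\<^sub>R y' (exp \<tau> - 1)" for \<tau>
    unfolding x_def x'_def by (simp add: scaleR_add_right mult.commute)
  then have "norm (x' (ln (1 + t)) - r *\<^sub>R x (ln (1 + t))) = (exp (r * ln (1 + t)) * (1 + t)) * norm (y' t)"
    using that by simp
  moreover have "(1 + t) powr (r + 1) = exp (r * ln (1 + t)) * (1 + t)"
    using that by (simp add: powr_add powr_def[of _ r])
  ultimately show ?thesis by simp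
qed

end

section \<open>The exponent \<nu> and the weights of the theorem\<close>

lemma Re_nu_gt: "\<mu> > 1/4 \<Longrightarrow> Re (nu \<mu>) = 0"
  by (simp add: nu_def)

lemma Re_nu_le:
  assumes "\<mu> \<le> 1/4"
  shows "Re (nu \<mu>) \<ge> 0" "1/4 - \<mu> = (Re (nu \<mu>))\<^sup>2"
  using assms by (simp_all add: nu_def power_divide)

lemma Re_nu_pos: "\<mu> < 1/4 \<Longrightarrow> Re (nu \<mu>) > 0"
  by (simp add: nu_def)

lemma Re_nu_neg: "\<mu> < 0 \<Longrightarrow> Re (nu \<mu>) > 1/2"
  by (simp add: nu_def real_less_rsqrt)

definition amplitude_weight :: "real \<Rightarrow> real \<Rightarrow> real \<Rightarrow> real" where
  "amplitude_weight \<mu> \<mu>\<^sub>1 t = (if \<mu> = 1/4 then (1 + t) powr (- 1/2 + \<mu>\<^sub>1 / 2) * inverse (1 + ln (1 + t))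
     else (1 + t) powr (- 1/2 - Re (nu \<mu>) + \<mu>\<^sub>1 / 2))"

definition energy_weight :: "real \<Rightarrow> real \<Rightarrow> real \<Rightarrow> real" where
  "energy_weight \<mu> \<mu>\<^sub>1 t = (1 + t) powr (1/2 - Re (nu \<mu>) + \<mu>\<^sub>1 / 2)"

lemma amplitude_weight_nonneg: "t \<ge> 0 \<Longrightarrow> amplitude_weight \<mu> \<mu>\<^sub>1 t \<ge> 0"
  by (simp add: amplitude_weight_def)

lemma energy_weight_nonneg: "energy_weight \<mu> \<mu>\<^sub>1 t \<ge> 0"
  by (simp add: energy_weight_def)

text \<open>What is left of \<open>amplitude_weight\<close> in logarithmic time once the factor
  \<open>(1 + t) powr r\<close>, which turns the mode into \<open>x\<close>, is split off.\<close>

definition log_weight :: "real \<Rightarrow> real \<Rightarrow> real" where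
  "log_weight \<mu> \<tau> = (if \<mu> = 1/4 then inverse (1 + \<tau>) else exp (- Re (nu \<mu>) * \<tau>))"

lemma log_weight_le_1: "\<tau> \<ge> 0 \<Longrightarrow> 0 \<le> log_weight \<mu> \<tau> \<and> log_weight \<mu> \<tau> \<le> 1"
  using Re_nu_gt[of \<mu>] Re_nu_le(1)[of \<mu>]
  by (cases "\<mu> \<le> 1/4") (auto simp: log_weight_def inverse_le_1_iff)

lemma filterlim_ln_at_top: "filterlim (\<lambda>t. ln (1 + t) :: real) at_top at_top"
  by real_asymp

context wave_mode
begin

definition \<mu> :: real where "\<mu> = \<mu>\<^sub>1 * (2 - \<mu>\<^sub>1) / 4 + \<mu>\<^sub>2"

lemma amplitude_eq:
  assumes t: "t \<ge> 0"
  shows "amplitude_weight \<mu> \<mu>\<^sub>1 t * norm (y t) = log_weight \<mu> (ln (1 + t)) * norm (x (ln (1 + t)))"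
proof -
  have "amplitude_weight \<mu> \<mu>\<^sub>1 t = log_weight \<mu> (ln (1 + t)) * (1 + t) powr r"
  proof (cases "\<mu> = 1/4")
    case True
    have "- 1/2 + \<mu>\<^sub>1 / 2 = r" by (simp add: r_def field_simps)
    then show ?thesis using True by (simp add: amplitude_weight_def log_weight_def)
  next
    case False
    have e: "- 1/2 - Re (nu \<mu>) + \<mu>\<^sub>1 / 2 = - Re (nu \<mu>) + r" by (simp add: r_def field_simps)
    have "(1 + t) powr (- Re (nu \<mu>)) = exp (- Re (nu \<mu>) * ln (1 + t))" using t by (simp add: powr_def)
    then show ?thesis using False by (simp only: amplitude_weight_def log_weight_def e powr_add if_False)
  qed
  then show ?thesis using norm_y[OF t] by simp
qed

lemma amplitude_tendsto_0:
  assumes "k > 0"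
  shows "((\<lambda>t. amplitude_weight \<mu> \<mu>\<^sub>1 t * norm (y t)) \<longlongrightarrow> 0) at_top"
proof (rule Lim_null_comparison)
  show "((\<lambda>t. norm (x (ln (1 + t)))) \<longlongrightarrow> 0) at_top"
    by (intro tendsto_norm_zero filterlim_compose[OF x_tendsto_0[OF assms] filterlim_ln_at_top])
  show "\<forall>\<^sub>F t in at_top. norm (amplitude_weight \<mu> \<mu>\<^sub>1 t * norm (y t)) \<le> norm (x (ln (1 + t)))"
    using eventually_ge_at_top[of 0]
  proof eventually_elim
    case (elim t)
    then have "ln (1 + t) \<ge> 0" by simp
    from log_weight_le_1[OF this, of \<mu>] show ?case
      unfolding amplitude_eq[OF elim] by (simp add: mult_left_le_one_le)
  qed
qed

lemma initial_combination:
  assumes "A \<ge> 0" "B \<ge> 0"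
  shows "A * norm (x 0) + B * norm (x' 0) \<le> (A + B * (1 + \<bar>r\<bar>)) * (norm (y 0) + norm (y' 0))"
proof -
  have "B * norm (x' 0) \<le> B * (norm (y' 0) + \<bar>r\<bar> * norm (y 0))"
    using initial_x(2) assms by (intro mult_left_mono)
  moreover have "A * norm (x 0) + B * (norm (y' 0) + \<bar>r\<bar> * norm (y 0)) =
      (A + B * (1 + \<bar>r\<bar>)) * (norm (y 0) + norm (y' 0)) - (A * norm (y' 0) + B * norm (y 0) + B * \<bar>r\<bar> * norm (y' 0))"
    unfolding initial_x(1) by (simp add: algebra_simps)
  moreover have "0 \<le> A * norm (y' 0) + B * norm (y 0) + B * \<bar>r\<bar> * norm (y' 0)"
    using assms by simp
  ultimately show ?thesis by linarith
qed

text \<open>The constant is the sum of those for \<open>\<mu> > 1/4\<close>,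
  \<open>\<mu> = 1/4\<close> and \<open>\<mu> < 1/4\<close>. Each is nonnegative for every
  \<open>\<mu>\<close>, since \<open>1 / 0 = 0\<close> takes care of the vanishing denominators, so
  one expression serves all cases.\<close>

lemma amplitude_bound:
  assumes t: "t \<ge> 0"
  shows "amplitude_weight \<mu> \<mu>\<^sub>1 t * norm (y t) \<le>
    (1 + 1 / sqrt \<bar>1/4 - \<mu>\<bar> * (1 + \<bar>r\<bar>) + (2 + 2 * (1 + \<bar>r\<bar>)) +
      (2 + 2 * (1 + 1 / (2 * Re (nu \<mu>))) * Re (nu \<mu>) + 2 * (1 + 1 / (2 * Re (nu \<mu>))) * (1 + \<bar>r\<bar>))) *
    (norm (y 0) + norm (y' 0))"
    (is "_ \<le> (?C1 + ?C2 + ?C3) * ?D")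
proof -
  define \<tau> where "\<tau> = ln (1 + t)"
  have \<tau>: "\<tau> \<ge> 0" using t by (simp add: \<tau>_def)
  have \<kappa>: "1/4 - (\<mu>\<^sub>1 * (2 - \<mu>\<^sub>1) / 4 + \<mu>\<^sub>2) = 1/4 - \<mu>" by (simp add: \<mu>_def)
  have nu0: "Re (nu \<mu>) \<ge> 0" using Re_nu_gt[of \<mu>] Re_nu_le(1)[of \<mu>] by linarith
  have C: "?C1 \<ge> 0" "?C2 \<ge> 0" "?C3 \<ge> 0"
    using nu0 by (intro add_nonneg_nonneg mult_nonneg_nonneg divide_nonneg_nonneg; simp)+
  consider (gt) "\<mu> > 1/4" | (eq) "\<mu> = 1/4" | (lt) "\<mu> < 1/4" by linarith
  then have "log_weight \<mu> \<tau> * norm (x \<tau>) \<le> ?C1 * ?D \<or> log_weight \<mu> \<tau> * norm (x \<tau>) \<le> ?C2 * ?D \<or>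
    log_weight \<mu> \<tau> * norm (x \<tau>) \<le> ?C3 * ?D"
  proof cases
    case gt
    define s where "s = sqrt \<bar>1/4 - \<mu>\<bar>"
    have s: "s > 0" "s\<^sup>2 = - (1/4 - \<mu>)" using gt by (simp_all add: s_def)
    have "(norm (x \<tau>))\<^sup>2 \<le> (norm (x 0))\<^sup>2 + (norm (x' 0))\<^sup>2 / s\<^sup>2"
      using norm_bound_negative[OF _ \<tau>] gt unfolding \<kappa> s(2) by simp
    also have "\<dots> = (norm (x 0))\<^sup>2 + (1 / s * norm (x' 0))\<^sup>2"
      by (simp add: power_mult_distrib power_divide)
    also have "\<dots> \<le> (norm (x 0) + 1 / s * norm (x' 0))\<^sup>2"
      using s(1) by (simp add: power2_sum)
    finally have "norm (x \<tau>) \<le> norm (x 0) + 1 / s * norm (x' 0)"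
      by (rule power2_le_imp_le) (use s(1) in simp)
    also have "\<dots> = 1 * norm (x 0) + 1 / s * norm (x' 0)" by simp
    also have "\<dots> \<le> (1 + 1 / s * (1 + \<bar>r\<bar>)) * ?D"
      by (rule initial_combination) (use s in simp_all)
    finally have "norm (x \<tau>) \<le> ?C1 * ?D" by (simp add: s_def)
    then show ?thesis using gt Re_nu_gt[OF gt] by (simp add: log_weight_def)
  next
    case eq
    have "log_weight \<mu> \<tau> * norm (x \<tau>) \<le> 2 * (norm (x 0) + norm (x' 0))"
      using growth_bound_zero[OF _ \<tau>] \<kappa> eq by (simp add: log_weight_def)
    also have "\<dots> = 2 * norm (x 0) + 2 * norm (x' 0)" by simp
    also have "\<dots> \<le> ?C2 * ?D" by (rule initial_combination) simp_all
    finally show ?thesis by simp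
  next
    case lt
    define \<nu> where "\<nu> = Re (nu \<mu>)"
    have \<nu>: "\<nu> > 0" "1/4 - \<mu> = \<nu>\<^sup>2" using lt Re_nu_pos[of \<mu>] Re_nu_le(2)[of \<mu>] by (simp_all add: \<nu>_def)
    define c where "c = 1 + 1 / (2 * \<nu>)"
    have c: "c \<ge> 0" unfolding c_def using \<nu>(1) by (intro add_nonneg_nonneg) simp_all
    have "log_weight \<mu> \<tau> * norm (x \<tau>) \<le> 2 * (norm (x 0) + c * (norm (x' 0) + \<nu> * norm (x 0)))"
      using growth_bound_pos[OF _ \<nu>(1) \<tau>] \<kappa> \<nu>(2) lt unfolding c_def by (simp add: log_weight_def \<nu>_def)
    also have "\<dots> = (2 + 2 * c * \<nu>) * norm (x 0) + 2 * c * norm (x' 0)" by (simp add: algebra_simps)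
    also have "\<dots> \<le> (2 + 2 * c * \<nu> + 2 * c * (1 + \<bar>r\<bar>)) * ?D"
      by (rule initial_combination) (use c \<nu>(1) in simp_all)
    finally show ?thesis by (simp add: c_def \<nu>_def)
  qed
  moreover have "p * D \<le> (p + q + s) * D \<and> q * D \<le> (p + q + s) * D \<and> s * D \<le> (p + q + s) * D"
    if "p \<ge> 0" "q \<ge> 0" "s \<ge> 0" "D \<ge> 0" for p q s D :: real
    using that by (intro conjI mult_right_mono) auto
  from this[OF C, of ?D] have "?C1 * ?D \<le> (?C1 + ?C2 + ?C3) * ?D \<and> ?C2 * ?D \<le> (?C1 + ?C2 + ?C3) * ?D \<and>
      ?C3 * ?D \<le> (?C1 + ?C2 + ?C3) * ?D"
    by (simp only: add_nonneg_nonneg norm_ge_zero simp_thms)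
  ultimately show ?thesis
    unfolding amplitude_eq[OF t] \<tau>_def[symmetric] by (elim disjE conjE; blast intro: order_trans)
qed

end

text \<open>The locale fixes \<open>k\<close>, which hides uniformity; here \<open>C\<close> is
  chosen before the frequency and the mode, as an integrable majorant requires.\<close>

lemma amplitude_bound_uniform:
  "\<exists>C\<ge>0. \<forall>k y y' t. wave_mode \<mu>\<^sub>1 \<mu>\<^sub>2 k y y' \<longrightarrow> t \<ge> 0 \<longrightarrow>
     amplitude_weight (\<mu>\<^sub>1 * (2 - \<mu>\<^sub>1) / 4 + \<mu>\<^sub>2) \<mu>\<^sub>1 t * norm (y t) \<le> C * (norm (y 0) + norm (y' 0))"
proof -
  define m where "m = \<mu>\<^sub>1 * (2 - \<mu>\<^sub>1) / 4 + \<mu>\<^sub>2"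
  define q where "q = (\<mu>\<^sub>1 - 1) / 2"
  define C where "C = 1 + 1 / sqrt \<bar>1/4 - m\<bar> * (1 + \<bar>q\<bar>) + (2 + 2 * (1 + \<bar>q\<bar>)) +
      (2 + 2 * (1 + 1 / (2 * Re (nu m))) * Re (nu m) + 2 * (1 + 1 / (2 * Re (nu m))) * (1 + \<bar>q\<bar>))"
  have "Re (nu m) \<ge> 0" using Re_nu_gt[of m] Re_nu_le(1)[of m] by linarith
  then have "C \<ge> 0" unfolding C_def
    by (intro add_nonneg_nonneg mult_nonneg_nonneg divide_nonneg_nonneg) simp_all
  moreover have "amplitude_weight m \<mu>\<^sub>1 t * norm (y t) \<le> C * (norm (y 0) + norm (y' 0))"
    if "wave_mode \<mu>\<^sub>1 \<mu>\<^sub>2 k y y'" "t \<ge> 0" for k y y' t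
  proof -
    interpret wave_mode \<mu>\<^sub>1 \<mu>\<^sub>2 k y y' by fact
    show ?thesis
      using amplitude_bound[OF that(2)] unfolding C_def m_def q_def wave_mode.r_def[OF that(1)] wave_mode.\<mu>_def[OF that(1)] .
  qed
  ultimately show ?thesis unfolding m_def by blast
qed

context wave_mode
begin

lemma energy_eq:
  assumes t: "t \<ge> 0"
  defines "\<tau> \<equiv> ln (1 + t)"
  shows "energy_weight \<mu> \<mu>\<^sub>1 t * (sqrt k * norm (y t)) = exp (- Re (nu \<mu>) * \<tau>) * (sqrt k * exp \<tau> * norm (x \<tau>))"
    and "energy_weight \<mu> \<mu>\<^sub>1 t * norm (y' t) = exp (- Re (nu \<mu>) * \<tau>) * norm (x' \<tau> - r *\<^sub>R x \<tau>)"
proof -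
  have e: "1/2 - Re (nu \<mu>) + \<mu>\<^sub>1 / 2 = - Re (nu \<mu>) + (r + 1)" by (simp add: r_def field_simps)
  have "(1 + t) powr (- Re (nu \<mu>)) = exp (- Re (nu \<mu>) * \<tau>)" using t by (simp add: powr_def \<tau>_def)
  then have w: "energy_weight \<mu> \<mu>\<^sub>1 t = exp (- Re (nu \<mu>) * \<tau>) * (1 + t) powr (r + 1)"
    unfolding energy_weight_def e powr_add[of _ "- Re (nu \<mu>)"] by (rule arg_cong)
  show "energy_weight \<mu> \<mu>\<^sub>1 t * norm (y' t) = exp (- Re (nu \<mu>) * \<tau>) * norm (x' \<tau> - r *\<^sub>R x \<tau>)"
    unfolding w mult.assoc norm_y'[OF t] \<tau>_def ..
  have "(1 + t) powr (r + 1) * (sqrt k * norm (y t)) = sqrt k * exp \<tau> * ((1 + t) powr r * norm (y t))"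
    using t by (simp add: powr_add \<tau>_def mult_ac)
  then show "energy_weight \<mu> \<mu>\<^sub>1 t * (sqrt k * norm (y t)) = exp (- Re (nu \<mu>) * \<tau>) * (sqrt k * exp \<tau> * norm (x \<tau>))"
    unfolding w mult.assoc[of _ "(1 + t) powr (r + 1)"] norm_y[OF t] \<tau>_def by simp
qed

lemma energy_mode_tendsto_0:
  assumes k: "k > 0" and \<mu>: "\<mu> < 0"
  shows "((\<lambda>t. energy_weight \<mu> \<mu>\<^sub>1 t * (sqrt k * norm (y t))) \<longlongrightarrow> 0) at_top"
    and "((\<lambda>t. energy_weight \<mu> \<mu>\<^sub>1 t * norm (y' t)) \<longlongrightarrow> 0) at_top"
proof -
  have ev: "\<forall>\<^sub>F t in at_top. t \<ge> (0 :: real)" by (rule eventually_ge_at_top)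
  show "((\<lambda>t. energy_weight \<mu> \<mu>\<^sub>1 t * (sqrt k * norm (y t))) \<longlongrightarrow> 0) at_top"
    by (rule Lim_transform_eventually[OF filterlim_compose[OF energy_tendsto_0(1)[OF k Re_nu_neg[OF \<mu>]] filterlim_ln_at_top]])
       (use ev in eventually_elim, simp only: energy_eq(1))
  show "((\<lambda>t. energy_weight \<mu> \<mu>\<^sub>1 t * norm (y' t)) \<longlongrightarrow> 0) at_top"
    by (rule Lim_transform_eventually[OF filterlim_compose[OF energy_tendsto_0(2)[OF k Re_nu_neg[OF \<mu>], of r] filterlim_ln_at_top]])
       (use ev in eventually_elim, simp only: energy_eq(2))
qed

text \<open>The energy controls \<open>x' + \<nu> x\<close>, but the time derivative corresponds to
  \<open>x' - r x\<close>. The difference \<open>(\<nu> + r) x\<close> is estimated by the amplitude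
  bound, because the energy sees \<open>x\<close> only through \<open>sqrt k\<close> and gives no
  uniform control as \<open>k\<close> tends to 0.\<close>

lemma energy_mode_bound:
  assumes \<mu>: "\<mu> < 0" and t: "t \<ge> 0" and C: "C \<ge> 0"
    and amp: "amplitude_weight \<mu> \<mu>\<^sub>1 t * norm (y t) \<le> C * (norm (y 0) + norm (y' 0))"
  defines "B \<equiv> (Re (nu \<mu>) + \<bar>r\<bar> + 1) * (1 + C) * (norm (y 0) + norm (y' 0) + sqrt k * norm (y 0))"
  shows "energy_weight \<mu> \<mu>\<^sub>1 t * (sqrt k * norm (y t)) \<le> B"
    and "energy_weight \<mu> \<mu>\<^sub>1 t * norm (y' t) \<le> B"
proof -
  define \<tau> where "\<tau> = ln (1 + t)"
  have \<tau>: "\<tau> \<ge> 0" using t by (simp add: \<tau>_def)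
  define \<nu> where "\<nu> = Re (nu \<mu>)"
  have \<nu>: "\<nu> > 1/2" using Re_nu_neg[OF \<mu>] by (simp add: \<nu>_def)
  have \<kappa>: "1/4 - (\<mu>\<^sub>1 * (2 - \<mu>\<^sub>1) / 4 + \<mu>\<^sub>2) = \<nu>\<^sup>2"
    using Re_nu_le(2)[of \<mu>] \<mu> unfolding \<nu>_def \<mu>_def by simp
  define D where "D = norm (y 0) + norm (y' 0) + sqrt k * norm (y 0)"
  have nn: "norm (y 0) + norm (y' 0) \<le> D" "0 \<le> norm (y 0) + norm (y' 0)" "0 \<le> D"
    unfolding D_def using k by simp_all
  define J where "J = norm (x' 0) + \<nu> * norm (x 0) + sqrt k * norm (x 0)"
  have "J \<le> (norm (y' 0) + \<bar>r\<bar> * norm (y 0)) + \<nu> * norm (y 0) + sqrt k * norm (y 0)"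
    unfolding J_def using initial_x by simp
  also have "\<dots> = norm (y' 0) + sqrt k * norm (y 0) + (\<nu> + \<bar>r\<bar>) * norm (y 0)"
    by (simp add: algebra_simps)
  also have "\<dots> \<le> D + (\<nu> + \<bar>r\<bar>) * D"
    using \<nu> k unfolding D_def by (intro add_mono mult_left_mono) auto
  also have "\<dots> = (\<nu> + \<bar>r\<bar> + 1) * D" by (simp add: algebra_simps)
  finally have J: "J \<le> (\<nu> + \<bar>r\<bar> + 1) * D" .
  have B: "B = (\<nu> + \<bar>r\<bar> + 1) * D + (\<nu> + \<bar>r\<bar> + 1) * (C * D)"
    unfolding B_def D_def[symmetric] \<nu>_def by (simp add: algebra_simps)
  have CD: "0 \<le> (\<nu> + \<bar>r\<bar> + 1) * (C * D)" using C nn(3) \<nu> by (intro mult_nonneg_nonneg) auto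
  have "energy_weight \<mu> \<mu>\<^sub>1 t * (sqrt k * norm (y t)) \<le> J"
    unfolding energy_eq(1)[OF t] \<tau>_def[symmetric] J_def \<nu>_def[symmetric]
    using \<nu> by (intro energy_norm_bounds(1)[OF \<kappa> _ \<tau>]) simp
  then show "energy_weight \<mu> \<mu>\<^sub>1 t * (sqrt k * norm (y t)) \<le> B"
    using J CD unfolding B by linarith
  have x_bound: "exp (- \<nu> * \<tau>) * norm (x \<tau>) \<le> C * D"
  proof -
    have "exp (- \<nu> * \<tau>) * norm (x \<tau>) \<le> C * (norm (y 0) + norm (y' 0))"
      using amp \<mu> unfolding amplitude_eq[OF t] log_weight_def \<nu>_def \<tau>_def by simp
    also have "\<dots> \<le> C * D" using nn C by (intro mult_left_mono)
    finally show ?thesis .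
  qed
  have "x' \<tau> - r *\<^sub>R x \<tau> = (x' \<tau> + \<nu> *\<^sub>R x \<tau>) - (\<nu> + r) *\<^sub>R x \<tau>"
    by (simp add: scaleR_add_left)
  then have "norm (x' \<tau> - r *\<^sub>R x \<tau>) \<le> norm (x' \<tau> + \<nu> *\<^sub>R x \<tau>) + \<bar>\<nu> + r\<bar> * norm (x \<tau>)"
    by (metis norm_triangle_ineq4 norm_scaleR)
  also have "\<dots> \<le> norm (x' \<tau> + \<nu> *\<^sub>R x \<tau>) + (\<nu> + \<bar>r\<bar> + 1) * norm (x \<tau>)"
    using \<nu> by (intro add_left_mono mult_right_mono) auto
  finally have "exp (- \<nu> * \<tau>) * norm (x' \<tau> - r *\<^sub>R x \<tau>) \<le>
      exp (- \<nu> * \<tau>) * (norm (x' \<tau> + \<nu> *\<^sub>R x \<tau>) + (\<nu> + \<bar>r\<bar> + 1) * norm (x \<tau>))"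
    by (rule mult_left_mono) simp
  also have "\<dots> = exp (- \<nu> * \<tau>) * norm (x' \<tau> + \<nu> *\<^sub>R x \<tau>) + (\<nu> + \<bar>r\<bar> + 1) * (exp (- \<nu> * \<tau>) * norm (x \<tau>))"
    by (simp only: distrib_left mult.left_commute)
  also have "\<dots> \<le> J + (\<nu> + \<bar>r\<bar> + 1) * (C * D)"
    unfolding J_def using \<nu> x_bound by (intro add_mono energy_norm_bounds(2)[OF \<kappa> _ \<tau>] mult_left_mono) auto
  also have "\<dots> \<le> B" unfolding B using J by simp
  finally show "energy_weight \<mu> \<mu>\<^sub>1 t * norm (y' t) \<le> B"
    unfolding energy_eq(2)[OF t] \<tau>_def[symmetric] \<nu>_def[symmetric] .
qed

end

section \<open>Decay of solutions\<close>

lemma L2_cmod: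
  assumes "f \<in> L2"
  shows "(\<lambda>x. of_real (cmod (f x))) \<in> L2"
  by (rule L2_bounded[OF assms, of _ 1]) (use L2_measurable[OF assms] in simp_all)

text \<open>\<open>w t\<close> agrees with \<open>F t\<close> outside a null set that depends on
  \<open>t\<close>. Passing to sequences of times leaves countably many null sets; measurability is
  taken from \<open>F\<close>, pointwise bounds and limits from \<open>w\<close>.\<close>

lemma weighted_L2_norm_tendsto_0:
  fixes F w :: "real \<Rightarrow> 'a::euclidean_space \<Rightarrow> complex"
  assumes F: "\<And>t. t \<ge> 0 \<Longrightarrow> F t \<in> L2"
    and \<omega>: "\<And>t. t \<ge> 0 \<Longrightarrow> \<omega> t \<ge> 0"
    and w: "\<And>t. t \<ge> 0 \<Longrightarrow> AE \<xi> in lborel. w t \<xi> = F t \<xi>"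
    and D: "integrable lborel (\<lambda>\<xi>. (D \<xi>)\<^sup>2)"
    and bound: "AE \<xi> in lborel. \<forall>t\<ge>0. \<omega> t * cmod (w t \<xi>) \<le> D \<xi>"
    and lim: "AE \<xi> in lborel. ((\<lambda>t. \<omega> t * cmod (w t \<xi>)) \<longlongrightarrow> 0) at_top"
  shows "((\<lambda>t. \<omega> t * L2_norm (F t)) \<longlongrightarrow> 0) at_top"
proof (rule tendsto_at_topI_sequentially)
  fix X :: "nat \<Rightarrow> real" assume X: "filterlim X at_top sequentially"
  \<comment> \<open>The assumptions speak of nonnegative times, while the first terms of
    \<open>X\<close> may be negative.\<close>
  define Y where "Y n = max 0 (X n)" for n
  have Y: "Y n \<ge> 0" for n by (simp add: Y_def)
  have ev: "\<forall>\<^sub>F n in sequentially. Y n = X n"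
    using X[unfolded filterlim_at_top, rule_format, of 0] by eventually_elim (simp add: Y_def)
  have Y_top: "filterlim Y at_top sequentially"
    using X ev filterlim_cong[OF refl refl ev] by simp
  have AE_w: "AE \<xi> in lborel. \<forall>n. w (Y n) \<xi> = F (Y n) \<xi>"
    unfolding AE_all_countable using w Y by simp
  have "(\<lambda>n. L2_norm (\<lambda>\<xi>. of_real (\<omega> (Y n)) * F (Y n) \<xi>)) \<longlonglongrightarrow> 0"
  proof (rule L2_dominated_convergence[OF D])
    show "(\<lambda>\<xi>. of_real (\<omega> (Y n)) * F (Y n) \<xi>) \<in> borel_measurable borel" for n
      by (intro L2_measurable L2_cmult F Y)
    show "AE \<xi> in lborel. cmod (of_real (\<omega> (Y n)) * F (Y n) \<xi>) \<le> D \<xi>" for n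
      using bound AE_w
    proof eventually_elim
      case (elim \<xi>)
      have "\<omega> (Y n) * cmod (w (Y n) \<xi>) \<le> D \<xi>" using elim(1) Y by blast
      then show ?case using elim(2) \<omega>[OF Y] by (simp add: norm_mult)
    qed
    show "AE \<xi> in lborel. (\<lambda>n. of_real (\<omega> (Y n)) * F (Y n) \<xi>) \<longlonglongrightarrow> 0"
      using lim AE_w
    proof eventually_elim
      case (elim \<xi>)
      have "(\<lambda>n. \<omega> (Y n) * cmod (w (Y n) \<xi>)) \<longlonglongrightarrow> 0"
        by (rule filterlim_compose[OF elim(1) Y_top])
      then have "(\<lambda>n. norm (of_real (\<omega> (Y n)) * F (Y n) \<xi>)) \<longlonglongrightarrow> 0"
        using elim(2) \<omega>[OF Y] by (simp add: norm_mult)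
      then show ?case by (rule tendsto_norm_zero_cancel)
    qed
  qed
  moreover have "\<forall>\<^sub>F n in sequentially. L2_norm (\<lambda>\<xi>. of_real (\<omega> (Y n)) * F (Y n) \<xi>) = \<omega> (X n) * L2_norm (F (X n))"
    using ev by eventually_elim (metis L2_norm_cmult norm_of_real abs_of_nonneg \<omega> Y)
  ultimately show "(\<lambda>n. \<omega> (X n) * L2_norm (F (X n))) \<longlonglongrightarrow> 0"
    by (rule Lim_transform_eventually)
qed

lemma difference_quotient_tendsto:
  fixes y :: "real \<Rightarrow> complex"
  assumes "(y has_vector_derivative y') (at t within {0..})" and t: "t \<ge> 0"
    and s: "\<And>n. s n > t" "s \<longlonglongrightarrow> t"
  shows "(\<lambda>n. of_real (inverse (s n - t)) * (y (s n) - y t)) \<longlonglongrightarrow> y'"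
proof -
  have "filterlim s (at t within {0..}) sequentially"
    unfolding filterlim_at using s t by (auto intro!: always_eventually less_imp_le order_le_less_trans[of 0 t] simp: less_imp_neq[THEN not_sym])
  moreover have "((\<lambda>r. (1 / norm (r - t)) *\<^sub>R (y r - (y t + (r - t) *\<^sub>R y'))) \<longlongrightarrow> 0) (at t within {0..})"
    using assms(1) unfolding has_vector_derivative_def has_derivative_within by blast
  ultimately have "(\<lambda>n. (1 / norm (s n - t)) *\<^sub>R (y (s n) - (y t + (s n - t) *\<^sub>R y'))) \<longlonglongrightarrow> 0"
    by (rule filterlim_compose[rotated])
  moreover have "(1 / norm (s n - t)) *\<^sub>R (y (s n) - (y t + (s n - t) *\<^sub>R y')) =
      of_real (inverse (s n - t)) * (y (s n) - y t) - y'" for n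
  proof -
    have "s n - t > 0" using s(1) by simp
    then show ?thesis by (simp add: scaleR_conv_of_real field_simps)
  qed
  ultimately have "(\<lambda>n. of_real (inverse (s n - t)) * (y (s n) - y t) - y') \<longlonglongrightarrow> 0" by simp
  then show ?thesis by (simp only: LIM_zero_iff)
qed

text \<open>Two notions of derivative have to be matched. The transformed difference quotients tend
  to \<open>fourier (v' t)\<close> in L2, by the isometry, and to \<open>w' t\<close> pointwise, by
  the differential equation; a subsequence converging almost everywhere identifies the
  limits.\<close>

lemma fourier_time_derivative:
  fixes v v' :: "real \<Rightarrow> 'a::euclidean_space \<Rightarrow> complex"
  assumes C1: "C1_L2 v v'" and t: "t \<ge> 0"
    and w: "\<And>t. t \<ge> 0 \<Longrightarrow> AE \<xi> in lborel. w t \<xi> = fourier (v t) \<xi>"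
    and w': "AE \<xi> in lborel. ((\<lambda>t. w t \<xi>) has_vector_derivative w' t \<xi>) (at t within {0..})"
  shows "AE \<xi> in lborel. w' t \<xi> = fourier (v' t) \<xi>"
proof -
  have v: "v t \<in> L2" "v' t \<in> L2" if "t \<ge> 0" for t using C1 that by (simp_all add: C1_L2_def)
  \<comment> \<open>Approaching from the right includes the one-sided derivative at
    \<open>t = 0\<close>, needed for the initial velocity.\<close>
  define s where "s n = t + inverse (real (Suc n))" for n
  have s: "s n > t" "s \<longlonglongrightarrow> t" for n
    unfolding s_def using LIMSEQ_inverse_real_of_nat_add[of t] by (simp_all del: of_nat_Suc)
  have s0: "s n \<ge> 0" for n using s(1)[of n] t by simp
  define c where "c n = complex_of_real (inverse (s n - t))" for n
  define d where "d n = (\<lambda>x. c n * (v (s n) x - v t x))" for n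
  have d: "d n \<in> L2" for n unfolding d_def by (intro L2_cmult L2_diff v s0 t)
  have F_d: "AE \<xi> in lborel. fourier (d n) \<xi> = c n * (fourier (v (s n)) \<xi> - fourier (v t) \<xi>)" for n
    unfolding d_def by (rule fourier_diff_cmult[OF v(1)[OF s0] v(1)[OF t]])
  define e where "e n = (\<lambda>\<xi>. fourier (d n) \<xi> - fourier (v' t) \<xi>)" for n
  have e_L2: "e n \<in> L2" for n unfolding e_def by (intro L2_diff fourier_L2 d v t)
  have e_norm: "L2_norm (e n) = L2_norm (\<lambda>x. d n x - v' t x)" for n
  proof -
    have L: "(\<lambda>x. d n x - v' t x) \<in> L2" by (intro L2_diff d v t)
    have "AE \<xi> in lborel. fourier (\<lambda>x. d n x - v' t x) \<xi> = e n \<xi>"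
      using fourier_diff_cmult[OF d v(2)[OF t], of 1 n] by (simp add: e_def)
    then have "L2_norm (e n) = L2_norm (fourier (\<lambda>x. d n x - v' t x))"
      by (intro L2_norm_cong_AE L2_measurable e_L2 fourier_L2 L) (auto elim: AE_mp)
    also have "\<dots> = L2_norm (\<lambda>x. d n x - v' t x)" by (rule L2_norm_fourier[OF L])
    finally show ?thesis .
  qed
  have "filterlim s (at t within {0..}) sequentially"
    unfolding filterlim_at using s s0 by (auto intro!: always_eventually simp: less_imp_neq[THEN not_sym])
  moreover have "((\<lambda>s. L2_norm (\<lambda>x. (v s x - v t x) / of_real (s - t) - v' t x)) \<longlongrightarrow> 0) (at t within {0..})"
    using C1 t by (simp add: C1_L2_def)
  ultimately have "(\<lambda>n. L2_norm (\<lambda>x. (v (s n) x - v t x) / of_real (s n - t) - v' t x)) \<longlonglongrightarrow> 0"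
    by (rule filterlim_compose[rotated])
  moreover have "(\<lambda>x. (v (s n) x - v t x) / of_real (s n - t) - v' t x) = (\<lambda>x. d n x - v' t x)" for n
    unfolding d_def c_def of_real_inverse by (simp only: divide_inverse mult.commute)
  ultimately have "(\<lambda>n. L2_norm (e n)) \<longlonglongrightarrow> 0" unfolding e_norm by simp
  from L2_norm_tendsto_AE_subseq[OF e_L2 this]
  obtain r :: "nat \<Rightarrow> nat" where r: "strict_mono r" "AE \<xi> in lborel. (\<lambda>n. e (r n) \<xi>) \<longlonglongrightarrow> 0" by blast
  have AE_d: "AE \<xi> in lborel. \<forall>n. fourier (d n) \<xi> = c n * (fourier (v (s n)) \<xi> - fourier (v t) \<xi>)"
    unfolding AE_all_countable using F_d by blast
  have AE_w: "AE \<xi> in lborel. \<forall>n. w (s n) \<xi> = fourier (v (s n)) \<xi>"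
    unfolding AE_all_countable using w s0 by simp
  show ?thesis
    using r(2) AE_d AE_w w[OF t] w'
  proof eventually_elim
    case (elim \<xi>)
    have "(\<lambda>n. c n * (w (s n) \<xi> - w t \<xi>)) \<longlonglongrightarrow> w' t \<xi>"
      unfolding c_def by (rule difference_quotient_tendsto[OF elim(5) t s])
    then have "(\<lambda>n. fourier (d n) \<xi>) \<longlonglongrightarrow> w' t \<xi>"
      using elim(2-4) by simp
    from LIMSEQ_subseq_LIMSEQ[OF this r(1)]
    have 1: "(\<lambda>n. fourier (d (r n)) \<xi>) \<longlonglongrightarrow> w' t \<xi>" by (simp add: o_def)
    have "(\<lambda>n. fourier (d (r n)) \<xi>) \<longlonglongrightarrow> fourier (v' t) \<xi>"
      using elim(1) unfolding e_def by (simp only: LIM_zero_iff)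
    with 1 show ?case by (rule LIMSEQ_unique)
  qed
qed

lemma wave_solution_modes:
  fixes v v' :: "real \<Rightarrow> 'a::euclidean_space \<Rightarrow> complex"
  assumes sol: "wave_solution (\<lambda>t. \<mu>\<^sub>1 / (1 + t)) (\<lambda>t. \<mu>\<^sub>2 / (1 + t)\<^sup>2) v0 v1 v v'"
  obtains w w' where
    "\<And>t. t \<ge> 0 \<Longrightarrow> AE \<xi> in lborel. w t \<xi> = fourier (v t) \<xi>"
    "\<And>t. t \<ge> 0 \<Longrightarrow> AE \<xi> in lborel. w' t \<xi> = fourier (v' t) \<xi>"
    "AE \<xi> in lborel. norm \<xi> > 0 \<and> wave_mode \<mu>\<^sub>1 \<mu>\<^sub>2 ((norm \<xi>)\<^sup>2) (\<lambda>t. w t \<xi>) (\<lambda>t. w' t \<xi>)"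
proof -
  obtain w where w: "\<And>t. t \<ge> 0 \<Longrightarrow> AE \<xi> in lborel. w t \<xi> = fourier (v t) \<xi>"
    and ode: "AE \<xi> in lborel. \<exists>y'. solves_ode (\<lambda>t. \<mu>\<^sub>1 / (1 + t)) (\<lambda>t. \<mu>\<^sub>2 / (1 + t)\<^sup>2) ((norm \<xi>)\<^sup>2) (\<lambda>t. w t \<xi>) y'"
    using sol unfolding wave_solution_def by blast
  \<comment> \<open>\<open>wave_solution\<close> grants a derivative separately for each frequency;
    choosing one makes it a function of both variables.\<close>
  define w' where "w' t \<xi> = (SOME y'. solves_ode (\<lambda>t. \<mu>\<^sub>1 / (1 + t)) (\<lambda>t. \<mu>\<^sub>2 / (1 + t)\<^sup>2) ((norm \<xi>)\<^sup>2) (\<lambda>t. w t \<xi>) y') t" for t \<xi>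
  have ode': "AE \<xi> in lborel. solves_ode (\<lambda>t. \<mu>\<^sub>1 / (1 + t)) (\<lambda>t. \<mu>\<^sub>2 / (1 + t)\<^sup>2) ((norm \<xi>)\<^sup>2) (\<lambda>t. w t \<xi>) (\<lambda>t. w' t \<xi>)"
    using ode
  proof eventually_elim
    case (elim \<xi>)
    from someI_ex[OF this] show ?case unfolding w'_def .
  qed
  show thesis
  proof (rule that[OF w])
    fix t :: real assume t: "t \<ge> 0"
    have "AE \<xi> in lborel. ((\<lambda>t. w t \<xi>) has_vector_derivative w' t \<xi>) (at t within {0..})"
      using ode' by eventually_elim (use t in \<open>simp add: solves_ode_def\<close>)
    moreover have "C1_L2 v v'" using sol by (simp add: wave_solution_def)
    ultimately show "AE \<xi> in lborel. w' t \<xi> = fourier (v' t) \<xi>"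
      using t w by (intro fourier_time_derivative)
  next
    \<comment> \<open>At frequency 0 a weighted mode need not tend to zero, so this null set is
      discarded here.\<close>
    show "AE \<xi> in lborel. norm \<xi> > 0 \<and> wave_mode \<mu>\<^sub>1 \<mu>\<^sub>2 ((norm \<xi>)\<^sup>2) (\<lambda>t. w t \<xi>) (\<lambda>t. w' t \<xi>)"
      using ode' AE_lborel_singleton[of "0 :: 'a"]
      by eventually_elim (simp add: wave_mode_def)
  qed
qed

lemma damped_wave_decay:
  fixes v v' :: "real \<Rightarrow> 'a::euclidean_space \<Rightarrow> complex"
  assumes sol: "wave_solution (\<lambda>t. \<mu>\<^sub>1 / (1 + t)) (\<lambda>t. \<mu>\<^sub>2 / (1 + t)\<^sup>2) v0 v1 v v'"
    and \<mu>: "\<mu> = \<mu>\<^sub>1 * (2 - \<mu>\<^sub>1) / 4 + \<mu>\<^sub>2"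
  shows "((\<lambda>t. amplitude_weight \<mu> \<mu>\<^sub>1 t * L2_norm (v t)) \<longlongrightarrow> 0) at_top"
    and "\<mu> < 0 \<Longrightarrow> ((\<lambda>t. energy_weight \<mu> \<mu>\<^sub>1 t * Hdot1_L2_norm (v t) (v' t)) \<longlongrightarrow> 0) at_top"
proof -
  obtain w w' where
    w: "\<And>t. t \<ge> 0 \<Longrightarrow> AE \<xi> in lborel. w t \<xi> = fourier (v t) \<xi>"
    and w': "\<And>t. t \<ge> 0 \<Longrightarrow> AE \<xi> in lborel. w' t \<xi> = fourier (v' t) \<xi>"
    and modes: "AE \<xi> in lborel. norm \<xi> > 0 \<and> wave_mode \<mu>\<^sub>1 \<mu>\<^sub>2 ((norm \<xi>)\<^sup>2) (\<lambda>t. w t \<xi>) (\<lambda>t. w' t \<xi>)"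
    using wave_solution_modes[OF sol] by blast
  have v: "v t \<in> L2" "v' t \<in> L2" "(\<lambda>\<xi>. of_real (norm \<xi>) * fourier (v t) \<xi>) \<in> L2" if "t \<ge> 0" for t
    using sol that unfolding wave_solution_def cont_H1_def C1_L2_def H1_def by auto
  have F: "fourier (v t) \<in> L2" "fourier (v' t) \<in> L2" if "t \<ge> 0" for t
    using v[OF that] by (simp_all add: fourier_L2)
  obtain C where C: "C \<ge> 0" "\<And>k y y' t. wave_mode \<mu>\<^sub>1 \<mu>\<^sub>2 k y y' \<Longrightarrow> t \<ge> 0 \<Longrightarrow>
     amplitude_weight \<mu> \<mu>\<^sub>1 t * norm (y t) \<le> C * (norm (y 0) + norm (y' 0))"
    using amplitude_bound_uniform[of \<mu>\<^sub>1 \<mu>\<^sub>2] unfolding \<mu>[symmetric] by blast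
  \<comment> \<open>The common majorant, up to a constant, of all weighted modes; its square is
    integrable because the data lie in H1 and L2.\<close>
  define D where "D \<xi> = cmod (fourier (v 0) \<xi>) + cmod (fourier (v' 0) \<xi>) + norm \<xi> * cmod (fourier (v 0) \<xi>)" for \<xi>
  have D: "integrable lborel (\<lambda>\<xi>. (B * D \<xi>)\<^sup>2)" for B
  proof -
    have "(\<lambda>\<xi>. of_real (cmod (fourier (v 0) \<xi>)) + of_real (cmod (fourier (v' 0) \<xi>)) +
       of_real (cmod (of_real (norm \<xi>) * fourier (v 0) \<xi>))) \<in> L2"
      by (intro L2_add L2_cmod F v) simp_all
    from L2_integrable[OF this]
    have "integrable lborel (\<lambda>\<xi>. (cmod (of_real (D \<xi>)))\<^sup>2)"
      unfolding D_def by (simp add: norm_mult)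
    then show ?thesis by (simp add: power_mult_distrib)
  qed
  show "((\<lambda>t. amplitude_weight \<mu> \<mu>\<^sub>1 t * L2_norm (v t)) \<longlongrightarrow> 0) at_top"
  proof -
    have "((\<lambda>t. amplitude_weight \<mu> \<mu>\<^sub>1 t * L2_norm (fourier (v t))) \<longlongrightarrow> 0) at_top"
    proof (rule weighted_L2_norm_tendsto_0[OF F(1) amplitude_weight_nonneg w D])
      show "AE \<xi> in lborel. \<forall>t\<ge>0. amplitude_weight \<mu> \<mu>\<^sub>1 t * cmod (w t \<xi>) \<le> C * D \<xi>"
        using modes w[OF order_refl] w'[OF order_refl]
      proof eventually_elim
        case (elim \<xi>)
        have "C * (cmod (w 0 \<xi>) + cmod (w' 0 \<xi>)) \<le> C * D \<xi>"
          using C(1) unfolding D_def elim(2,3) by (intro mult_left_mono) auto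
        then show ?case using C(2)[of "(norm \<xi>)\<^sup>2" "\<lambda>t. w t \<xi>" "\<lambda>t. w' t \<xi>"] elim(1) by (blast intro: order_trans)
      qed
      show "AE \<xi> in lborel. ((\<lambda>t. amplitude_weight \<mu> \<mu>\<^sub>1 t * cmod (w t \<xi>)) \<longlongrightarrow> 0) at_top"
        using modes
      proof eventually_elim
        case (elim \<xi>)
        then interpret mode: wave_mode \<mu>\<^sub>1 \<mu>\<^sub>2 "(norm \<xi>)\<^sup>2" "\<lambda>t. w t \<xi>" "\<lambda>t. w' t \<xi>" by simp
        show ?case using mode.amplitude_tendsto_0 elim unfolding mode.\<mu>_def \<mu> by simp
      qed
    qed
    moreover have "\<forall>\<^sub>F t in at_top. amplitude_weight \<mu> \<mu>\<^sub>1 t * L2_norm (fourier (v t)) = amplitude_weight \<mu> \<mu>\<^sub>1 t * L2_norm (v t)"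
      using eventually_ge_at_top[of 0] by eventually_elim (simp add: L2_norm_fourier v)
    ultimately show ?thesis by (rule Lim_transform_eventually)
  qed
  assume neg: "\<mu> < 0"
  define B where "B = (Re (nu \<mu>) + \<bar>(\<mu>\<^sub>1 - 1) / 2\<bar> + 1) * (1 + C)"
  have energy: "AE \<xi> in lborel. (\<forall>t\<ge>0. energy_weight \<mu> \<mu>\<^sub>1 t * cmod (of_real (norm \<xi>) * w t \<xi>) \<le> B * D \<xi>) \<and>
      (\<forall>t\<ge>0. energy_weight \<mu> \<mu>\<^sub>1 t * cmod (w' t \<xi>) \<le> B * D \<xi>) \<and>
      ((\<lambda>t. energy_weight \<mu> \<mu>\<^sub>1 t * cmod (of_real (norm \<xi>) * w t \<xi>)) \<longlongrightarrow> 0) at_top \<and>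
      ((\<lambda>t. energy_weight \<mu> \<mu>\<^sub>1 t * cmod (w' t \<xi>)) \<longlongrightarrow> 0) at_top"
    using modes w[OF order_refl] w'[OF order_refl]
  proof eventually_elim
    case (elim \<xi>)
    then interpret mode: wave_mode \<mu>\<^sub>1 \<mu>\<^sub>2 "(norm \<xi>)\<^sup>2" "\<lambda>t. w t \<xi>" "\<lambda>t. w' t \<xi>" by simp
    have m: "mode.\<mu> = \<mu>" by (simp add: mode.\<mu>_def \<mu>)
    have B_eq: "(Re (nu mode.\<mu>) + \<bar>mode.r\<bar> + 1) * (1 + C) * (norm (w 0 \<xi>) + norm (w' 0 \<xi>) + sqrt ((norm \<xi>)\<^sup>2) * norm (w 0 \<xi>)) = B * D \<xi>"
      unfolding m mode.r_def B_def D_def elim(2,3) by simp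
    have amp: "amplitude_weight mode.\<mu> \<mu>\<^sub>1 t * norm (w t \<xi>) \<le> C * (norm (w 0 \<xi>) + norm (w' 0 \<xi>))" if "t \<ge> 0" for t
      unfolding m using C(2)[of "(norm \<xi>)\<^sup>2" "\<lambda>t. w t \<xi>" "\<lambda>t. w' t \<xi>"] elim(1) that by blast
    have bounds: "energy_weight \<mu> \<mu>\<^sub>1 t * (norm \<xi> * norm (w t \<xi>)) \<le> B * D \<xi>" "energy_weight \<mu> \<mu>\<^sub>1 t * norm (w' t \<xi>) \<le> B * D \<xi>"
      if t: "t \<ge> 0" for t
      using mode.energy_mode_bound[OF _ t C(1) amp[OF t]] neg unfolding B_eq unfolding m by simp_all
    have lims: "((\<lambda>t. energy_weight \<mu> \<mu>\<^sub>1 t * (norm \<xi> * norm (w t \<xi>))) \<longlongrightarrow> 0) at_top"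
      "((\<lambda>t. energy_weight \<mu> \<mu>\<^sub>1 t * norm (w' t \<xi>)) \<longlongrightarrow> 0) at_top"
      using mode.energy_mode_tendsto_0 neg elim(1) unfolding m by simp_all
    show ?case using bounds lims by (simp add: norm_mult)
  qed
  have H: "((\<lambda>t. energy_weight \<mu> \<mu>\<^sub>1 t * L2_norm (\<lambda>\<xi>. of_real (norm \<xi>) * fourier (v t) \<xi>)) \<longlongrightarrow> 0) at_top"
  proof (rule weighted_L2_norm_tendsto_0[OF v(3) energy_weight_nonneg _ D])
    show "AE \<xi> in lborel. of_real (norm \<xi>) * w t \<xi> = of_real (norm \<xi>) * fourier (v t) \<xi>" if "t \<ge> 0" for t
      using w[OF that] by eventually_elim simp
    show "AE \<xi> in lborel. \<forall>t\<ge>0. energy_weight \<mu> \<mu>\<^sub>1 t * cmod (of_real (norm \<xi>) * w t \<xi>) \<le> B * D \<xi>"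
      "AE \<xi> in lborel. ((\<lambda>t. energy_weight \<mu> \<mu>\<^sub>1 t * cmod (of_real (norm \<xi>) * w t \<xi>)) \<longlongrightarrow> 0) at_top"
      using energy by (eventually_elim, blast)+
  qed
  have "((\<lambda>t. energy_weight \<mu> \<mu>\<^sub>1 t * L2_norm (fourier (v' t))) \<longlongrightarrow> 0) at_top"
  proof (rule weighted_L2_norm_tendsto_0[OF F(2) energy_weight_nonneg w' D])
    show "AE \<xi> in lborel. \<forall>t\<ge>0. energy_weight \<mu> \<mu>\<^sub>1 t * cmod (w' t \<xi>) \<le> B * D \<xi>"
      "AE \<xi> in lborel. ((\<lambda>t. energy_weight \<mu> \<mu>\<^sub>1 t * cmod (w' t \<xi>)) \<longlongrightarrow> 0) at_top"
      using energy by (eventually_elim, blast)+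
  qed
  from tendsto_add[OF H this]
  have sum: "((\<lambda>t. energy_weight \<mu> \<mu>\<^sub>1 t * L2_norm (\<lambda>\<xi>. of_real (norm \<xi>) * fourier (v t) \<xi>) +
     energy_weight \<mu> \<mu>\<^sub>1 t * L2_norm (fourier (v' t))) \<longlongrightarrow> 0) at_top" by simp
  show "((\<lambda>t. energy_weight \<mu> \<mu>\<^sub>1 t * Hdot1_L2_norm (v t) (v' t)) \<longlongrightarrow> 0) at_top"
  proof (rule Lim_null_comparison[OF _ sum])
    show "\<forall>\<^sub>F t in at_top. norm (energy_weight \<mu> \<mu>\<^sub>1 t * Hdot1_L2_norm (v t) (v' t)) \<le>
      energy_weight \<mu> \<mu>\<^sub>1 t * L2_norm (\<lambda>\<xi>. of_real (norm \<xi>) * fourier (v t) \<xi>) +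
      energy_weight \<mu> \<mu>\<^sub>1 t * L2_norm (fourier (v' t))"
      using eventually_ge_at_top[of 0]
    proof eventually_elim
      case (elim t)
      have "Hdot1_L2_norm (v t) (v' t) \<le> Hdot1_norm (v t) + L2_norm (v' t)"
        unfolding Hdot1_L2_norm_def by (rule sqrt_sum_squares_le_sum) (simp_all add: Hdot1_norm_def)
      also have "\<dots> = L2_norm (\<lambda>\<xi>. of_real (norm \<xi>) * fourier (v t) \<xi>) + L2_norm (fourier (v' t))"
        using elim by (simp add: Hdot1_norm_def L2_norm_fourier v)
      finally have "energy_weight \<mu> \<mu>\<^sub>1 t * Hdot1_L2_norm (v t) (v' t) \<le>
          energy_weight \<mu> \<mu>\<^sub>1 t * (L2_norm (\<lambda>\<xi>. of_real (norm \<xi>) * fourier (v t) \<xi>) + L2_norm (fourier (v' t)))"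
        by (rule mult_left_mono[OF _ energy_weight_nonneg])
      moreover have "Hdot1_L2_norm (v t) (v' t) \<ge> 0" by (simp add: Hdot1_L2_norm_def)
      ultimately show ?case using energy_weight_nonneg[of \<mu> \<mu>\<^sub>1 t]
        by (simp add: abs_mult distrib_left)
    qed
  qed
qed

theorem theorem1p3:
  "(\<forall>(\<mu>::real) (v0 :: 'a::euclidean_space \<Rightarrow> complex) (v1 :: 'a \<Rightarrow> complex)
      (v :: real \<Rightarrow> 'a \<Rightarrow> complex) (v' :: real \<Rightarrow> 'a \<Rightarrow> complex).
      v0 \<in> H1 \<and> v1 \<in> L2 \<and>
      wave_solution (\<lambda>t. 0) (\<lambda>t. \<mu> / (1 + t)\<^sup>2) v0 v1 v v' \<longrightarrow>
        (\<mu> < 0 \<longrightarrow>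
          ((\<lambda>t. (1 + t) powr (1/2 - Re (nu \<mu>)) * Hdot1_L2_norm (v t) (v' t)) \<longlongrightarrow> 0) at_top) \<and>
        (\<mu> \<noteq> 1/4 \<longrightarrow>
          ((\<lambda>t. (1 + t) powr (- 1/2 - Re (nu \<mu>)) * L2_norm (v t)) \<longlongrightarrow> 0) at_top) \<and>
        (\<mu> = 1/4 \<longrightarrow>
          ((\<lambda>t. (1 + t) powr (- 1/2) * inverse (1 + ln (1 + t)) * L2_norm (v t)) \<longlongrightarrow> 0) at_top))
   \<and>
   (\<forall>(\<mu>\<^sub>1::real) (\<mu>\<^sub>2::real) (\<mu>::real) (u0 :: 'a \<Rightarrow> complex) (u1 :: 'a \<Rightarrow> complex)
      (u :: real \<Rightarrow> 'a \<Rightarrow> complex) (u' :: real \<Rightarrow> 'a \<Rightarrow> complex).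
      \<mu> = \<mu>\<^sub>1 * (2 - \<mu>\<^sub>1) / 4 + \<mu>\<^sub>2 \<and> u0 \<in> H1 \<and> u1 \<in> L2 \<and>
      wave_solution (\<lambda>t. \<mu>\<^sub>1 / (1 + t)) (\<lambda>t. \<mu>\<^sub>2 / (1 + t)\<^sup>2) u0 u1 u u' \<longrightarrow>
        (\<mu> < 0 \<longrightarrow>
          ((\<lambda>t. (1 + t) powr (1/2 - Re (nu \<mu>) + \<mu>\<^sub>1 / 2) * Hdot1_L2_norm (u t) (u' t)) \<longlongrightarrow> 0) at_top) \<and>
        (\<mu> \<noteq> 1/4 \<longrightarrow>
          ((\<lambda>t. (1 + t) powr (- 1/2 - Re (nu \<mu>) + \<mu>\<^sub>1 / 2) * L2_norm (u t)) \<longlongrightarrow> 0) at_top) \<and>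
        (\<mu> = 1/4 \<longrightarrow>
          ((\<lambda>t. (1 + t) powr (- 1/2 + \<mu>\<^sub>1 / 2) * inverse (1 + ln (1 + t)) * L2_norm (u t)) \<longlongrightarrow> 0) at_top))"
proof -
  have main: "(\<mu> < 0 \<longrightarrow>
          ((\<lambda>t. (1 + t) powr (1/2 - Re (nu \<mu>) + \<mu>\<^sub>1 / 2) * Hdot1_L2_norm (u t) (u' t)) \<longlongrightarrow> 0) at_top) \<and>
        (\<mu> \<noteq> 1/4 \<longrightarrow>
          ((\<lambda>t. (1 + t) powr (- 1/2 - Re (nu \<mu>) + \<mu>\<^sub>1 / 2) * L2_norm (u t)) \<longlongrightarrow> 0) at_top) \<and>
        (\<mu> = 1/4 \<longrightarrow>
          ((\<lambda>t. (1 + t) powr (- 1/2 + \<mu>\<^sub>1 / 2) * inverse (1 + ln (1 + t)) * L2_norm (u t)) \<longlongrightarrow> 0) at_top)"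
    if \<mu>: "\<mu> = \<mu>\<^sub>1 * (2 - \<mu>\<^sub>1) / 4 + \<mu>\<^sub>2"
      and sol: "wave_solution (\<lambda>t. \<mu>\<^sub>1 / (1 + t)) (\<lambda>t. \<mu>\<^sub>2 / (1 + t)\<^sup>2) u0 u1 u u'"
    for \<mu>\<^sub>1 \<mu>\<^sub>2 \<mu> and u0 u1 :: "'a \<Rightarrow> complex" and u u'
  proof (intro conjI impI)
    note amp = damped_wave_decay(1)[OF sol \<mu>]
    show "((\<lambda>t. (1 + t) powr (1/2 - Re (nu \<mu>) + \<mu>\<^sub>1 / 2) * Hdot1_L2_norm (u t) (u' t)) \<longlongrightarrow> 0) at_top"
      if "\<mu> < 0"
      using damped_wave_decay(2)[OF sol \<mu> that] unfolding energy_weight_def .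
    show "((\<lambda>t. (1 + t) powr (- 1/2 - Re (nu \<mu>) + \<mu>\<^sub>1 / 2) * L2_norm (u t)) \<longlongrightarrow> 0) at_top"
      if "\<mu> \<noteq> 1/4"
      using amp that by (simp only: amplitude_weight_def if_False)
    show "((\<lambda>t. (1 + t) powr (- 1/2 + \<mu>\<^sub>1 / 2) * inverse (1 + ln (1 + t)) * L2_norm (u t)) \<longlongrightarrow> 0) at_top"
      if "\<mu> = 1/4"
      using amp by (simp only: amplitude_weight_def that if_True simp_thms)
  qed
  \<comment> \<open>Part (i) is the case \<open>\<mu>\<^sub>1 = 0\<close>: unfolding turns the
    damping coefficient \<open>0 / (1 + t)\<close> into 0, removes \<open>0 / 2\<close> from the
    exponents, and reduces the condition on \<open>\<mu>\<close> to an equation closed by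
    \<open>refl\<close>.\<close>
  note undamped = main[where \<mu>\<^sub>1 = 0, unfolded mult_zero_left div_0 add_0_left add_0_right, OF refl]
  show ?thesis
    by (rule conjI) (use undamped in blast, use main in blast)
qed

end
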